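(* Let $\phi:k\to S$ be a ring homomorphism such that $S$ is flat as a left $k$-module, and let $n\ge3$. Let $A$ be the ring of lower triangular $n\times n$ matrices with diagonal entries in $k$ and entries below the diagonal in $S$. Let $P_i$ ($1\le i\le n$) be the left $A$-module given by the $i$-th column of $A$, and let $\sigma$ be the set of the $A$-module maps $s_i:P_n\to P_i$ described in the context. Then the ring homomorphism $A\to M_n(S)$ is universally $\sigma$-inverting, that is, $$\sigma^{-1}A= M_n(S).$$
   Context: Rings are associative with $1$, not necessarily commutative. The ring $$A=\begin{pmatrix} k&0&\cdots&0\\ S&k&\cdots&0\\ \vdots&\vdots&\ddots&\vdots\\ S&S&\cdots&k\end{pmatrix}$$ maps to $M_n(S)$ via $\phi$ on the diagonal entries. The left $A$-module $P_i$ consists of columns whose entries in rows $<i$ are $0$, whose entry in row $i$ lies in $k$, and whose entries in rows $>i$ lie in $S$; thus $A=P_1\oplus\cdots\oplus P_n$ as a left $A$-module. The map $s_i:P_n\to P_i$ sends the column with bottom entry $x\in k$ to the column with bottom entry $\phi(x)\in S$ and all other entries $0$ (for $i=n$ it is the identity of $P_n$). A ring homomorphism $A\to B$ is $\sigma$-inverting if $1\otimes s:B\otimes_AP\to B\otimes_AQ$ is an isomorphism for every $s:P\to Q$ in $\sigma$. It is universally $\sigma$-inverting if it is $\sigma$-inverting and every $\sigma$-inverting ring homomorphism $A\to T$ factors uniquely through $A\to B$; one then writes $B=\sigma^{-1}A$. *)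

theory Defs
  imports "HOL-Algebra.Free_Abelian_Groups" "HOL-Algebra.Module" "HOL-Algebra.RingHom"
begin

section \<open>Modules over noncommutative rings\<close>

text \<open>
  The library locale \<open>module\<close> assumes a commutative ring of scalars, but its record type
  \<open>('r, 'm) module\<close> can be reused. As usual, the fields \<open>mult\<close> and \<open>one\<close> of a module are
  irrelevant.
\<close>

locale left_module = R?: ring R + M?: abelian_group M for R (structure) and M (structure) +
  assumes smult_closed:
      "\<lbrakk>a \<in> carrier R; x \<in> carrier M\<rbrakk> \<Longrightarrow> a \<odot>\<^bsub>M\<^esub> x \<in> carrier M"
    and smult_l_distr:
      "\<lbrakk>a \<in> carrier R; b \<in> carrier R; x \<in> carrier M\<rbrakk> \<Longrightarrow>
        (a \<oplus>\<^bsub>R\<^esub> b) \<odot>\<^bsub>M\<^esub> x = a \<odot>\<^bsub>M\<^esub> x \<oplus>\<^bsub>M\<^esub> b \<odot>\<^bsub>M\<^esub> x"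
    and smult_r_distr:
      "\<lbrakk>a \<in> carrier R; x \<in> carrier M; y \<in> carrier M\<rbrakk> \<Longrightarrow>
        a \<odot>\<^bsub>M\<^esub> (x \<oplus>\<^bsub>M\<^esub> y) = a \<odot>\<^bsub>M\<^esub> x \<oplus>\<^bsub>M\<^esub> a \<odot>\<^bsub>M\<^esub> y"
    and smult_assoc:
      "\<lbrakk>a \<in> carrier R; b \<in> carrier R; x \<in> carrier M\<rbrakk> \<Longrightarrow>
        (a \<otimes>\<^bsub>R\<^esub> b) \<odot>\<^bsub>M\<^esub> x = a \<odot>\<^bsub>M\<^esub> (b \<odot>\<^bsub>M\<^esub> x)"
    and smult_one:
      "x \<in> carrier M \<Longrightarrow> \<one>\<^bsub>R\<^esub> \<odot>\<^bsub>M\<^esub> x = x"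

text \<open>In a right module, \<open>a \<odot> x\<close> stands for $x \cdot a$; this only affects associativity.\<close>

locale right_module = R?: ring R + M?: abelian_group M for R (structure) and M (structure) +
  assumes smult_closed:
      "\<lbrakk>a \<in> carrier R; x \<in> carrier M\<rbrakk> \<Longrightarrow> a \<odot>\<^bsub>M\<^esub> x \<in> carrier M"
    and smult_l_distr:
      "\<lbrakk>a \<in> carrier R; b \<in> carrier R; x \<in> carrier M\<rbrakk> \<Longrightarrow>
        (a \<oplus>\<^bsub>R\<^esub> b) \<odot>\<^bsub>M\<^esub> x = a \<odot>\<^bsub>M\<^esub> x \<oplus>\<^bsub>M\<^esub> b \<odot>\<^bsub>M\<^esub> x"
    and smult_r_distr:
      "\<lbrakk>a \<in> carrier R; x \<in> carrier M; y \<in> carrier M\<rbrakk> \<Longrightarrow>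
        a \<odot>\<^bsub>M\<^esub> (x \<oplus>\<^bsub>M\<^esub> y) = a \<odot>\<^bsub>M\<^esub> x \<oplus>\<^bsub>M\<^esub> a \<odot>\<^bsub>M\<^esub> y"
    and smult_assoc:
      "\<lbrakk>a \<in> carrier R; b \<in> carrier R; x \<in> carrier M\<rbrakk> \<Longrightarrow>
        (a \<otimes>\<^bsub>R\<^esub> b) \<odot>\<^bsub>M\<^esub> x = b \<odot>\<^bsub>M\<^esub> (a \<odot>\<^bsub>M\<^esub> x)"
    and smult_one:
      "x \<in> carrier M \<Longrightarrow> \<one>\<^bsub>R\<^esub> \<odot>\<^bsub>M\<^esub> x = x"

definition linear_hom ::
    "('r, 'x) ring_scheme \<Rightarrow> ('r, 'm) module \<Rightarrow> ('r, 'n) module \<Rightarrow> ('m \<Rightarrow> 'n) set" where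
  "linear_hom R M N = {h \<in> carrier M \<rightarrow> carrier N.
     (\<forall>x\<in>carrier M. \<forall>y\<in>carrier M. h (x \<oplus>\<^bsub>M\<^esub> y) = h x \<oplus>\<^bsub>N\<^esub> h y) \<and>
     (\<forall>a\<in>carrier R. \<forall>x\<in>carrier M. h (a \<odot>\<^bsub>M\<^esub> x) = a \<odot>\<^bsub>N\<^esub> h x)}"

definition linear_iso ::
    "('r, 'x) ring_scheme \<Rightarrow> ('r, 'm) module \<Rightarrow> ('r, 'n) module \<Rightarrow> ('m \<Rightarrow> 'n) set" where
  "linear_iso R M N = {h \<in> linear_hom R M N. bij_betw h (carrier M) (carrier N)}"

definition left_restrict :: "('r \<Rightarrow> 's) \<Rightarrow> 's ring \<Rightarrow> ('r, 's) module" where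
  "left_restrict f S = \<lparr>carrier = carrier S, mult = mult S, one = one S, zero = zero S,
     add = add S, smult = (\<lambda>a x. f a \<otimes>\<^bsub>S\<^esub> x)\<rparr>"

definition right_restrict :: "('r \<Rightarrow> 's) \<Rightarrow> 's ring \<Rightarrow> ('r, 's) module" where
  "right_restrict f S = \<lparr>carrier = carrier S, mult = mult S, one = one S, zero = zero S,
     add = add S, smult = (\<lambda>a x. x \<otimes>\<^bsub>S\<^esub> f a)\<rparr>"


section \<open>Tensor products\<close>

definition tensor_relations ::
    "('r, 'x) ring_scheme \<Rightarrow> ('r, 'm) module \<Rightarrow> ('r, 'n) module \<Rightarrow> ('m \<times> 'n \<Rightarrow>\<^sub>0 int) set" where
  "tensor_relations R M N =
     {frag_of (x \<oplus>\<^bsub>M\<^esub> x', y) - frag_of (x, y) - frag_of (x', y) | x x' y.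
        x \<in> carrier M \<and> x' \<in> carrier M \<and> y \<in> carrier N} \<union>
     {frag_of (x, y \<oplus>\<^bsub>N\<^esub> y') - frag_of (x, y) - frag_of (x, y') | x y y'.
        x \<in> carrier M \<and> y \<in> carrier N \<and> y' \<in> carrier N} \<union>
     {frag_of (a \<odot>\<^bsub>M\<^esub> x, y) - frag_of (x, a \<odot>\<^bsub>N\<^esub> y) | a x y.
        a \<in> carrier R \<and> x \<in> carrier M \<and> y \<in> carrier N}"

definition tensor_kernel ::
    "('r, 'x) ring_scheme \<Rightarrow> ('r, 'm) module \<Rightarrow> ('r, 'n) module \<Rightarrow> ('m \<times> 'n \<Rightarrow>\<^sub>0 int) set" where
  "tensor_kernel R M N =
     generate (free_Abelian_group (carrier M \<times> carrier N)) (tensor_relations R M N)"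

text \<open>The Abelian group \<open>M \<otimes>\<^sub>R N\<close> for a right module \<open>M\<close> and a left module \<open>N\<close>, in the
  multiplicative notation of \<open>monoid\<close> records.\<close>

definition tensor ::
    "('r, 'x) ring_scheme \<Rightarrow> ('r, 'm) module \<Rightarrow> ('r, 'n) module \<Rightarrow> ('m \<times> 'n \<Rightarrow>\<^sub>0 int) set monoid" where
  "tensor R M N = free_Abelian_group (carrier M \<times> carrier N) Mod tensor_kernel R M N"

text \<open>The map \<open>f \<otimes> g : M \<otimes>\<^sub>R N \<rightarrow> M' \<otimes>\<^sub>R N'\<close> sends the coset of $\sum_i c_i (x_i, y_i)$ to the
  coset of $\sum_i c_i (f(x_i), g(y_i))$. When \<open>f\<close> and \<open>g\<close> are linear, all the cosets in
  the union below coincide.\<close>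

definition tensor_map ::
    "('r, 'x) ring_scheme \<Rightarrow> ('r, 'm1) module \<Rightarrow> ('r, 'n1) module \<Rightarrow> ('m \<Rightarrow> 'm1) \<Rightarrow> ('n \<Rightarrow> 'n1) \<Rightarrow>
     ('m \<times> 'n \<Rightarrow>\<^sub>0 int) set \<Rightarrow> ('m1 \<times> 'n1 \<Rightarrow>\<^sub>0 int) set" where
  "tensor_map R M' N' f g X =
     (\<Union>c\<in>X. tensor_kernel R M' N' #>\<^bsub>free_Abelian_group (carrier M' \<times> carrier N')\<^esub>
        frag_extend (\<lambda>(x, y). frag_of (f x, g y)) c)"

text \<open>\<open>B \<otimes>\<^sub>A P\<close> as a left \<open>B\<close>-module, along a ring homomorphism \<open>f : A \<rightarrow> B\<close>.\<close>

definition base_change ::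
    "'a ring \<Rightarrow> 'b ring \<Rightarrow> ('a \<Rightarrow> 'b) \<Rightarrow> ('a, 'p) module \<Rightarrow> ('b, ('b \<times> 'p \<Rightarrow>\<^sub>0 int) set) module" where
  "base_change A B f P =
     (let G = tensor A (right_restrict f B) P in
      \<lparr>carrier = carrier G, mult = undefined, one = undefined, zero = one G, add = mult G,
       smult = (\<lambda>b. tensor_map A (right_restrict f B) P (\<lambda>x. b \<otimes>\<^bsub>B\<^esub> x) id)\<rparr>)"

definition base_change_map ::
    "'a ring \<Rightarrow> 'b ring \<Rightarrow> ('a \<Rightarrow> 'b) \<Rightarrow> ('a, 'q) module \<Rightarrow> ('p \<Rightarrow> 'q) \<Rightarrow>
     ('b \<times> 'p \<Rightarrow>\<^sub>0 int) set \<Rightarrow> ('b \<times> 'q \<Rightarrow>\<^sub>0 int) set" where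
  "base_change_map A B f Q s = tensor_map A (right_restrict f B) Q id s"


section \<open>Flatness\<close>

text \<open>Tensoring with \<open>N\<close> preserves injectivity of maps between right modules with elements
  in the type \<open>'m\<close>.\<close>

definition flat_on :: "'m itself \<Rightarrow> ('r, 'x) ring_scheme \<Rightarrow> ('r, 'n) module \<Rightarrow> bool" where
  "flat_on _ R N \<longleftrightarrow>
     (\<forall>(M :: ('r, 'm) module) (M' :: ('r, 'm) module). \<forall>h.
        right_module R M \<longrightarrow> right_module R M' \<longrightarrow> h \<in> linear_hom R M M' \<longrightarrow>
        inj_on h (carrier M) \<longrightarrow>
        inj_on (tensor_map R M' N h id) (carrier (tensor R M N)))"

text \<open>HOL cannot quantify over all types inside a formula. The type \<open>(nat \<Rightarrow> 'r) set\<close> holds,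
  up to isomorphism, all finitely generated right modules and their submodules, and these
  suffice: see \<open>flat_imp_flat_on\<close> below.\<close>

definition flat :: "('r, 'x) ring_scheme \<Rightarrow> ('r, 'n) module \<Rightarrow> bool" where
  "flat R N \<longleftrightarrow> flat_on TYPE((nat \<Rightarrow> 'r) set) R N"


section \<open>Universal localization\<close>

text \<open>A set \<open>\<sigma>\<close> of maps of left modules is given by triples \<open>(P, Q, s)\<close> with \<open>s : P \<rightarrow> Q\<close>.\<close>

definition inverting ::
    "'a ring \<Rightarrow> (('a, 'p) module \<times> ('a, 'p) module \<times> ('p \<Rightarrow> 'p)) set \<Rightarrow> 'b ring \<Rightarrow> ('a \<Rightarrow> 'b) \<Rightarrow> bool" where
  "inverting A \<sigma> B f \<longleftrightarrow>
     ring A \<and> ring B \<and> f \<in> ring_hom A B \<and>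
     (\<forall>(P, Q, s) \<in> \<sigma>.
        base_change_map A B f Q s \<in> linear_iso B (base_change A B f P) (base_change A B f Q))"

text \<open>The competing rings \<open>T\<close> have their elements in the type \<open>'t\<close>; a theorem that leaves \<open>'t\<close>
  free asserts the universal property for all rings. Uniqueness is uniqueness on
  \<open>carrier B\<close>, hence the restriction to \<open>extensional\<close>.\<close>

definition universally_inverting ::
    "'t itself \<Rightarrow> 'a ring \<Rightarrow> (('a, 'p) module \<times> ('a, 'p) module \<times> ('p \<Rightarrow> 'p)) set \<Rightarrow>
     'b ring \<Rightarrow> ('a \<Rightarrow> 'b) \<Rightarrow> bool" where
  "universally_inverting _ A \<sigma> B f \<longleftrightarrow>
     inverting A \<sigma> B f \<and>
     (\<forall>(T :: 't ring) h. inverting A \<sigma> T h \<longrightarrow>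
        (\<exists>!g. g \<in> ring_hom B T \<inter> extensional (carrier B) \<and> (\<forall>a\<in>carrier A. g (f a) = h a)))"


section \<open>Matrix rings\<close>

definition matrix_ring :: "nat \<Rightarrow> 's ring \<Rightarrow> (nat \<times> nat \<Rightarrow> 's) ring" where
  "matrix_ring n S =
     \<lparr>carrier = {1..n} \<times> {1..n} \<rightarrow>\<^sub>E carrier S,
      mult = (\<lambda>a b. restrict (\<lambda>(i, j). \<Oplus>\<^bsub>S\<^esub>l\<in>{1..n}. a (i, l) \<otimes>\<^bsub>S\<^esub> b (l, j)) ({1..n} \<times> {1..n})),
      one = restrict (\<lambda>(i, j). if i = j then \<one>\<^bsub>S\<^esub> else \<zero>\<^bsub>S\<^esub>) ({1..n} \<times> {1..n}),
      zero = restrict (\<lambda>_. \<zero>\<^bsub>S\<^esub>) ({1..n} \<times> {1..n}),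
      add = (\<lambda>a b. restrict (\<lambda>ij. a ij \<oplus>\<^bsub>S\<^esub> b ij) ({1..n} \<times> {1..n}))\<rparr>"

text \<open>An element of \<open>A\<close> is a pair of its diagonal (over \<open>k\<close>) and its entries below the diagonal
  (over \<open>S\<close>). Since \<open>k\<close> acts on \<open>S\<close> through \<open>\<phi>\<close>, the entries of a product below the diagonal can
  be computed in $M_n(S)$, from the images \<open>triangular_entry\<close> of the entries.\<close>

definition below_diagonal :: "nat \<Rightarrow> (nat \<times> nat) set" where
  "below_diagonal n = {(i, j). 1 \<le> j \<and> j < i \<and> i \<le> n}"

definition triangular_entry ::
    "'s ring \<Rightarrow> ('k \<Rightarrow> 's) \<Rightarrow> (nat \<Rightarrow> 'k) \<times> (nat \<times> nat \<Rightarrow> 's) \<Rightarrow> nat \<times> nat \<Rightarrow> 's" where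
  "triangular_entry S \<phi> a = (\<lambda>(i, j).
     if i = j then \<phi> (fst a i) else if j < i then snd a (i, j) else \<zero>\<^bsub>S\<^esub>)"

definition triangular_ring ::
    "nat \<Rightarrow> 'k ring \<Rightarrow> 's ring \<Rightarrow> ('k \<Rightarrow> 's) \<Rightarrow> ((nat \<Rightarrow> 'k) \<times> (nat \<times> nat \<Rightarrow> 's)) ring" where
  "triangular_ring n k S \<phi> =
     \<lparr>carrier = ({1..n} \<rightarrow>\<^sub>E carrier k) \<times> (below_diagonal n \<rightarrow>\<^sub>E carrier S),
      mult = (\<lambda>a b. (\<lambda>i\<in>{1..n}. fst a i \<otimes>\<^bsub>k\<^esub> fst b i,
        restrict (\<lambda>(i, j). \<Oplus>\<^bsub>S\<^esub>l\<in>{1..n}.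
          triangular_entry S \<phi> a (i, l) \<otimes>\<^bsub>S\<^esub> triangular_entry S \<phi> b (l, j)) (below_diagonal n))),
      one = (\<lambda>i\<in>{1..n}. \<one>\<^bsub>k\<^esub>, \<lambda>ij\<in>below_diagonal n. \<zero>\<^bsub>S\<^esub>),
      zero = (\<lambda>i\<in>{1..n}. \<zero>\<^bsub>k\<^esub>, \<lambda>ij\<in>below_diagonal n. \<zero>\<^bsub>S\<^esub>),
      add = (\<lambda>a b. (\<lambda>i\<in>{1..n}. fst a i \<oplus>\<^bsub>k\<^esub> fst b i,
        \<lambda>ij\<in>below_diagonal n. snd a ij \<oplus>\<^bsub>S\<^esub> snd b ij))\<rparr>"

definition triangular_to_matrix ::
    "nat \<Rightarrow> 's ring \<Rightarrow> ('k \<Rightarrow> 's) \<Rightarrow> (nat \<Rightarrow> 'k) \<times> (nat \<times> nat \<Rightarrow> 's) \<Rightarrow> nat \<times> nat \<Rightarrow> 's" where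
  "triangular_to_matrix n S \<phi> a = restrict (triangular_entry S \<phi> a) ({1..n} \<times> {1..n})"

text \<open>The columns $P_i$, stored in the same way: \<open>fst c\<close> is the entry in row \<open>i\<close>, \<open>snd c\<close>
  holds the entries in the rows below it, and \<open>column_entry\<close> gives the images in \<open>S\<close>.\<close>

definition column_entry :: "'s ring \<Rightarrow> ('k \<Rightarrow> 's) \<Rightarrow> nat \<Rightarrow> 'k \<times> (nat \<Rightarrow> 's) \<Rightarrow> nat \<Rightarrow> 's" where
  "column_entry S \<phi> i c r = (if r = i then \<phi> (fst c) else if i < r then snd c r else \<zero>\<^bsub>S\<^esub>)"

definition column_module ::
    "nat \<Rightarrow> 'k ring \<Rightarrow> 's ring \<Rightarrow> ('k \<Rightarrow> 's) \<Rightarrow> nat \<Rightarrow>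
     ((nat \<Rightarrow> 'k) \<times> (nat \<times> nat \<Rightarrow> 's), 'k \<times> (nat \<Rightarrow> 's)) module" where
  "column_module n k S \<phi> i =
     \<lparr>carrier = carrier k \<times> ({i<..n} \<rightarrow>\<^sub>E carrier S), mult = undefined, one = undefined,
      zero = (\<zero>\<^bsub>k\<^esub>, \<lambda>r\<in>{i<..n}. \<zero>\<^bsub>S\<^esub>),
      add = (\<lambda>c d. (fst c \<oplus>\<^bsub>k\<^esub> fst d, \<lambda>r\<in>{i<..n}. snd c r \<oplus>\<^bsub>S\<^esub> snd d r)),
      smult = (\<lambda>a c. (fst a i \<otimes>\<^bsub>k\<^esub> fst c,
        \<lambda>r\<in>{i<..n}. \<Oplus>\<^bsub>S\<^esub>l\<in>{1..n}. triangular_entry S \<phi> a (r, l) \<otimes>\<^bsub>S\<^esub> column_entry S \<phi> i c l))\<rparr>"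

definition column_map ::
    "nat \<Rightarrow> 'k ring \<Rightarrow> 's ring \<Rightarrow> ('k \<Rightarrow> 's) \<Rightarrow> nat \<Rightarrow> 'k \<times> (nat \<Rightarrow> 's) \<Rightarrow> 'k \<times> (nat \<Rightarrow> 's)" where
  "column_map n k S \<phi> i c =
     (if i = n then c
      else (\<zero>\<^bsub>k\<^esub>, \<lambda>r\<in>{i<..n}. if r = n then \<phi> (fst c) else \<zero>\<^bsub>S\<^esub>))"

definition column_maps ::
    "nat \<Rightarrow> 'k ring \<Rightarrow> 's ring \<Rightarrow> ('k \<Rightarrow> 's) \<Rightarrow>
     (((nat \<Rightarrow> 'k) \<times> (nat \<times> nat \<Rightarrow> 's), 'k \<times> (nat \<Rightarrow> 's)) module \<times>
      ((nat \<Rightarrow> 'k) \<times> (nat \<times> nat \<Rightarrow> 's), 'k \<times> (nat \<Rightarrow> 's)) module \<times>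
      ('k \<times> (nat \<Rightarrow> 's) \<Rightarrow> 'k \<times> (nat \<Rightarrow> 's))) set" where
  "column_maps n k S \<phi> =
     {(column_module n k S \<phi> n, column_module n k S \<phi> i, column_map n k S \<phi> i) | i. i \<in> {1..n}}"


section \<open>Flatness can be tested on one type\<close>

lemma keys_diff_subset: "Poly_Mapping.keys a \<subseteq> X \<Longrightarrow> Poly_Mapping.keys b \<subseteq> X \<Longrightarrow> Poly_Mapping.keys (a - b) \<subseteq> X"
  for a b :: "'x \<Rightarrow>\<^sub>0 int"
  using keys_diff[of a b] by blast

lemma tensor_relationsI:
  "\<lbrakk>x \<in> carrier M; x' \<in> carrier M; y \<in> carrier N\<rbrakk> \<Longrightarrow>
    frag_of (x \<oplus>\<^bsub>M\<^esub> x', y) - frag_of (x, y) - frag_of (x', y) \<in> tensor_relations R M N"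
  "\<lbrakk>x \<in> carrier M; y \<in> carrier N; y' \<in> carrier N\<rbrakk> \<Longrightarrow>
    frag_of (x, y \<oplus>\<^bsub>N\<^esub> y') - frag_of (x, y) - frag_of (x, y') \<in> tensor_relations R M N"
  "\<lbrakk>a \<in> carrier R; x \<in> carrier M; y \<in> carrier N\<rbrakk> \<Longrightarrow>
    frag_of (a \<odot>\<^bsub>M\<^esub> x, y) - frag_of (x, a \<odot>\<^bsub>N\<^esub> y) \<in> tensor_relations R M N"
  unfolding tensor_relations_def by blast+

lemma tensor_relationsE [consumes 1, case_names left right balanced]:
  assumes "c \<in> tensor_relations R M N"
  obtains x x' y where "x \<in> carrier M" "x' \<in> carrier M" "y \<in> carrier N"
      "c = frag_of (x \<oplus>\<^bsub>M\<^esub> x', y) - frag_of (x, y) - frag_of (x', y)"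
    | x y y' where "x \<in> carrier M" "y \<in> carrier N" "y' \<in> carrier N"
      "c = frag_of (x, y \<oplus>\<^bsub>N\<^esub> y') - frag_of (x, y) - frag_of (x, y')"
    | a x y where "a \<in> carrier R" "x \<in> carrier M" "y \<in> carrier N"
      "c = frag_of (a \<odot>\<^bsub>M\<^esub> x, y) - frag_of (x, a \<odot>\<^bsub>N\<^esub> y)"
  using assms unfolding tensor_relations_def by blast

lemma tensor_relations_keys:
  assumes "left_module R N" "right_module R M" "c \<in> tensor_relations R M N"
  shows "Poly_Mapping.keys c \<subseteq> carrier M \<times> carrier N"
proof -
  interpret N: left_module R N by fact
  interpret M: right_module R M by fact
  show ?thesis
    using assms(3) unfolding tensor_relations_def
    by (auto simp: N.smult_closed M.smult_closed simp del: One_nat_def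
        intro!: keys_diff_subset dest!: subsetD[OF keys_diff] split: if_splits)
qed

context
  fixes R :: "('r, 'x) ring_scheme" and M :: "('r, 'm) module" and N :: "('r, 'n) module"
  assumes N: "left_module R N" and M: "right_module R M"
begin

lemma tensor_kernel_subgroup:
  "subgroup (tensor_kernel R M N) (free_Abelian_group (carrier M \<times> carrier N))"
  unfolding tensor_kernel_def
  by (rule group.generate_is_subgroup) (use tensor_relations_keys[OF N M] in auto)

lemma tensor_kernel_keys:
  "c \<in> tensor_kernel R M N \<Longrightarrow> Poly_Mapping.keys c \<subseteq> carrier M \<times> carrier N"
  using subsetD[OF subgroup.subset[OF tensor_kernel_subgroup]]
  by (simp add: carrier_free_Abelian_group_iff)

lemma tensor_kernel_0: "0 \<in> tensor_kernel R M N"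
  using subgroup.one_closed[OF tensor_kernel_subgroup] by simp

lemma tensor_kernel_add:
  "c \<in> tensor_kernel R M N \<Longrightarrow> d \<in> tensor_kernel R M N \<Longrightarrow> c + d \<in> tensor_kernel R M N"
  using subgroup.m_closed[OF tensor_kernel_subgroup] by simp

lemma tensor_kernel_minus:
  assumes "c \<in> tensor_kernel R M N" shows "- c \<in> tensor_kernel R M N"
  using subgroup.m_inv_closed[OF tensor_kernel_subgroup assms]
    inv_free_Abelian_group[OF tensor_kernel_keys[OF assms]] by simp

lemma tensor_kernel_diff:
  "c \<in> tensor_kernel R M N \<Longrightarrow> d \<in> tensor_kernel R M N \<Longrightarrow> c - d \<in> tensor_kernel R M N"
  using tensor_kernel_add[of c "- d"] tensor_kernel_minus[of d] by simp

lemma tensor_kernel_relation: "c \<in> tensor_relations R M N \<Longrightarrow> c \<in> tensor_kernel R M N"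
  unfolding tensor_kernel_def by (rule generate.incl)

lemma tensor_kernel_induct [consumes 1, case_names zero relation minus add]:
  assumes "c \<in> tensor_kernel R M N" "P 0"
    "\<And>c. c \<in> tensor_relations R M N \<Longrightarrow> P c"
    "\<And>c. c \<in> tensor_relations R M N \<Longrightarrow> P c \<Longrightarrow> P (- c)"
    "\<And>c d. P c \<Longrightarrow> P d \<Longrightarrow> P (c + d)"
  shows "P c"
  using assms(1) unfolding tensor_kernel_def
proof (induction rule: generate.induct)
  case (inv h)
  then show ?case using assms tensor_relations_keys[OF N M] by simp
qed (use assms in auto)

lemma tensor_coset_eq_iff:
  assumes "Poly_Mapping.keys c \<subseteq> carrier M \<times> carrier N" "Poly_Mapping.keys d \<subseteq> carrier M \<times> carrier N"
  shows "tensor_kernel R M N #>\<^bsub>free_Abelian_group (carrier M \<times> carrier N)\<^esub> c =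
         tensor_kernel R M N #>\<^bsub>free_Abelian_group (carrier M \<times> carrier N)\<^esub> d \<longleftrightarrow>
         c - d \<in> tensor_kernel R M N" (is "?l \<longleftrightarrow> ?r")
proof
  assume ?l
  moreover have "c \<in> tensor_kernel R M N #>\<^bsub>free_Abelian_group (carrier M \<times> carrier N)\<^esub> c"
    using tensor_kernel_0 by (auto simp: r_coset_def)
  ultimately have "c \<in> tensor_kernel R M N #>\<^bsub>free_Abelian_group (carrier M \<times> carrier N)\<^esub> d" by simp
  then show ?r by (auto simp: r_coset_def)
next
  assume r: ?r
  have "\<exists>k'\<in>tensor_kernel R M N. k + c = k' + d" if "k \<in> tensor_kernel R M N" for k
    using tensor_kernel_add[OF that r] by (intro bexI[of _ "k + (c - d)"]) auto
  moreover have "\<exists>k'\<in>tensor_kernel R M N. k + d = k' + c" if "k \<in> tensor_kernel R M N" for k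
    using tensor_kernel_diff[OF that r] by (intro bexI[of _ "k - (c - d)"]) auto
  ultimately show ?l by (fastforce simp: r_coset_def)
qed

end

lemma keys_frag_pair:
  assumes "f \<in> carrier M \<rightarrow> carrier M'" "g \<in> carrier N \<rightarrow> carrier N'"
    "Poly_Mapping.keys c \<subseteq> carrier M \<times> carrier N"
  shows "Poly_Mapping.keys (frag_extend (\<lambda>(x, y). frag_of (f x, g y)) c) \<subseteq> carrier M' \<times> carrier N'"
  using keys_frag_extend[of "\<lambda>(x, y). frag_of (f x, g y)" c] assms by fastforce

lemma tensor_kernel_map:
  assumes "left_module R N" "right_module R M" "left_module R N'" "right_module R M'"
    and f: "f \<in> linear_hom R M M'" and g: "g \<in> linear_hom R N N'"
    and c: "c \<in> tensor_kernel R M N"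
  shows "frag_extend (\<lambda>(x, y). frag_of (f x, g y)) c \<in> tensor_kernel R M' N'"
proof -
  note intros = tensor_kernel_0[OF assms(3,4)] tensor_kernel_add[OF assms(3,4)]
    tensor_kernel_minus[OF assms(3,4)]
  have rel: "frag_extend (\<lambda>(x, y). frag_of (f x, g y)) c \<in> tensor_kernel R M' N'"
    if "c \<in> tensor_relations R M N" for c
  proof (rule tensor_kernel_relation[OF assms(3,4)])
    have fc: "f x \<in> carrier M'" if "x \<in> carrier M" for x using f that by (auto simp: linear_hom_def)
    have gc: "g x \<in> carrier N'" if "x \<in> carrier N" for x using g that by (auto simp: linear_hom_def)
    show "frag_extend (\<lambda>(x, y). frag_of (f x, g y)) c \<in> tensor_relations R M' N'"
      using that
    proof (cases rule: tensor_relationsE)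
      case (left x x' y)
      then have "frag_extend (\<lambda>(x, y). frag_of (f x, g y)) c =
          frag_of (f x \<oplus>\<^bsub>M'\<^esub> f x', g y) - frag_of (f x, g y) - frag_of (f x', g y)"
        using f by (simp add: linear_hom_def frag_extend_diff)
      then show ?thesis using tensor_relationsI(1) left fc gc by metis
    next
      case (right x y y')
      then have "frag_extend (\<lambda>(x, y). frag_of (f x, g y)) c =
          frag_of (f x, g y \<oplus>\<^bsub>N'\<^esub> g y') - frag_of (f x, g y) - frag_of (f x, g y')"
        using g by (simp add: linear_hom_def frag_extend_diff)
      then show ?thesis using tensor_relationsI(2) right fc gc by metis
    next
      case (balanced a x y)
      then have "frag_extend (\<lambda>(x, y). frag_of (f x, g y)) c =
          frag_of (a \<odot>\<^bsub>M'\<^esub> f x, g y) - frag_of (f x, a \<odot>\<^bsub>N'\<^esub> g y)"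
        using f g by (simp add: linear_hom_def frag_extend_diff)
      then show ?thesis using tensor_relationsI(3) balanced fc gc by metis
    qed
  qed
  show ?thesis
    by (induction rule: tensor_kernel_induct[OF assms(1,2) c])
      (auto simp: frag_extend_minus frag_extend_add intro: intros rel)
qed

lemma linear_hom_id: "id \<in> linear_hom R M M"
  by (simp add: linear_hom_def)

lemma inj_tensor_map_iff:
  assumes N: "left_module R N" and M: "right_module R M" and M': "right_module R M'"
    and h: "h \<in> linear_hom R M M'"
  shows "inj_on (tensor_map R M' N h id) (carrier (tensor R M N)) \<longleftrightarrow>
    (\<forall>c. Poly_Mapping.keys c \<subseteq> carrier M \<times> carrier N \<longrightarrow>
       frag_extend (\<lambda>(x, y). frag_of (h x, y)) c \<in> tensor_kernel R M' N \<longrightarrow>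
       c \<in> tensor_kernel R M N)" (is "?inj \<longleftrightarrow> ?ker")
proof -
  let ?F = "free_Abelian_group (carrier M \<times> carrier N)"
  let ?F' = "free_Abelian_group (carrier M' \<times> carrier N)"
  let ?h = "frag_extend (\<lambda>(x, y). frag_of (h x, y))"
  let ?K = "tensor_kernel R M N" and ?K' = "tensor_kernel R M' N"
  have hc: "h \<in> carrier M \<rightarrow> carrier M'" using h by (simp add: linear_hom_def)
  have keys: "Poly_Mapping.keys (?h c) \<subseteq> carrier M' \<times> carrier N"
    if "Poly_Mapping.keys c \<subseteq> carrier M \<times> carrier N" for c
    using keys_frag_pair[OF hc, of id N N c] that by simp
  have map: "tensor_map R M' N h id (?K #>\<^bsub>?F\<^esub> c) = ?K' #>\<^bsub>?F'\<^esub> ?h c"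
    if c: "Poly_Mapping.keys c \<subseteq> carrier M \<times> carrier N" for c
  proof -
    have "?K' #>\<^bsub>?F'\<^esub> ?h (k + c) = ?K' #>\<^bsub>?F'\<^esub> ?h c" if k: "k \<in> ?K" for k
    proof (subst tensor_coset_eq_iff[OF N M'])
      have "Poly_Mapping.keys (k + c) \<subseteq> carrier M \<times> carrier N"
        using Poly_Mapping.keys_add[of k c] tensor_kernel_keys[OF N M k] c by blast
      then show "Poly_Mapping.keys (?h (k + c)) \<subseteq> carrier M' \<times> carrier N" by (rule keys)
      show "?h (k + c) - ?h c \<in> ?K'"
        using tensor_kernel_map[OF N M N M' h linear_hom_id k] by (simp add: frag_extend_add)
    qed (use keys c in blast)
    moreover have "0 \<in> ?K" by (rule tensor_kernel_0[OF N M])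
    ultimately show ?thesis by (auto simp: tensor_map_def r_coset_def[of ?F])
  qed
  have carr: "carrier (tensor R M N) = {?K #>\<^bsub>?F\<^esub> c | c. Poly_Mapping.keys c \<subseteq> carrier M \<times> carrier N}"
    by (auto simp: tensor_def carrier_FactGroup)
  show ?thesis
  proof
    assume inj: ?inj
    show ?ker
    proof (intro allI impI)
      fix c assume c: "Poly_Mapping.keys c \<subseteq> carrier M \<times> carrier N" and hk: "?h c \<in> ?K'"
      have "?K' #>\<^bsub>?F'\<^esub> ?h c = ?K' #>\<^bsub>?F'\<^esub> ?h 0"
        by (subst tensor_coset_eq_iff[OF N M']) (use keys[OF c] hk in auto)
      then have "tensor_map R M' N h id (?K #>\<^bsub>?F\<^esub> c) = tensor_map R M' N h id (?K #>\<^bsub>?F\<^esub> 0)"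
        using map[OF c] map[of 0] by simp
      then have "?K #>\<^bsub>?F\<^esub> c = ?K #>\<^bsub>?F\<^esub> 0"
        by (rule inj_onD[OF inj]) (unfold carr, use c in blast, rule CollectI, rule exI[of _ 0], simp)
      then show "c \<in> ?K" using tensor_coset_eq_iff[OF N M, of c 0] c by simp
    qed
  next
    assume ker: ?ker
    show ?inj
    proof (rule inj_onI)
      fix X Y assume "X \<in> carrier (tensor R M N)" "Y \<in> carrier (tensor R M N)"
        and eq: "tensor_map R M' N h id X = tensor_map R M' N h id Y"
      then obtain c d where c: "Poly_Mapping.keys c \<subseteq> carrier M \<times> carrier N" "X = ?K #>\<^bsub>?F\<^esub> c"
        and d: "Poly_Mapping.keys d \<subseteq> carrier M \<times> carrier N" "Y = ?K #>\<^bsub>?F\<^esub> d"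
        using carr by auto
      have "?h c - ?h d \<in> ?K'"
        using eq map c d keys tensor_coset_eq_iff[OF N M', of "?h c" "?h d"] by simp
      then have "c - d \<in> ?K"
        using ker c d keys_diff_subset by (metis frag_extend_diff)
      then show "X = Y" using tensor_coset_eq_iff[OF N M, of c d] c d by simp
    qed
  qed
qed

definition submodule_set :: "('r, 'x) ring_scheme \<Rightarrow> ('r, 'm) module \<Rightarrow> 'm set \<Rightarrow> bool" where
  "submodule_set R M U \<longleftrightarrow> U \<subseteq> carrier M \<and> \<zero>\<^bsub>M\<^esub> \<in> U \<and> (\<forall>x\<in>U. \<forall>y\<in>U. x \<oplus>\<^bsub>M\<^esub> y \<in> U) \<and>
     (\<forall>a\<in>carrier R. \<forall>x\<in>U. a \<odot>\<^bsub>M\<^esub> x \<in> U)"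

lemma (in right_module) smult_zero: "a \<in> carrier R \<Longrightarrow> a \<odot>\<^bsub>M\<^esub> \<zero>\<^bsub>M\<^esub> = \<zero>\<^bsub>M\<^esub>"
  using smult_r_distr[of a "\<zero>\<^bsub>M\<^esub>" "\<zero>\<^bsub>M\<^esub>"] smult_closed[of a "\<zero>\<^bsub>M\<^esub>"]
  by (metis M.add.r_cancel_one' M.r_zero M.zero_closed)

lemma (in right_module) zero_smult: "x \<in> carrier M \<Longrightarrow> \<zero>\<^bsub>R\<^esub> \<odot>\<^bsub>M\<^esub> x = \<zero>\<^bsub>M\<^esub>"
  using smult_l_distr[of "\<zero>\<^bsub>R\<^esub>" "\<zero>\<^bsub>R\<^esub>" x] smult_closed[of "\<zero>\<^bsub>R\<^esub>" x]
  by (metis M.add.r_cancel_one' R.r_zero R.zero_closed)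

lemma (in right_module) minus_smult:
  assumes "x \<in> carrier M" shows "(\<ominus>\<^bsub>R\<^esub> \<one>\<^bsub>R\<^esub>) \<odot>\<^bsub>M\<^esub> x \<oplus>\<^bsub>M\<^esub> x = \<zero>\<^bsub>M\<^esub>"
proof -
  have "(\<ominus>\<^bsub>R\<^esub> \<one>\<^bsub>R\<^esub> \<oplus>\<^bsub>R\<^esub> \<one>\<^bsub>R\<^esub>) \<odot>\<^bsub>M\<^esub> x = (\<ominus>\<^bsub>R\<^esub> \<one>\<^bsub>R\<^esub>) \<odot>\<^bsub>M\<^esub> x \<oplus>\<^bsub>M\<^esub> x"
    using smult_l_distr[of "\<ominus>\<^bsub>R\<^esub> \<one>\<^bsub>R\<^esub>" "\<one>\<^bsub>R\<^esub>" x] assms smult_one by simp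
  then show ?thesis using zero_smult[OF assms] by (simp add: R.l_neg)
qed

text \<open>Submodules and transport of structure in one step: the submodule \<open>U\<close>, with its elements
  renamed by \<open>e\<close>.\<close>

definition renamed :: "('r, 'm) module \<Rightarrow> 'm set \<Rightarrow> ('m \<Rightarrow> 'u) \<Rightarrow> ('r, 'u) module" where
  "renamed M U e = (let i = the_inv_into U e in
     \<lparr>carrier = e ` U, mult = undefined, one = undefined, zero = e \<zero>\<^bsub>M\<^esub>,
      add = (\<lambda>x y. e (i x \<oplus>\<^bsub>M\<^esub> i y)), smult = (\<lambda>a x. e (a \<odot>\<^bsub>M\<^esub> i x))\<rparr>)"

lemma renamed:
  assumes M: "right_module R M" and U: "submodule_set R M U" and e: "inj_on e U"
  shows "right_module R (renamed M U e)"
    and "the_inv_into U e \<in> linear_hom R (renamed M U e) M"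
    and "\<lbrakk>x \<in> U; y \<in> U\<rbrakk> \<Longrightarrow> e x \<oplus>\<^bsub>renamed M U e\<^esub> e y = e (x \<oplus>\<^bsub>M\<^esub> y)"
    and "\<lbrakk>a \<in> carrier R; x \<in> U\<rbrakk> \<Longrightarrow> a \<odot>\<^bsub>renamed M U e\<^esub> e x = e (a \<odot>\<^bsub>M\<^esub> x)"
proof -
  interpret M: right_module R M by fact
  note inv = the_inv_into_f_f[OF e]
  have cl: "\<And>x. x \<in> U \<Longrightarrow> x \<in> carrier M" "\<zero>\<^bsub>M\<^esub> \<in> U" "\<And>x y. x \<in> U \<Longrightarrow> y \<in> U \<Longrightarrow> x \<oplus>\<^bsub>M\<^esub> y \<in> U"
    "\<And>a x. a \<in> carrier R \<Longrightarrow> x \<in> U \<Longrightarrow> a \<odot>\<^bsub>M\<^esub> x \<in> U"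
    using U by (auto simp: submodule_set_def)
  have ag: "abelian_group (renamed M U e)"
  proof (rule abelian_groupI)
    fix x assume "x \<in> carrier (renamed M U e)"
    then obtain u where u: "u \<in> U" "x = e u" by (auto simp: renamed_def Let_def)
    show "\<exists>y\<in>carrier (renamed M U e). y \<oplus>\<^bsub>renamed M U e\<^esub> x = \<zero>\<^bsub>renamed M U e\<^esub>"
      by (rule bexI[of _ "e ((\<ominus>\<^bsub>R\<^esub> \<one>\<^bsub>R\<^esub>) \<odot>\<^bsub>M\<^esub> u)"])
        (use u cl M.minus_smult in \<open>auto simp: renamed_def Let_def inv\<close>)
  qed (auto simp: renamed_def Let_def inv cl M.M.add.m_ac)
  show "right_module R (renamed M U e)"
    by (intro right_module.intro right_module_axioms.intro ag M.R.ring_axioms)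
      (auto simp: renamed_def Let_def inv cl M.smult_l_distr M.smult_r_distr M.smult_assoc M.smult_one)
qed (use U in \<open>auto simp: renamed_def Let_def linear_hom_def submodule_set_def the_inv_into_f_f[OF e]\<close>)

lemma submodule_generated:
  fixes R :: "('r, 'x) ring_scheme" and M :: "('r, 'm) module"
  assumes M: "right_module R M" and "finite X" "X \<subseteq> carrier M"
  shows "\<exists>U (q :: (nat \<Rightarrow> 'r) \<Rightarrow> 'm). submodule_set R M U \<and> X \<subseteq> U \<and> U \<subseteq> range q"
  using assms(2,3)
proof (induction X rule: finite_induct)
  interpret M: right_module R M by fact
  case empty
  have "submodule_set R M {\<zero>\<^bsub>M\<^esub>}" by (simp add: submodule_set_def M.smult_zero)
  then show ?case by (intro exI[of _ "{\<zero>\<^bsub>M\<^esub>}"] exI[of _ "\<lambda>_. \<zero>\<^bsub>M\<^esub>"]) auto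
next
  interpret M: right_module R M by fact
  case (insert x X)
  then obtain U and q :: "(nat \<Rightarrow> 'r) \<Rightarrow> 'm"
    where U: "submodule_set R M U" "X \<subseteq> U" "U \<subseteq> range q" by auto
  have x: "x \<in> carrier M" using insert by simp
  have cl: "\<And>x. x \<in> U \<Longrightarrow> x \<in> carrier M" "\<zero>\<^bsub>M\<^esub> \<in> U" "\<And>x y. x \<in> U \<Longrightarrow> y \<in> U \<Longrightarrow> x \<oplus>\<^bsub>M\<^esub> y \<in> U"
    "\<And>a x. a \<in> carrier R \<Longrightarrow> x \<in> U \<Longrightarrow> a \<odot>\<^bsub>M\<^esub> x \<in> U"
    using U by (auto simp: submodule_set_def)
  let ?V = "{u \<oplus>\<^bsub>M\<^esub> a \<odot>\<^bsub>M\<^esub> x | u a. u \<in> U \<and> a \<in> carrier R}"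
  let ?q = "\<lambda>v :: nat \<Rightarrow> 'r. q (v \<circ> Suc) \<oplus>\<^bsub>M\<^esub> v 0 \<odot>\<^bsub>M\<^esub> x"
  have UV: "u \<in> ?V" if "u \<in> U" for u
    using that cl x M.zero_smult by (intro CollectI exI[of _ u] exI[of _ "\<zero>\<^bsub>R\<^esub>"]) auto
  have "x \<in> ?V"
    using cl x M.smult_one by (intro CollectI exI[of _ "\<zero>\<^bsub>M\<^esub>"] exI[of _ "\<one>\<^bsub>R\<^esub>"]) auto
  moreover have "submodule_set R M ?V"
    unfolding submodule_set_def
  proof (intro conjI ballI)
    show "?V \<subseteq> carrier M" using cl x M.smult_closed by auto
    show "\<zero>\<^bsub>M\<^esub> \<in> ?V" using UV cl by blast
  next
    fix y z assume "y \<in> ?V" "z \<in> ?V"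
    then obtain u a u' a' where *: "u \<in> U" "a \<in> carrier R" "y = u \<oplus>\<^bsub>M\<^esub> a \<odot>\<^bsub>M\<^esub> x"
      "u' \<in> U" "a' \<in> carrier R" "z = u' \<oplus>\<^bsub>M\<^esub> a' \<odot>\<^bsub>M\<^esub> x" by blast
    then have "y \<oplus>\<^bsub>M\<^esub> z = (u \<oplus>\<^bsub>M\<^esub> u') \<oplus>\<^bsub>M\<^esub> (a \<oplus>\<^bsub>R\<^esub> a') \<odot>\<^bsub>M\<^esub> x"
      using cl x M.smult_closed M.smult_l_distr by (simp add: M.M.add.m_ac)
    then show "y \<oplus>\<^bsub>M\<^esub> z \<in> ?V" using * cl M.R.add.m_closed by blast
  next
    fix b y assume b: "b \<in> carrier R" and "y \<in> ?V"
    then obtain u a where *: "u \<in> U" "a \<in> carrier R" "y = u \<oplus>\<^bsub>M\<^esub> a \<odot>\<^bsub>M\<^esub> x" by blast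
    then have "b \<odot>\<^bsub>M\<^esub> y = b \<odot>\<^bsub>M\<^esub> u \<oplus>\<^bsub>M\<^esub> (a \<otimes>\<^bsub>R\<^esub> b) \<odot>\<^bsub>M\<^esub> x"
      using b cl x M.smult_closed M.smult_r_distr M.smult_assoc by simp
    then show "b \<odot>\<^bsub>M\<^esub> y \<in> ?V" using * cl b M.R.m_closed by blast
  qed
  moreover have "?V \<subseteq> range ?q"
  proof
    fix y assume "y \<in> ?V"
    then obtain u a where *: "u \<in> U" "a \<in> carrier R" "y = u \<oplus>\<^bsub>M\<^esub> a \<odot>\<^bsub>M\<^esub> x" by blast
    then obtain v where "u = q v" using U by auto
    then have "y = ?q (case_nat a v)" using * by (simp add: comp_def)
    then show "y \<in> range ?q" by blast
  qed
  ultimately show ?case using UV U by (intro exI[of _ ?V] exI[of _ ?q]) auto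
qed

lemma tensor_kernel_finite_support:
  assumes N: "left_module R N" and M: "right_module R M" and c: "c \<in> tensor_kernel R M N"
  shows "\<exists>X. finite X \<and> X \<subseteq> carrier M \<and> (\<forall>U (e :: 'm \<Rightarrow> 'u). submodule_set R M U \<longrightarrow> X \<subseteq> U \<longrightarrow> inj_on e U \<longrightarrow>
     frag_extend (\<lambda>(x, y). frag_of (e x, y)) c \<in> tensor_kernel R (renamed M U e) N)"
    (is "?P c")
proof -
  let ?e = "\<lambda>e :: 'm \<Rightarrow> 'u. frag_extend (\<lambda>(x, y). frag_of (e x, y))"
  have mod: "right_module R (renamed M U e)" if "submodule_set R M U" "inj_on e U"
    for U and e :: "'m \<Rightarrow> 'u"
    by (rule renamed(1)[OF M that])
  have rel: "?P c" if "c \<in> tensor_relations R M N" for c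
  proof -
    have e: "e x \<in> carrier (renamed M U e)" if "x \<in> U" for x U and e :: "'m \<Rightarrow> 'u"
      using that by (simp add: renamed_def Let_def)
    have "\<exists>X. finite X \<and> X \<subseteq> carrier M \<and> (\<forall>U (e :: 'm \<Rightarrow> 'u). submodule_set R M U \<longrightarrow> X \<subseteq> U \<longrightarrow> inj_on e U \<longrightarrow>
       ?e e c \<in> tensor_relations R (renamed M U e) N)"
      using that
    proof (cases rule: tensor_relationsE)
      case (left x x' y)
      have "?e e c \<in> tensor_relations R (renamed M U e) N"
        if U: "submodule_set R M U" "x \<in> U" "x' \<in> U" "inj_on e U" for U and e :: "'m \<Rightarrow> 'u"
      proof -
        have "?e e c = frag_of (e x \<oplus>\<^bsub>renamed M U e\<^esub> e x', y) - frag_of (e x, y) - frag_of (e x', y)"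
          using left renamed(3)[OF M U(1,4,2,3)] by (simp add: frag_extend_diff)
        then show ?thesis using tensor_relationsI(1) e U left by metis
      qed
      then show ?thesis using left by (intro exI[of _ "{x, x'}"]) simp
    next
      case (right x y y')
      have "?e e c \<in> tensor_relations R (renamed M U e) N"
        if U: "submodule_set R M U" "x \<in> U" "inj_on e U" for U and e :: "'m \<Rightarrow> 'u"
      proof -
        have "?e e c = frag_of (e x, y \<oplus>\<^bsub>N\<^esub> y') - frag_of (e x, y) - frag_of (e x, y')"
          using right by (simp add: frag_extend_diff)
        then show ?thesis using tensor_relationsI(2) e U right by metis
      qed
      then show ?thesis using right by (intro exI[of _ "{x}"]) simp
    next
      case (balanced a x y)
      have "?e e c \<in> tensor_relations R (renamed M U e) N"
        if U: "submodule_set R M U" "x \<in> U" "inj_on e U" for U and e :: "'m \<Rightarrow> 'u"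
      proof -
        have "?e e c = frag_of (a \<odot>\<^bsub>renamed M U e\<^esub> e x, y) - frag_of (e x, a \<odot>\<^bsub>N\<^esub> y)"
          using balanced renamed(4)[OF M U(1,3) balanced(1) U(2)] by (simp add: frag_extend_diff)
        then show ?thesis using tensor_relationsI(3) e U balanced by metis
      qed
      then show ?thesis using balanced by (intro exI[of _ "{x}"]) simp
    qed
    then show ?thesis using tensor_kernel_relation[OF N mod] by meson
  qed
  show ?thesis
  proof (induction rule: tensor_kernel_induct[OF N M c])
    case 1
    then show ?case using tensor_kernel_0[OF N mod] by (intro exI[of _ "{}"]) auto
  next
    case (2 c)
    then show ?case by (rule rel)
  next
    case (3 c)
    then show ?case using tensor_kernel_minus[OF N mod] unfolding frag_extend_minus by meson
  next
    case (4 c d)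
    then obtain X Y where "finite X" "X \<subseteq> carrier M" "finite Y" "Y \<subseteq> carrier M"
      "\<And>U (e :: 'm \<Rightarrow> 'u). submodule_set R M U \<Longrightarrow> X \<subseteq> U \<Longrightarrow> inj_on e U \<Longrightarrow>
        ?e e c \<in> tensor_kernel R (renamed M U e) N"
      "\<And>U (e :: 'm \<Rightarrow> 'u). submodule_set R M U \<Longrightarrow> Y \<subseteq> U \<Longrightarrow> inj_on e U \<Longrightarrow>
        ?e e d \<in> tensor_kernel R (renamed M U e) N" by blast
    then show ?case using tensor_kernel_add[OF N mod]
      by (intro exI[of _ "X \<union> Y"]) (auto simp: frag_extend_add)
  qed
qed

theorem flat_imp_flat_on:
  fixes R :: "('r, 'x) ring_scheme" and N :: "('r, 'n) module"
  assumes N: "left_module R N" and flat: "flat R N"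
  shows "flat_on TYPE('m) R N"
  unfolding flat_on_def
proof (intro allI impI)
  fix M M' :: "('r, 'm) module" and h
  assume M: "right_module R M" and M': "right_module R M'" and h: "h \<in> linear_hom R M M'"
    and inj: "inj_on h (carrier M)"
  interpret M: right_module R M by fact
  interpret M': right_module R M' by fact
  show "inj_on (tensor_map R M' N h id) (carrier (tensor R M N))"
    unfolding inj_tensor_map_iff[OF N M M' h]
  proof (intro allI impI)
    fix c assume c: "Poly_Mapping.keys c \<subseteq> carrier M \<times> carrier N"
      and hc: "frag_extend (\<lambda>(x, y). frag_of (h x, y)) c \<in> tensor_kernel R M' N"
    obtain X where X: "finite X" "X \<subseteq> carrier M'"
      and Xk: "\<And>U (e :: 'm \<Rightarrow> (nat \<Rightarrow> 'r) set). submodule_set R M' U \<Longrightarrow> X \<subseteq> U \<Longrightarrow> inj_on e U \<Longrightarrow>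
        frag_extend (\<lambda>(x, y). frag_of (e x, y)) (frag_extend (\<lambda>(x, y). frag_of (h x, y)) c) \<in>
        tensor_kernel R (renamed M' U e) N"
      using tensor_kernel_finite_support[OF N M' hc, where 'u = "(nat \<Rightarrow> 'r) set"] by blast
    have hM: "\<And>x. x \<in> carrier M \<Longrightarrow> h x \<in> carrier M'" using h by (auto simp: linear_hom_def)
    have fin: "finite (X \<union> (h \<circ> fst) ` Poly_Mapping.keys c)" using X by simp
    have sub: "X \<union> (h \<circ> fst) ` Poly_Mapping.keys c \<subseteq> carrier M'" using X c hM by auto
    obtain U and q :: "(nat \<Rightarrow> 'r) \<Rightarrow> 'm" where U: "submodule_set R M' U"
      "X \<union> (h \<circ> fst) ` Poly_Mapping.keys c \<subseteq> U" "U \<subseteq> range q"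
      using submodule_generated[OF M' fin sub] by blast
    define e where "e y = {v. q v = y}" for y
    have e: "inj_on e U"
      using U(3) by (fastforce simp: inj_on_def e_def)
    define V where "V = {x \<in> carrier M. h x \<in> U}"
    have h0: "h \<zero>\<^bsub>M\<^esub> = \<zero>\<^bsub>M'\<^esub>"
      using h M.zero_smult[of "\<zero>\<^bsub>M\<^esub>"] M'.zero_smult[OF hM, of "\<zero>\<^bsub>M\<^esub>"]
      unfolding linear_hom_def by (metis (mono_tags, lifting) M.M.zero_closed M.R.zero_closed mem_Collect_eq)
    have V: "submodule_set R M V"
      using U(1) h h0 M.smult_closed by (auto simp: submodule_set_def V_def linear_hom_def)
    have eh: "inj_on (e \<circ> h) V"
      by (rule comp_inj_on) (use inj e in \<open>auto simp: V_def inj_on_def\<close>)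
    let ?V = "renamed M V (e \<circ> h)" and ?U = "renamed M' U e"
    let ?c = "frag_extend (\<lambda>(x, y). frag_of ((e \<circ> h) x, y)) c"
    have comp: "frag_extend (\<lambda>(x, y). frag_of (f x, y)) (frag_extend (\<lambda>(x, y). frag_of (g x, y)) d) =
        frag_extend (\<lambda>(x, y). frag_of ((f \<circ> g) x, y)) d"
      for f :: "'b1 \<Rightarrow> 'c1" and g :: "'a1 \<Rightarrow> 'b1" and d :: "'a1 \<times> 'n \<Rightarrow>\<^sub>0 int"
      using frag_extend_compose[of "\<lambda>(x, y). frag_of (f x, y)" "\<lambda>(x, y). (g x, y)" d]
      by (simp add: comp_def case_prod_beta')
    have keysV: "fst ` Poly_Mapping.keys c \<subseteq> V" using U(2) c by (auto simp: V_def)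
    have inc: "id \<in> linear_hom R ?V ?U"
    proof -
      have VU: "h x \<in> U" if "x \<in> V" for x using that by (simp add: V_def)
      have VM: "x \<in> carrier M" if "x \<in> V" for x using that by (simp add: V_def)
      show ?thesis
        unfolding linear_hom_def
      proof (intro CollectI conjI ballI)
        show "id \<in> carrier ?V \<rightarrow> carrier ?U" using VU by (auto simp: renamed_def Let_def)
      next
        fix x y assume "x \<in> carrier ?V" "y \<in> carrier ?V"
        then obtain u v where uv: "u \<in> V" "v \<in> V" "x = (e \<circ> h) u" "y = (e \<circ> h) v"
          by (auto simp: renamed_def Let_def)
        have "x \<oplus>\<^bsub>?V\<^esub> y = (e \<circ> h) (u \<oplus>\<^bsub>M\<^esub> v)" using uv renamed(3)[OF M V eh] by simp
        moreover have "x \<oplus>\<^bsub>?U\<^esub> y = e (h u \<oplus>\<^bsub>M'\<^esub> h v)" using uv VU renamed(3)[OF M' U(1) e] by simp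
        ultimately show "id (x \<oplus>\<^bsub>?V\<^esub> y) = id x \<oplus>\<^bsub>?U\<^esub> id y"
          using h uv VM by (simp add: linear_hom_def)
      next
        fix a x assume a: "a \<in> carrier R" and "x \<in> carrier ?V"
        then obtain u where uv: "u \<in> V" "x = (e \<circ> h) u" by (auto simp: renamed_def Let_def)
        have "a \<odot>\<^bsub>?V\<^esub> x = (e \<circ> h) (a \<odot>\<^bsub>M\<^esub> u)" using a uv renamed(4)[OF M V eh] by simp
        moreover have "a \<odot>\<^bsub>?U\<^esub> x = e (a \<odot>\<^bsub>M'\<^esub> h u)" using a uv VU renamed(4)[OF M' U(1) e] by simp
        ultimately show "id (a \<odot>\<^bsub>?V\<^esub> x) = a \<odot>\<^bsub>?U\<^esub> id x"
          using h a uv VM by (simp add: linear_hom_def)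
      qed
    qed
    have modV: "right_module R ?V" and modU: "right_module R ?U"
      by (rule renamed(1)[OF M V eh], rule renamed(1)[OF M' U(1) e])
    have "inj_on (tensor_map R ?U N id id) (carrier (tensor R ?V N))"
      using flat modV modU inc unfolding flat_def flat_on_def by (meson inj_on_id)
    moreover have "Poly_Mapping.keys ?c \<subseteq> carrier ?V \<times> carrier N"
    proof (rule order_trans[OF keys_frag_extend], rule UN_least)
      fix z assume z: "z \<in> Poly_Mapping.keys c"
      then have "fst z \<in> V" "snd z \<in> carrier N" using keysV c by auto
      then show "Poly_Mapping.keys (case z of (x, y) \<Rightarrow> frag_of ((e \<circ> h) x, y)) \<subseteq>
          carrier ?V \<times> carrier N"
        by (auto simp: renamed_def Let_def split: prod.split)
    qed
    moreover have "frag_extend (\<lambda>(x, y). frag_of (id x, y)) ?c \<in> tensor_kernel R ?U N"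
      using Xk[OF U(1) _ e] U(2) unfolding comp by simp
    ultimately have "?c \<in> tensor_kernel R ?V N"
      using inj_tensor_map_iff[OF N modV modU inc] by blast
    then have "frag_extend (\<lambda>(x, y). frag_of (the_inv_into V (e \<circ> h) x, id y)) ?c \<in> tensor_kernel R M N"
      by (rule tensor_kernel_map[OF N modV N M renamed(2)[OF M V eh] linear_hom_id])
    also have "frag_extend (\<lambda>(x, y). frag_of (the_inv_into V (e \<circ> h) x, id y)) ?c =
        frag_extend (\<lambda>(x, y). frag_of ((the_inv_into V (e \<circ> h) \<circ> (e \<circ> h)) x, y)) c"
      using comp by simp
    also have "\<dots> = frag_extend frag_of c"
      by (rule frag_extend_eq) (use keysV the_inv_into_f_f[OF eh] in \<open>auto simp: image_subset_iff\<close>)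
    also have "\<dots> = c" by (rule frag_expansion[symmetric])
    finally show "c \<in> tensor_kernel R M N" .
  qed
qed


section \<open>Ring and module axioms\<close>

lemma left_module_left_restrict:
  assumes "ring R" "ring S" "f \<in> ring_hom R S"
  shows "left_module R (left_restrict f S)"
proof -
  interpret R: ring R by fact
  interpret S: ring S by fact
  have "abelian_group (left_restrict f S)"
    by (rule abelian_groupI) (auto simp: left_restrict_def S.add.m_ac intro: S.l_neg)
  with assms show ?thesis
    by (intro left_module.intro left_module_axioms.intro)
      (auto simp: left_restrict_def ring_hom_def Pi_iff S.l_distr S.r_distr S.m_assoc)
qed

lemma right_module_right_restrict:
  assumes "ring R" "ring S" "f \<in> ring_hom R S"
  shows "right_module R (right_restrict f S)"
proof -
  interpret R: ring R by fact
  interpret S: ring S by fact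
  have "abelian_group (right_restrict f S)"
    by (rule abelian_groupI) (auto simp: right_restrict_def S.add.m_ac intro: S.l_neg)
  with assms show ?thesis
    by (intro right_module.intro right_module_axioms.intro)
      (auto simp: right_restrict_def ring_hom_def Pi_iff S.l_distr S.r_distr S.m_assoc)
qed

context ring
begin

lemma finsum_swap:
  assumes "finite I" "finite J" "\<And>i j. i \<in> I \<Longrightarrow> j \<in> J \<Longrightarrow> f i j \<in> carrier R"
  shows "(\<Oplus>i\<in>I. \<Oplus>j\<in>J. f i j) = (\<Oplus>j\<in>J. \<Oplus>i\<in>I. f i j)"
  using assms(1,3)
proof (induction I rule: finite_induct)
  case empty
  then show ?case by (simp add: finsum_zero)
next
  case (insert i I)
  have "(\<Oplus>i\<in>insert i I. \<Oplus>j\<in>J. f i j) = (\<Oplus>j\<in>J. f i j) \<oplus> (\<Oplus>j\<in>J. \<Oplus>i\<in>I. f i j)"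
    using insert by (subst finsum_insert) (auto intro!: finsum_closed)
  also have "\<dots> = (\<Oplus>j\<in>J. f i j \<oplus> (\<Oplus>i\<in>I. f i j))"
    using insert by (subst finsum_addf) (auto intro!: finsum_closed)
  also have "\<dots> = (\<Oplus>j\<in>J. \<Oplus>i\<in>insert i I. f i j)"
    using insert by (intro finsum_cong') (auto intro!: finsum_closed a_closed simp: finsum_insert)
  finally show ?case .
qed

lemma matrix_product_assoc:
  assumes "finite I" "\<And>l. l \<in> I \<Longrightarrow> u l \<in> carrier R" "\<And>m. m \<in> I \<Longrightarrow> w m \<in> carrier R"
    "\<And>l m. l \<in> I \<Longrightarrow> m \<in> I \<Longrightarrow> v l m \<in> carrier R"
  shows "(\<Oplus>m\<in>I. (\<Oplus>l\<in>I. u l \<otimes> v l m) \<otimes> w m) = (\<Oplus>l\<in>I. u l \<otimes> (\<Oplus>m\<in>I. v l m \<otimes> w m))"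
proof -
  have "(\<Oplus>m\<in>I. (\<Oplus>l\<in>I. u l \<otimes> v l m) \<otimes> w m) = (\<Oplus>m\<in>I. \<Oplus>l\<in>I. u l \<otimes> v l m \<otimes> w m)"
    using assms by (intro finsum_cong') (auto intro!: finsum_closed finsum_ldistr)
  also have "\<dots> = (\<Oplus>l\<in>I. \<Oplus>m\<in>I. u l \<otimes> v l m \<otimes> w m)"
    using assms by (intro finsum_swap) auto
  also have "\<dots> = (\<Oplus>l\<in>I. \<Oplus>m\<in>I. u l \<otimes> (v l m \<otimes> w m))"
    using assms by (intro finsum_cong' refl) (auto intro!: finsum_closed simp: m_assoc)
  also have "\<dots> = (\<Oplus>l\<in>I. u l \<otimes> (\<Oplus>m\<in>I. v l m \<otimes> w m))"
    using assms by (intro finsum_cong') (auto intro!: finsum_closed simp: finsum_rdistr)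
  finally show ?thesis .
qed

lemma finsum_delta_left:
  assumes "finite I" "i \<in> I" "\<And>l. l \<in> I \<Longrightarrow> v l \<in> carrier R"
  shows "(\<Oplus>l\<in>I. (if i = l then \<one> else \<zero>) \<otimes> v l) = v i"
proof -
  have "(\<Oplus>l\<in>I. (if i = l then \<one> else \<zero>) \<otimes> v l) = (\<Oplus>l\<in>I. if i = l then v l else \<zero>)"
    by (rule finsum_cong') (use assms in auto)
  then show ?thesis using add.finprod_singleton[of i I v] assms by auto
qed

lemma finsum_delta_right:
  assumes "finite I" "i \<in> I" "\<And>l. l \<in> I \<Longrightarrow> v l \<in> carrier R"
  shows "(\<Oplus>l\<in>I. v l \<otimes> (if l = i then \<one> else \<zero>)) = v i"
proof -
  have "(\<Oplus>l\<in>I. v l \<otimes> (if l = i then \<one> else \<zero>)) = (\<Oplus>l\<in>I. if i = l then v l else \<zero>)"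
    by (rule finsum_cong') (use assms in auto)
  then show ?thesis using add.finprod_singleton[of i I v] assms by auto
qed

lemma finsum_triangular:
  assumes "finite I" "i \<in> I" "j \<in> I" "\<And>l. l \<in> I \<Longrightarrow> u l \<in> carrier R" "\<And>l. l \<in> I \<Longrightarrow> v l \<in> carrier R"
    "\<And>l. l \<in> I \<Longrightarrow> i < l \<Longrightarrow> u l = \<zero>" "\<And>l. l \<in> I \<Longrightarrow> l < j \<Longrightarrow> v l = \<zero>"
  shows "i < (j :: nat) \<Longrightarrow> (\<Oplus>l\<in>I. u l \<otimes> v l) = \<zero>"
    and "i = j \<Longrightarrow> (\<Oplus>l\<in>I. u l \<otimes> v l) = u i \<otimes> v i"
proof -
  have "u l \<otimes> v l = \<zero>" if "l \<in> I" "i < j" for l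
    using assms that by (cases "i < l") auto
  then show "(\<Oplus>l\<in>I. u l \<otimes> v l) = \<zero>" if "i < j"
    using that by (intro add.finprod_one_eqI) auto
  have "(\<Oplus>l\<in>I. u l \<otimes> v l) = (\<Oplus>l\<in>I. if i = l then u l \<otimes> v l else \<zero>)" if "i = j"
  proof (rule finsum_cong')
    fix l assume "l \<in> I"
    then show "u l \<otimes> v l = (if i = l then u l \<otimes> v l else \<zero>)"
      using assms that by (cases i l rule: linorder_cases) auto
  qed (use assms in auto)
  then show "(\<Oplus>l\<in>I. u l \<otimes> v l) = u i \<otimes> v i" if "i = j"
    using that assms add.finprod_singleton[of i I "\<lambda>l. u l \<otimes> v l"] by auto
qed

end

lemma ring_matrix_ring:
  assumes "ring S" shows "ring (matrix_ring n S)"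
proof -
  interpret S: ring S by fact
  let ?M = "matrix_ring n S"
  have ext: "x = y" if "x \<in> carrier ?M" "y \<in> carrier ?M"
    "\<And>i j. i \<in> {1..n} \<Longrightarrow> j \<in> {1..n} \<Longrightarrow> x (i, j) = y (i, j)" for x y
    by (rule PiE_ext[of _ "{1..n} \<times> {1..n}" "\<lambda>_. carrier S"])
      (use that in \<open>auto simp: matrix_ring_def\<close>)
  have el: "x (i, j) \<in> carrier S" if "x \<in> carrier ?M" "i \<in> {1..n}" "j \<in> {1..n}" for x i j
    using that by (auto simp: matrix_ring_def)
  have cl: "x \<otimes>\<^bsub>?M\<^esub> y \<in> carrier ?M" "x \<oplus>\<^bsub>?M\<^esub> y \<in> carrier ?M" "\<one>\<^bsub>?M\<^esub> \<in> carrier ?M" "\<zero>\<^bsub>?M\<^esub> \<in> carrier ?M"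
    if "x \<in> carrier ?M" "y \<in> carrier ?M" for x y
    using that[THEN el] by (auto simp: matrix_ring_def intro!: S.finsum_closed)
  have ap: "(x \<otimes>\<^bsub>?M\<^esub> y) (i, j) = (\<Oplus>\<^bsub>S\<^esub>l\<in>{1..n}. x (i, l) \<otimes>\<^bsub>S\<^esub> y (l, j))"
      "(x \<oplus>\<^bsub>?M\<^esub> y) (i, j) = x (i, j) \<oplus>\<^bsub>S\<^esub> y (i, j)" "\<zero>\<^bsub>?M\<^esub> (i, j) = \<zero>\<^bsub>S\<^esub>"
      "\<one>\<^bsub>?M\<^esub> (i, j) = (if i = j then \<one>\<^bsub>S\<^esub> else \<zero>\<^bsub>S\<^esub>)"
    if "i \<in> {1..n}" "j \<in> {1..n}" for x y i j
    using that by (auto simp: matrix_ring_def)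
  have z: "\<zero>\<^bsub>?M\<^esub> \<in> carrier ?M" "\<one>\<^bsub>?M\<^esub> \<in> carrier ?M" by (auto simp: matrix_ring_def)
  note [simp] = S.finsum_closed Pi_iff
  have ag: "abelian_group ?M"
  proof (rule abelian_groupI)
    fix x assume x: "x \<in> carrier ?M"
    let ?y = "restrict (\<lambda>ij. \<ominus>\<^bsub>S\<^esub> x ij) ({1..n} \<times> {1..n})"
    have y: "?y \<in> carrier ?M" using el[OF x] by (auto simp: matrix_ring_def)
    have "?y \<oplus>\<^bsub>?M\<^esub> x = \<zero>\<^bsub>?M\<^esub>"
      by (rule ext) (use x y cl z el[OF x] in \<open>auto simp: ap S.l_neg\<close>)
    then show "\<exists>y\<in>carrier ?M. y \<oplus>\<^bsub>?M\<^esub> x = \<zero>\<^bsub>?M\<^esub>" using y by blast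
  next
    fix x y assume "x \<in> carrier ?M" "y \<in> carrier ?M"
    then show "x \<oplus>\<^bsub>?M\<^esub> y = y \<oplus>\<^bsub>?M\<^esub> x" by (intro ext cl) (auto simp: ap S.a_comm el)
  next
    fix x y w assume "x \<in> carrier ?M" "y \<in> carrier ?M" "w \<in> carrier ?M"
    then show "x \<oplus>\<^bsub>?M\<^esub> y \<oplus>\<^bsub>?M\<^esub> w = x \<oplus>\<^bsub>?M\<^esub> (y \<oplus>\<^bsub>?M\<^esub> w)"
      by (intro ext cl) (auto simp: ap S.a_assoc el)
  next
    fix x assume "x \<in> carrier ?M"
    then show "\<zero>\<^bsub>?M\<^esub> \<oplus>\<^bsub>?M\<^esub> x = x" by (intro ext cl z) (auto simp: ap el)
  qed (auto simp: cl z)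
  have mo: "monoid ?M"
  proof (rule monoidI)
    fix x y w assume "x \<in> carrier ?M" "y \<in> carrier ?M" "w \<in> carrier ?M"
    then show "x \<otimes>\<^bsub>?M\<^esub> y \<otimes>\<^bsub>?M\<^esub> w = x \<otimes>\<^bsub>?M\<^esub> (y \<otimes>\<^bsub>?M\<^esub> w)"
      using S.matrix_product_assoc[of "{1..n}"]
      by (intro ext cl) (auto simp: ap el cong: S.finsum_cong)
  next
    fix x assume x: "x \<in> carrier ?M"
    show "\<one>\<^bsub>?M\<^esub> \<otimes>\<^bsub>?M\<^esub> x = x"
      using x S.finsum_delta_left[of "{1..n}"] by (intro ext cl z) (auto simp: ap el cong: S.finsum_cong)
    show "x \<otimes>\<^bsub>?M\<^esub> \<one>\<^bsub>?M\<^esub> = x"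
      using x S.finsum_delta_right[of "{1..n}"] by (intro ext cl z) (auto simp: ap el cong: S.finsum_cong)
  qed (auto simp: cl z)
  show ?thesis
  proof (rule ringI[OF ag mo])
    fix x y w assume *: "x \<in> carrier ?M" "y \<in> carrier ?M" "w \<in> carrier ?M"
    show "(x \<oplus>\<^bsub>?M\<^esub> y) \<otimes>\<^bsub>?M\<^esub> w = x \<otimes>\<^bsub>?M\<^esub> w \<oplus>\<^bsub>?M\<^esub> y \<otimes>\<^bsub>?M\<^esub> w"
      using * by (intro ext cl) (auto simp: ap el S.l_distr S.finsum_addf cong: S.finsum_cong)
    show "w \<otimes>\<^bsub>?M\<^esub> (x \<oplus>\<^bsub>?M\<^esub> y) = w \<otimes>\<^bsub>?M\<^esub> x \<oplus>\<^bsub>?M\<^esub> w \<otimes>\<^bsub>?M\<^esub> y"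
      using * by (intro ext cl) (auto simp: ap el S.r_distr S.finsum_addf cong: S.finsum_cong)
  qed
qed

context
  fixes k :: "'k ring" and S :: "'s ring" and \<phi> :: "'k \<Rightarrow> 's" and n :: nat
  assumes k: "ring k" and S: "ring S" and \<phi>: "\<phi> \<in> ring_hom k S"
begin

interpretation k: ring k by (rule k)
interpretation S: ring S by (rule S)

private abbreviation (input) "A \<equiv> triangular_ring n k S \<phi>"
private abbreviation (input) "P \<equiv> column_module n k S \<phi>"
private abbreviation (input) "E \<equiv> triangular_entry S \<phi>"
private abbreviation (input) "C \<equiv> column_entry S \<phi>"

private lemma phi [simp]:
  "x \<in> carrier k \<Longrightarrow> \<phi> x \<in> carrier S" "\<phi> \<one>\<^bsub>k\<^esub> = \<one>\<^bsub>S\<^esub>" "\<phi> \<zero>\<^bsub>k\<^esub> = \<zero>\<^bsub>S\<^esub>"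
  "x \<in> carrier k \<Longrightarrow> y \<in> carrier k \<Longrightarrow> \<phi> (x \<otimes>\<^bsub>k\<^esub> y) = \<phi> x \<otimes>\<^bsub>S\<^esub> \<phi> y"
  "x \<in> carrier k \<Longrightarrow> y \<in> carrier k \<Longrightarrow> \<phi> (x \<oplus>\<^bsub>k\<^esub> y) = \<phi> x \<oplus>\<^bsub>S\<^esub> \<phi> y"
  using \<phi> ring_hom_zero[OF \<phi> k S] by (auto simp: ring_hom_def)

lemma triangular_ext:
  assumes "x \<in> carrier A" "y \<in> carrier A" "\<And>i. i \<in> {1..n} \<Longrightarrow> fst x i = fst y i"
    "\<And>i j. i \<in> {1..n} \<Longrightarrow> j \<in> {1..n} \<Longrightarrow> j < i \<Longrightarrow> E x (i, j) = E y (i, j)"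
  shows "x = y"
proof (rule prod_eqI)
  show "fst x = fst y"
    by (rule PiE_ext[of _ "{1..n}" "\<lambda>_. carrier k"]) (use assms in \<open>auto simp: triangular_ring_def\<close>)
  show "snd x = snd y"
  proof (rule PiE_ext)
    show "snd x \<in> below_diagonal n \<rightarrow>\<^sub>E carrier S" "snd y \<in> below_diagonal n \<rightarrow>\<^sub>E carrier S"
      using assms by (auto simp: triangular_ring_def)
    fix ij assume "ij \<in> below_diagonal n"
    then show "snd x ij = snd y ij"
      using assms(4)[of "fst ij" "snd ij"] by (auto simp: triangular_entry_def below_diagonal_def)
  qed
qed

lemma triangular_el:
  assumes "x \<in> carrier A" "i \<in> {1..n}"
  shows "fst x i \<in> carrier k" "j \<in> {1..n} \<Longrightarrow> E x (i, j) \<in> carrier S"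
  using assms by (auto simp: triangular_ring_def triangular_entry_def below_diagonal_def Pi_iff PiE_iff)

lemma triangular_fst:
  assumes "i \<in> {1..n}"
  shows "fst (x \<otimes>\<^bsub>A\<^esub> y) i = fst x i \<otimes>\<^bsub>k\<^esub> fst y i" "fst (x \<oplus>\<^bsub>A\<^esub> y) i = fst x i \<oplus>\<^bsub>k\<^esub> fst y i"
    "fst \<one>\<^bsub>A\<^esub> i = \<one>\<^bsub>k\<^esub>" "fst \<zero>\<^bsub>A\<^esub> i = \<zero>\<^bsub>k\<^esub>"
  using assms by (auto simp: triangular_ring_def)

lemma triangular_entry_simps:
  assumes "i \<in> {1..n}" "j \<in> {1..n}"
  shows "\<lbrakk>x \<in> carrier A; y \<in> carrier A\<rbrakk> \<Longrightarrow>
      E (x \<otimes>\<^bsub>A\<^esub> y) (i, j) = (\<Oplus>\<^bsub>S\<^esub>l\<in>{1..n}. E x (i, l) \<otimes>\<^bsub>S\<^esub> E y (l, j))"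
    and "\<lbrakk>x \<in> carrier A; y \<in> carrier A\<rbrakk> \<Longrightarrow> E (x \<oplus>\<^bsub>A\<^esub> y) (i, j) = E x (i, j) \<oplus>\<^bsub>S\<^esub> E y (i, j)"
    and "E \<one>\<^bsub>A\<^esub> (i, j) = (if i = j then \<one>\<^bsub>S\<^esub> else \<zero>\<^bsub>S\<^esub>)"
    and "E \<zero>\<^bsub>A\<^esub> (i, j) = \<zero>\<^bsub>S\<^esub>"
proof -
  assume *: "x \<in> carrier A" "y \<in> carrier A"
  have tri: "E x (i, l) = \<zero>\<^bsub>S\<^esub>" if "i < l" for l x i
    using that by (simp add: triangular_entry_def)
  note f = S.finsum_triangular[of "{1..n}" i j "\<lambda>l. E x (i, l)" "\<lambda>l. E y (l, j)"]
  show "E (x \<otimes>\<^bsub>A\<^esub> y) (i, j) = (\<Oplus>\<^bsub>S\<^esub>l\<in>{1..n}. E x (i, l) \<otimes>\<^bsub>S\<^esub> E y (l, j))"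
  proof (cases i j rule: linorder_cases)
    case less
    then show ?thesis using f assms * by (simp add: triangular_el tri)
  next
    case equal
    then have "E (x \<otimes>\<^bsub>A\<^esub> y) (i, j) = E x (i, i) \<otimes>\<^bsub>S\<^esub> E y (i, i)"
      using assms * triangular_fst triangular_el by (simp add: triangular_entry_def)
    then show ?thesis using f assms * equal by (simp add: triangular_el tri)
  next
    case greater
    then show ?thesis using assms
      by (simp add: triangular_entry_def[of _ _ "_ \<otimes>\<^bsub>A\<^esub> _"]) (simp add: triangular_ring_def below_diagonal_def)
  qed
  show "E (x \<oplus>\<^bsub>A\<^esub> y) (i, j) = E x (i, j) \<oplus>\<^bsub>S\<^esub> E y (i, j)"
    using assms * triangular_el by (auto simp: triangular_entry_def triangular_ring_def below_diagonal_def PiE_iff)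
qed (use assms in \<open>auto simp: triangular_entry_def triangular_ring_def below_diagonal_def\<close>)

lemma triangular_closed:
  "\<lbrakk>x \<in> carrier A; y \<in> carrier A\<rbrakk> \<Longrightarrow> x \<otimes>\<^bsub>A\<^esub> y \<in> carrier A"
  "\<lbrakk>x \<in> carrier A; y \<in> carrier A\<rbrakk> \<Longrightarrow> x \<oplus>\<^bsub>A\<^esub> y \<in> carrier A"
  "\<one>\<^bsub>A\<^esub> \<in> carrier A" "\<zero>\<^bsub>A\<^esub> \<in> carrier A"
proof -
  assume *: "x \<in> carrier A" "y \<in> carrier A"
  have 1: "E x (i, l) \<in> carrier S" "E y (i, l) \<in> carrier S" if "i \<in> {1..n}" "l \<in> {1..n}" for i l
    using triangular_el * that by auto
  have "(\<Oplus>\<^bsub>S\<^esub>l\<in>{1..n}. E x (i, l) \<otimes>\<^bsub>S\<^esub> E y (l, j)) \<in> carrier S" if "(i, j) \<in> below_diagonal n" for i j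
    using that 1 by (auto simp: below_diagonal_def intro!: S.finsum_closed)
  then show "x \<otimes>\<^bsub>A\<^esub> y \<in> carrier A"
    using * by (auto simp: triangular_ring_def PiE_iff)
qed (auto simp: triangular_ring_def PiE_iff)

lemma ring_triangular_ring: "ring (triangular_ring n k S \<phi>)"
proof -
  have neg: "\<exists>y\<in>carrier A. y \<oplus>\<^bsub>A\<^esub> x = \<zero>\<^bsub>A\<^esub>" if "x \<in> carrier A" for x
    by (rule bexI[of _ "(\<lambda>i\<in>{1..n}. \<ominus>\<^bsub>k\<^esub> fst x i, \<lambda>ij\<in>below_diagonal n. \<ominus>\<^bsub>S\<^esub> snd x ij)"])
      (use that in \<open>auto simp: triangular_ring_def PiE_iff k.l_neg S.l_neg\<close>)
  have ag: "abelian_group A"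
  proof (rule abelian_groupI)
    fix x y w assume *: "x \<in> carrier A" "y \<in> carrier A" "w \<in> carrier A"
    show "x \<oplus>\<^bsub>A\<^esub> y \<oplus>\<^bsub>A\<^esub> w = x \<oplus>\<^bsub>A\<^esub> (y \<oplus>\<^bsub>A\<^esub> w)"
      by (rule triangular_ext) (use * in \<open>simp_all add: triangular_closed triangular_fst triangular_entry_simps triangular_el k.a_assoc S.a_assoc\<close>)
    show "x \<oplus>\<^bsub>A\<^esub> y = y \<oplus>\<^bsub>A\<^esub> x"
      by (rule triangular_ext) (use * in \<open>simp_all add: triangular_closed triangular_fst triangular_entry_simps triangular_el k.a_comm S.a_comm\<close>)
  next
    fix x assume *: "x \<in> carrier A"
    show "\<zero>\<^bsub>A\<^esub> \<oplus>\<^bsub>A\<^esub> x = x"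
      by (rule triangular_ext) (use * in \<open>simp_all add: triangular_closed triangular_fst triangular_entry_simps triangular_el\<close>)
  qed (auto simp: triangular_closed neg)
  have mo: "monoid A"
  proof (rule monoidI)
    fix x y w assume *: "x \<in> carrier A" "y \<in> carrier A" "w \<in> carrier A"
    show "x \<otimes>\<^bsub>A\<^esub> y \<otimes>\<^bsub>A\<^esub> w = x \<otimes>\<^bsub>A\<^esub> (y \<otimes>\<^bsub>A\<^esub> w)"
      by (rule triangular_ext) (use * S.matrix_product_assoc[of "{1..n}"] in
        \<open>simp_all add: triangular_closed triangular_fst triangular_entry_simps triangular_el k.m_assoc Pi_iff S.finsum_closed cong: S.finsum_cong\<close>)
  next
    fix x assume *: "x \<in> carrier A"
    show "\<one>\<^bsub>A\<^esub> \<otimes>\<^bsub>A\<^esub> x = x"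
      by (rule triangular_ext) (use * S.finsum_delta_left[of "{1..n}"] in
        \<open>simp_all add: triangular_closed triangular_fst triangular_entry_simps triangular_el Pi_iff cong: S.finsum_cong\<close>)
    show "x \<otimes>\<^bsub>A\<^esub> \<one>\<^bsub>A\<^esub> = x"
      by (rule triangular_ext) (use * S.finsum_delta_right[of "{1..n}"] in
        \<open>simp_all add: triangular_closed triangular_fst triangular_entry_simps triangular_el Pi_iff cong: S.finsum_cong\<close>)
  qed (auto simp: triangular_closed)
  show ?thesis
  proof (rule ringI[OF ag mo])
    fix x y w assume *: "x \<in> carrier A" "y \<in> carrier A" "w \<in> carrier A"
    show "(x \<oplus>\<^bsub>A\<^esub> y) \<otimes>\<^bsub>A\<^esub> w = x \<otimes>\<^bsub>A\<^esub> w \<oplus>\<^bsub>A\<^esub> y \<otimes>\<^bsub>A\<^esub> w"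
      by (rule triangular_ext) (use * in \<open>simp_all add: triangular_closed triangular_fst triangular_entry_simps triangular_el k.l_distr S.l_distr
        S.finsum_addf Pi_iff cong: S.finsum_cong\<close>)
    show "w \<otimes>\<^bsub>A\<^esub> (x \<oplus>\<^bsub>A\<^esub> y) = w \<otimes>\<^bsub>A\<^esub> x \<oplus>\<^bsub>A\<^esub> w \<otimes>\<^bsub>A\<^esub> y"
      by (rule triangular_ext) (use * in \<open>simp_all add: triangular_closed triangular_fst triangular_entry_simps triangular_el k.r_distr S.r_distr
        S.finsum_addf Pi_iff cong: S.finsum_cong\<close>)
  qed
qed

lemma triangular_to_matrix_hom:
  "triangular_to_matrix n S \<phi> \<in> ring_hom (triangular_ring n k S \<phi>) (matrix_ring n S)"
proof (rule ring_hom_memI)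
  fix x y assume *: "x \<in> carrier A" "y \<in> carrier A"
  show "triangular_to_matrix n S \<phi> (x \<otimes>\<^bsub>A\<^esub> y) =
      triangular_to_matrix n S \<phi> x \<otimes>\<^bsub>matrix_ring n S\<^esub> triangular_to_matrix n S \<phi> y"
    using * by (auto simp: fun_eq_iff triangular_to_matrix_def matrix_ring_def triangular_entry_simps triangular_el cong: S.finsum_cong)
  show "triangular_to_matrix n S \<phi> (x \<oplus>\<^bsub>A\<^esub> y) =
      triangular_to_matrix n S \<phi> x \<oplus>\<^bsub>matrix_ring n S\<^esub> triangular_to_matrix n S \<phi> y"
    using * by (auto simp: fun_eq_iff triangular_to_matrix_def matrix_ring_def triangular_entry_simps)
qed (auto simp: fun_eq_iff triangular_to_matrix_def matrix_ring_def triangular_entry_simps triangular_el)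

lemma column_ext:
  assumes "x \<in> carrier (P i)" "y \<in> carrier (P i)" "fst x = fst y" "i \<in> {1..n}"
    "\<And>r. r \<in> {1..n} \<Longrightarrow> i < r \<Longrightarrow> C i x r = C i y r"
  shows "x = y"
proof (rule prod_eqI)
  show "snd x = snd y"
    by (rule PiE_ext[of _ "{i<..n}" "\<lambda>_. carrier S"])
      (use assms in \<open>auto simp: column_module_def column_entry_def\<close>)
qed (rule assms)

lemma column_el:
  assumes "x \<in> carrier (P i)"
  shows "fst x \<in> carrier k" "r \<in> {1..n} \<Longrightarrow> C i x r \<in> carrier S"
  using assms by (auto simp: column_module_def column_entry_def PiE_iff)

lemma column_fst:
  "fst (x \<oplus>\<^bsub>P i\<^esub> y) = fst x \<oplus>\<^bsub>k\<^esub> fst y" "fst (a \<odot>\<^bsub>P i\<^esub> x) = fst a i \<otimes>\<^bsub>k\<^esub> fst x" "fst \<zero>\<^bsub>P i\<^esub> = \<zero>\<^bsub>k\<^esub>"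
  by (auto simp: column_module_def)

lemma column_entry_simps:
  assumes "i \<in> {1..n}" "r \<in> {1..n}"
  shows "\<lbrakk>a \<in> carrier A; x \<in> carrier (P i)\<rbrakk> \<Longrightarrow>
      C i (a \<odot>\<^bsub>P i\<^esub> x) r = (\<Oplus>\<^bsub>S\<^esub>l\<in>{1..n}. E a (r, l) \<otimes>\<^bsub>S\<^esub> C i x l)"
    and "\<lbrakk>x \<in> carrier (P i); y \<in> carrier (P i)\<rbrakk> \<Longrightarrow> C i (x \<oplus>\<^bsub>P i\<^esub> y) r = C i x r \<oplus>\<^bsub>S\<^esub> C i y r"
    and "C i \<zero>\<^bsub>P i\<^esub> r = \<zero>\<^bsub>S\<^esub>"
proof -
  assume *: "a \<in> carrier A" "x \<in> carrier (P i)"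
  have tri: "E a (i, l) = \<zero>\<^bsub>S\<^esub>" "C l x i = \<zero>\<^bsub>S\<^esub>" if "i < l" for l i
    using that by (simp_all add: triangular_entry_def column_entry_def)
  note f = S.finsum_triangular[of "{1..n}" r i "\<lambda>l. E a (r, l)" "\<lambda>l. C i x l"]
  show "C i (a \<odot>\<^bsub>P i\<^esub> x) r = (\<Oplus>\<^bsub>S\<^esub>l\<in>{1..n}. E a (r, l) \<otimes>\<^bsub>S\<^esub> C i x l)"
  proof (cases r i rule: linorder_cases)
    case less
    then have "C i (a \<odot>\<^bsub>P i\<^esub> x) r = \<zero>\<^bsub>S\<^esub>" by (simp add: column_entry_def)
    then show ?thesis using f assms * less by (simp add: triangular_el column_el tri)
  next
    case equal
    then have "C i (a \<odot>\<^bsub>P i\<^esub> x) r = E a (i, i) \<otimes>\<^bsub>S\<^esub> C i x i"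
      using assms * column_fst triangular_el column_el by (simp add: triangular_entry_def column_entry_def)
    then show ?thesis using f assms * equal by (simp add: triangular_el column_el tri)
  next
    case greater
    then show ?thesis using assms
      by (simp add: column_entry_def[of _ _ _ "_ \<odot>\<^bsub>P i\<^esub> _"]) (simp add: column_module_def)
  qed
next
  assume "x \<in> carrier (P i)" "y \<in> carrier (P i)"
  then show "C i (x \<oplus>\<^bsub>P i\<^esub> y) r = C i x r \<oplus>\<^bsub>S\<^esub> C i y r"
    using assms by (auto simp: column_entry_def column_module_def PiE_iff)
qed (use assms in \<open>auto simp: column_entry_def column_module_def\<close>)

lemma column_closed:
  assumes "i \<in> {1..n}"
  shows "\<lbrakk>a \<in> carrier A; x \<in> carrier (P i)\<rbrakk> \<Longrightarrow> a \<odot>\<^bsub>P i\<^esub> x \<in> carrier (P i)"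
    "\<lbrakk>x \<in> carrier (P i); y \<in> carrier (P i)\<rbrakk> \<Longrightarrow> x \<oplus>\<^bsub>P i\<^esub> y \<in> carrier (P i)"
    "\<zero>\<^bsub>P i\<^esub> \<in> carrier (P i)"
proof -
  assume *: "a \<in> carrier A" "x \<in> carrier (P i)"
  have "(\<Oplus>\<^bsub>S\<^esub>l\<in>{1..n}. E a (r, l) \<otimes>\<^bsub>S\<^esub> C i x l) \<in> carrier S" if "r \<in> {1..n}" for r
    using that triangular_el[OF *(1)] column_el[OF *(2)] by (auto intro!: S.finsum_closed)
  then show "a \<odot>\<^bsub>P i\<^esub> x \<in> carrier (P i)"
    using assms triangular_el[OF *(1)] column_el[OF *(2)] by (auto simp: column_module_def PiE_iff)
qed (auto simp: column_module_def PiE_iff)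

lemma left_module_column_module:
  assumes i: "i \<in> {1..n}"
  shows "left_module (triangular_ring n k S \<phi>) (column_module n k S \<phi> i)"
proof -
  note ext = column_ext[OF _ _ _ i] and cl = column_closed[OF i] triangular_closed
  note simps = column_fst column_entry_simps[OF i] column_el triangular_el triangular_fst triangular_entry_simps i i[simplified]
  have neg: "\<exists>y\<in>carrier (P i). y \<oplus>\<^bsub>P i\<^esub> x = \<zero>\<^bsub>P i\<^esub>" if "x \<in> carrier (P i)" for x
    by (rule bexI[of _ "(\<ominus>\<^bsub>k\<^esub> fst x, \<lambda>r\<in>{i<..n}. \<ominus>\<^bsub>S\<^esub> snd x r)"])
      (use that in \<open>auto simp: column_module_def PiE_iff k.l_neg S.l_neg\<close>)
  have ag: "abelian_group (P i)"
  proof (rule abelian_groupI)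
    fix x y w assume *: "x \<in> carrier (P i)" "y \<in> carrier (P i)" "w \<in> carrier (P i)"
    show "x \<oplus>\<^bsub>P i\<^esub> y \<oplus>\<^bsub>P i\<^esub> w = x \<oplus>\<^bsub>P i\<^esub> (y \<oplus>\<^bsub>P i\<^esub> w)"
      by (rule ext) (use * in \<open>simp_all add: cl simps k.a_assoc S.a_assoc\<close>)
    show "x \<oplus>\<^bsub>P i\<^esub> y = y \<oplus>\<^bsub>P i\<^esub> x"
      by (rule ext) (use * in \<open>simp_all add: cl simps k.a_comm S.a_comm\<close>)
  next
    fix x assume *: "x \<in> carrier (P i)"
    show "\<zero>\<^bsub>P i\<^esub> \<oplus>\<^bsub>P i\<^esub> x = x"
      by (rule ext) (use * in \<open>simp_all add: cl simps\<close>)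
  qed (auto simp: cl neg)
  show ?thesis
  proof (intro left_module.intro left_module_axioms.intro ag ring_triangular_ring)
    fix a b x y assume *: "a \<in> carrier A" "b \<in> carrier A" "x \<in> carrier (P i)"
    show "(a \<oplus>\<^bsub>A\<^esub> b) \<odot>\<^bsub>P i\<^esub> x = a \<odot>\<^bsub>P i\<^esub> x \<oplus>\<^bsub>P i\<^esub> b \<odot>\<^bsub>P i\<^esub> x"
      by (rule ext) (use * in \<open>simp_all add: cl simps k.l_distr S.l_distr
        S.finsum_addf Pi_iff cong: S.finsum_cong\<close>)
    show "(a \<otimes>\<^bsub>A\<^esub> b) \<odot>\<^bsub>P i\<^esub> x = a \<odot>\<^bsub>P i\<^esub> (b \<odot>\<^bsub>P i\<^esub> x)"
      by (rule ext) (use * S.matrix_product_assoc[of "{1..n}"] in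
        \<open>simp_all add: cl simps k.m_assoc Pi_iff S.finsum_closed cong: S.finsum_cong\<close>)
  next
    fix a x y assume *: "a \<in> carrier A" "x \<in> carrier (P i)" "y \<in> carrier (P i)"
    show "a \<odot>\<^bsub>P i\<^esub> (x \<oplus>\<^bsub>P i\<^esub> y) = a \<odot>\<^bsub>P i\<^esub> x \<oplus>\<^bsub>P i\<^esub> a \<odot>\<^bsub>P i\<^esub> y"
      by (rule ext) (use * in \<open>simp_all add: cl simps k.r_distr S.r_distr
        S.finsum_addf Pi_iff cong: S.finsum_cong\<close>)
  next
    fix x assume *: "x \<in> carrier (P i)"
    show "\<one>\<^bsub>A\<^esub> \<odot>\<^bsub>P i\<^esub> x = x"
      by (rule ext) (use * S.finsum_delta_left[of "{1..n}"] in
        \<open>simp_all add: cl simps Pi_iff cong: S.finsum_cong\<close>)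
  qed (simp add: cl)
qed

lemma column_map_linear:
  assumes i: "i \<in> {1..n}"
  shows "column_map n k S \<phi> i \<in> linear_hom (triangular_ring n k S \<phi>)
           (column_module n k S \<phi> n) (column_module n k S \<phi> i)"
proof (cases "i = n")
  case True
  then have "column_map n k S \<phi> i = id" by (auto simp: column_map_def)
  then show ?thesis using True by (simp add: linear_hom_id)
next
  case False
  let ?s = "column_map n k S \<phi> i"
  have n: "n \<in> {1..n}" "i < n" using i False by auto
  have s: "?s c \<in> carrier (P i)" "fst (?s c) = \<zero>\<^bsub>k\<^esub>"
    "\<And>r. r \<in> {1..n} \<Longrightarrow> C i (?s c) r = (if r = n then \<phi> (fst c) else \<zero>\<^bsub>S\<^esub>)"
    if "c \<in> carrier (P n)" for c
    using that False n by (auto simp: column_map_def column_module_def column_entry_def PiE_iff)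
  note ext = column_ext[OF _ _ _ i]
  note cl = column_closed[OF i] column_closed[OF n(1)] triangular_closed
  note simps = column_fst column_entry_simps[OF i] column_el triangular_el triangular_fst triangular_entry_simps i i[simplified] s
  show ?thesis
    unfolding linear_hom_def
  proof (intro CollectI conjI ballI)
    show "?s \<in> carrier (P n) \<rightarrow> carrier (P i)" using s by auto
  next
    fix x y assume *: "x \<in> carrier (P n)" "y \<in> carrier (P n)"
    show "?s (x \<oplus>\<^bsub>P n\<^esub> y) = ?s x \<oplus>\<^bsub>P i\<^esub> ?s y"
      by (rule ext) (use * in \<open>simp_all add: cl simps\<close>)
  next
    fix a x assume *: "a \<in> carrier A" "x \<in> carrier (P n)"
    have E: "E a (r, n) = (if r = n then \<phi> (fst a n) else \<zero>\<^bsub>S\<^esub>)" if "r \<in> {1..n}" for r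
      using that by (auto simp: triangular_entry_def)
    have "(\<Oplus>\<^bsub>S\<^esub>l\<in>{1..n}. E a (r, l) \<otimes>\<^bsub>S\<^esub> C i (?s x) l) =
        (\<Oplus>\<^bsub>S\<^esub>l\<in>{1..n}. if n = l then E a (r, l) \<otimes>\<^bsub>S\<^esub> \<phi> (fst x) else \<zero>\<^bsub>S\<^esub>)" if "r \<in> {1..n}" for r
      using that * s(3)[of x] by (intro S.finsum_cong') (auto simp: triangular_el column_el)
    also have "\<dots> r = E a (r, n) \<otimes>\<^bsub>S\<^esub> \<phi> (fst x)" if "r \<in> {1..n}" for r
      using S.add.finprod_singleton[of n "{1..n}" "\<lambda>l. E a (r, l) \<otimes>\<^bsub>S\<^esub> \<phi> (fst x)"] that * n
      by (simp add: triangular_el column_el Pi_iff)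
    finally have sum: "(\<Oplus>\<^bsub>S\<^esub>l\<in>{1..n}. E a (r, l) \<otimes>\<^bsub>S\<^esub> C i (?s x) l) = E a (r, n) \<otimes>\<^bsub>S\<^esub> \<phi> (fst x)"
      if "r \<in> {1..n}" for r using that by simp
    show "?s (a \<odot>\<^bsub>P n\<^esub> x) = a \<odot>\<^bsub>P i\<^esub> ?s x"
    proof (rule ext)
      fix r assume r: "r \<in> {1..n}" "i < r"
      have "C i (a \<odot>\<^bsub>P i\<^esub> ?s x) r = E a (r, n) \<otimes>\<^bsub>S\<^esub> \<phi> (fst x)"
        using column_entry_simps(1)[OF i r(1) *(1) s(1)[OF *(2)]] sum[OF r(1)] by simp
      then show "C i (?s (a \<odot>\<^bsub>P n\<^esub> x)) r = C i (a \<odot>\<^bsub>P i\<^esub> ?s x) r"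
        using * r n E[OF r(1)] by (simp add: simps cl)
    qed (use * n in \<open>simp_all add: cl simps\<close>)
  qed
qed

end

end

theory Submission
  imports Defs "HOL-Algebra.UnivPoly"
begin

text \<open>
  Let $e_i$ be the diagonal idempotents of $A$. Then $P_i = Ae_i$, and $s_i$ is right multiplication
  by the element $c_i \<in> e_nAe_i$ with entry one in position $(n,i)$, where $c_n = e_n$. For a ring
  homomorphism $h : A \<rightarrow> T$ the module $T \<otimes>_A P_i$ is $T h(e_i)$, and $1 \<otimes> s_i$ becomes right multiplication by
  $h(c_i)$ (\<open>base_change_map_iso_iff\<close>). Such a map is bijective exactly when $h(c_i)$ has an
  inverse $v_i$ between the idempotents $h(e_i)$ and $h(e_n)$ (\<open>inverting_iff\<close>). In $M_n(S)$ the matrix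
  units in the last column are such inverses.

  Now let $h$ be inverting. The elements $v_i$ and $h(c_i)$ generate a full system of matrix units in
  $T$, so $T$ is the ring of $n \<times> n$ matrices over its corner $h(e_n)Th(e_n)$ (\<open>matrix_units\<close>). An
  entry $s \<in> S$ of $A$ in position $(i,j)$ becomes an element of the corner which does not depend on
  the row, because left multiplication by $c_i$ brings it to the last row; write $\<beta>_j(s)$ for it.
  Multiplication in $A$ gives $\<beta>_l(s) \<beta>_j(t) = \<beta>_j(st)$ for $j < l < n$. The case $t = 1$
  shows that $\<beta>_j$ does not depend on the column either, and then, for $l = 2$ and $j = 1$, that
  $\<beta> = \<beta>_1$ is multiplicative; these two columns exist because $n \<ge> 3$.

  Applying $\<beta>$ to the entries gives the ring homomorphism $M_n(S) \<rightarrow> T$. It extends $h$, also on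
  the diagonal, because an entry in $k$ can be moved below the diagonal by multiplication with some
  $c_j$, where it becomes an entry in $S$ (\<open>entry_h\<close>). It is unique, because inverses are unique and
  $M_n(S)$ is generated by the image of $A$ and the inverses of the images of the $c_i$
  (\<open>lift_unique\<close>).
\<close>

section \<open>Tensor products with a principal projective module\<close>

definition pure_tensor ::
    "('r, 'x) ring_scheme \<Rightarrow> ('r, 'm) module \<Rightarrow> ('r, 'n) module \<Rightarrow> 'm \<Rightarrow> 'n \<Rightarrow> ('m \<times> 'n \<Rightarrow>\<^sub>0 int) set" where
  "pure_tensor R M N x y =
     tensor_kernel R M N #>\<^bsub>free_Abelian_group (carrier M \<times> carrier N)\<^esub> frag_of (x, y)"

lemma keys_add_subset: "Poly_Mapping.keys a \<subseteq> X \<Longrightarrow> Poly_Mapping.keys b \<subseteq> X \<Longrightarrow> Poly_Mapping.keys (a + b) \<subseteq> X"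
  for a b :: "'x \<Rightarrow>\<^sub>0 int"
  using Poly_Mapping.keys_add[of a b] by blast

context
  fixes R :: "('r, 'x) ring_scheme" and M :: "('r, 'm) module" and N :: "('r, 'n) module"
  assumes N: "left_module R N" and M: "right_module R M"
begin

interpretation N: left_module R N by (rule N)
interpretation M: right_module R M by (rule M)

private abbreviation (input) "F \<equiv> free_Abelian_group (carrier M \<times> carrier N)"
private abbreviation (input) "K \<equiv> tensor_kernel R M N"

lemma tensor_kernel_normal: "tensor_kernel R M N \<lhd> free_Abelian_group (carrier M \<times> carrier N)"
proof -
  interpret comm_group F by (rule abelian_free_Abelian_group)
  show ?thesis using tensor_kernel_subgroup[OF N M] by (rule subgroup_imp_normal)
qed

lemma pure_tensor_closed:
  "\<lbrakk>x \<in> carrier M; y \<in> carrier N\<rbrakk> \<Longrightarrow> pure_tensor R M N x y \<in> carrier (tensor R M N)"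
  by (auto simp: pure_tensor_def tensor_def carrier_FactGroup)

lemma pure_tensor_add_left:
  assumes "x \<in> carrier M" "x' \<in> carrier M" "y \<in> carrier N"
  shows "pure_tensor R M N (x \<oplus>\<^bsub>M\<^esub> x') y =
    pure_tensor R M N x y \<otimes>\<^bsub>tensor R M N\<^esub> pure_tensor R M N x' y"
proof -
  have "pure_tensor R M N x y \<otimes>\<^bsub>tensor R M N\<^esub> pure_tensor R M N x' y =
      K #>\<^bsub>F\<^esub> (frag_of (x, y) + frag_of (x', y))"
    using normal.rcos_sum[OF tensor_kernel_normal, of "frag_of (x, y)" "frag_of (x', y)"] assms
    by (simp add: pure_tensor_def tensor_def)
  also have "\<dots> = K #>\<^bsub>F\<^esub> frag_of (x \<oplus>\<^bsub>M\<^esub> x', y)"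
  proof (subst tensor_coset_eq_iff[OF N M])
    have "- (frag_of (x \<oplus>\<^bsub>M\<^esub> x', y) - frag_of (x, y) - frag_of (x', y)) \<in> K"
      using assms by (intro tensor_kernel_minus[OF N M] tensor_kernel_relation[OF N M] tensor_relationsI)
    then show "frag_of (x, y) + frag_of (x', y) - frag_of (x \<oplus>\<^bsub>M\<^esub> x', y) \<in> K"
      by (simp add: algebra_simps)
    show "Poly_Mapping.keys (frag_of (x, y) + frag_of (x', y)) \<subseteq> carrier M \<times> carrier N"
      using assms by (intro keys_add_subset) auto
  qed (use assms in auto)
  finally show ?thesis by (simp add: pure_tensor_def)
qed

lemma pure_tensor_balanced:
  assumes "a \<in> carrier R" "x \<in> carrier M" "y \<in> carrier N"
  shows "pure_tensor R M N (a \<odot>\<^bsub>M\<^esub> x) y = pure_tensor R M N x (a \<odot>\<^bsub>N\<^esub> y)"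
  unfolding pure_tensor_def
  by (subst tensor_coset_eq_iff[OF N M])
    (use assms in \<open>auto intro!: tensor_kernel_relation[OF N M] tensor_relationsI
      simp: M.smult_closed N.smult_closed\<close>)

text \<open>
  To map out of the tensor product it is enough to give a balanced biadditive map: it extends to
  the free Abelian group, and each defining relation of the tensor product dies in \<open>G\<close>.
\<close>

lemma tensor_universal:
  assumes G: "comm_group G"
    and b: "\<And>x y. \<lbrakk>x \<in> carrier M; y \<in> carrier N\<rbrakk> \<Longrightarrow> b x y \<in> carrier G"
    "\<And>x x' y. \<lbrakk>x \<in> carrier M; x' \<in> carrier M; y \<in> carrier N\<rbrakk> \<Longrightarrow> b (x \<oplus>\<^bsub>M\<^esub> x') y = b x y \<otimes>\<^bsub>G\<^esub> b x' y"
    "\<And>x y y'. \<lbrakk>x \<in> carrier M; y \<in> carrier N; y' \<in> carrier N\<rbrakk> \<Longrightarrow> b x (y \<oplus>\<^bsub>N\<^esub> y') = b x y \<otimes>\<^bsub>G\<^esub> b x y'"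
    "\<And>a x y. \<lbrakk>a \<in> carrier R; x \<in> carrier M; y \<in> carrier N\<rbrakk> \<Longrightarrow> b (a \<odot>\<^bsub>M\<^esub> x) y = b x (a \<odot>\<^bsub>N\<^esub> y)"
  obtains \<Psi> where "\<Psi> \<in> hom (tensor R M N) G"
    "\<And>x y. \<lbrakk>x \<in> carrier M; y \<in> carrier N\<rbrakk> \<Longrightarrow> \<Psi> (pure_tensor R M N x y) = b x y"
proof -
  interpret G: comm_group G by (rule G)
  obtain h where h: "h \<in> hom F G" "\<And>z. z \<in> carrier M \<times> carrier N \<Longrightarrow> h (frag_of z) = case_prod b z"
    by (rule G.free_Abelian_group_universal[of "case_prod b" "carrier M \<times> carrier N"]) (use b in auto)
  interpret h: group_hom F G h
    using h(1) by (intro group_hom.intro group_hom_axioms.intro) auto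
  have hd: "h (c - d) = h c \<otimes>\<^bsub>G\<^esub> inv\<^bsub>G\<^esub> h d"
    if "Poly_Mapping.keys c \<subseteq> carrier M \<times> carrier N" "Poly_Mapping.keys d \<subseteq> carrier M \<times> carrier N" for c d
    using h.hom_mult[of c "- d"] h.hom_inv[of d] that
    by (simp add: carrier_free_Abelian_group_iff)
  have "K \<subseteq> kernel F G h"
  proof
    fix c assume c: "c \<in> K"
    have rel: "h c = \<one>\<^bsub>G\<^esub>" if "c \<in> tensor_relations R M N" for c
      using that
    proof (cases rule: tensor_relationsE)
      case (left x x' y)
      then have "h c = b (x \<oplus>\<^bsub>M\<^esub> x') y \<otimes>\<^bsub>G\<^esub> inv\<^bsub>G\<^esub> b x y \<otimes>\<^bsub>G\<^esub> inv\<^bsub>G\<^esub> b x' y"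
        using h(2) by (auto simp: hd keys_diff_subset)
      then show ?thesis using left b(1) by (simp add: b G.m_ac G.inv_solve_right')
    next
      case (right x y y')
      then have "h c = b x (y \<oplus>\<^bsub>N\<^esub> y') \<otimes>\<^bsub>G\<^esub> inv\<^bsub>G\<^esub> b x y \<otimes>\<^bsub>G\<^esub> inv\<^bsub>G\<^esub> b x y'"
        using h(2) by (auto simp: hd keys_diff_subset)
      then show ?thesis using right b(1) by (simp add: b G.m_ac G.inv_solve_right')
    next
      case (balanced a x y)
      then have "h c = b (a \<odot>\<^bsub>M\<^esub> x) y \<otimes>\<^bsub>G\<^esub> inv\<^bsub>G\<^esub> b x (a \<odot>\<^bsub>N\<^esub> y)"
        using h(2) by (auto simp: hd keys_diff_subset M.smult_closed N.smult_closed)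
      then show ?thesis using balanced b(1) by (simp add: b N.smult_closed)
    qed
    have "Poly_Mapping.keys c \<subseteq> carrier M \<times> carrier N \<and> h c = \<one>\<^bsub>G\<^esub>"
    proof (induction rule: tensor_kernel_induct[OF N M c])
      case 1
      then show ?case using h.hom_one by simp
    next
      case (2 c)
      then show ?case using rel tensor_relations_keys[OF N M] by blast
    next
      case (3 c)
      then show ?case using hd[of 0 c] h.hom_one by simp
    next
      case (4 c d)
      then show ?case
        using h.hom_mult[of c d] by (simp add: carrier_free_Abelian_group_iff keys_add_subset)
    qed
    then show "c \<in> kernel F G h" by (simp add: kernel_def carrier_free_Abelian_group_iff)
  qed
  then obtain \<Psi> where \<Psi>: "\<Psi> \<in> hom (F Mod K) G" "\<And>c. c \<in> carrier F \<Longrightarrow> \<Psi> (K #>\<^bsub>F\<^esub> c) = h c"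
    using h.FactGroup_universal_kernel[OF tensor_kernel_normal] by blast
  show thesis
    by (rule that[of \<Psi>]) (use \<Psi> h(2) in \<open>auto simp: tensor_def pure_tensor_def\<close>)
qed

text \<open>
  Shifting a representative by an element of the kernel does not change the image coset, since
  linear maps carry the kernel into the kernel; so the union that defines \<open>tensor_map\<close> collapses.
\<close>

lemma tensor_map_pure:
  assumes N': "left_module R N'" and M': "right_module R M'"
    and f: "f \<in> linear_hom R M M'" and g: "g \<in> linear_hom R N N'"
    and xy: "x \<in> carrier M" "y \<in> carrier N"
  shows "tensor_map R M' N' f g (pure_tensor R M N x y) = pure_tensor R M' N' (f x) (g y)"
proof -
  let ?h = "frag_extend (\<lambda>(x, y). frag_of (f x, g y))"
  let ?F' = "free_Abelian_group (carrier M' \<times> carrier N')"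
  have fg: "f \<in> carrier M \<rightarrow> carrier M'" "g \<in> carrier N \<rightarrow> carrier N'" using f g by (auto simp: linear_hom_def)
  have "tensor_kernel R M' N' #>\<^bsub>?F'\<^esub> ?h (c + frag_of (x, y)) = pure_tensor R M' N' (f x) (g y)"
    if c: "c \<in> K" for c
    unfolding pure_tensor_def
  proof (subst tensor_coset_eq_iff[OF N' M'])
    have "Poly_Mapping.keys (c + frag_of (x, y)) \<subseteq> carrier M \<times> carrier N"
      using tensor_kernel_keys[OF N M c] xy by (intro keys_add_subset) auto
    then show "Poly_Mapping.keys (?h (c + frag_of (x, y))) \<subseteq> carrier M' \<times> carrier N'"
      by (rule keys_frag_pair[OF fg])
    show "?h (c + frag_of (x, y)) - frag_of (f x, g y) \<in> tensor_kernel R M' N'"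
      using tensor_kernel_map[OF N M N' M' f g c] by (simp add: frag_extend_add)
  qed (use fg xy in auto)
  moreover have "0 \<in> K" by (rule tensor_kernel_0[OF N M])
  ultimately show ?thesis
    unfolding tensor_map_def pure_tensor_def[of R M N] r_coset_def[of F] by auto
qed

end

text \<open>
  This is a one-element dual basis. It makes \<open>\<delta>\<close> an isomorphism of \<open>P\<close> onto the left ideal $Ae$ with
  $e = \<delta>(p)$, and $e$ is idempotent by \<open>dual_idem\<close>.
\<close>

locale principal_projective = left_module A P for A :: "'a ring" and P :: "('a, 'p) module" +
  fixes p :: 'p and \<delta> :: "'p \<Rightarrow> 'a"
  assumes gen_closed: "p \<in> carrier P"
    and dual_linear: "\<delta> \<in> linear_hom A P (left_restrict id A)"
    and dual_basis: "x \<in> carrier P \<Longrightarrow> \<delta> x \<odot>\<^bsub>P\<^esub> p = x"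
begin

lemma dual_closed: "x \<in> carrier P \<Longrightarrow> \<delta> x \<in> carrier A"
  and dual_add: "\<lbrakk>x \<in> carrier P; y \<in> carrier P\<rbrakk> \<Longrightarrow> \<delta> (x \<oplus>\<^bsub>P\<^esub> y) = \<delta> x \<oplus>\<^bsub>A\<^esub> \<delta> y"
  and dual_smult: "\<lbrakk>a \<in> carrier A; x \<in> carrier P\<rbrakk> \<Longrightarrow> \<delta> (a \<odot>\<^bsub>P\<^esub> x) = a \<otimes>\<^bsub>A\<^esub> \<delta> x"
  using dual_linear by (auto simp: linear_hom_def left_restrict_def)

lemma dual_idem: "x \<in> carrier P \<Longrightarrow> \<delta> x \<otimes>\<^bsub>A\<^esub> \<delta> p = \<delta> x"
  using dual_smult[OF dual_closed gen_closed] dual_basis by simp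

end

text \<open>
  For an idempotent $e$ this is the left ideal $Te$; membership by an equation avoids
  carrying a witness.
\<close>

definition idempotent_left_ideal :: "('t, 'x) ring_scheme \<Rightarrow> 't \<Rightarrow> 't set" where
  "idempotent_left_ideal T e = {t \<in> carrier T. t \<otimes>\<^bsub>T\<^esub> e = t}"

context principal_projective
begin

context
  fixes T :: "'t ring" and h :: "'a \<Rightarrow> 't"
  assumes T: "ring T" and h: "h \<in> ring_hom A T"
begin

interpretation T: ring T by (rule T)

private abbreviation (input) "B \<equiv> right_restrict h T"
private abbreviation (input) "pt \<equiv> pure_tensor A (right_restrict h T) P"

private lemma B: "right_module A B"
  using right_module_right_restrict[OF R.ring_axioms T h] .
private lemma P: "left_module A P" ..

private lemma Bs: "carrier B = carrier T" "x \<oplus>\<^bsub>B\<^esub> y = x \<oplus>\<^bsub>T\<^esub> y" "a \<odot>\<^bsub>B\<^esub> x = x \<otimes>\<^bsub>T\<^esub> h a"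
  by (simp_all add: right_restrict_def)

private lemma hc: "a \<in> carrier A \<Longrightarrow> h a \<in> carrier T" using h by (rule ring_hom_closed)

text \<open>
  From $x = \<delta>(x) p$ one gets $t \<otimes> x = t\,h(\<delta>(x)) \<otimes> p$, so the elements $t \<otimes> p$ form a generating
  set; it is already closed under subtraction. The same rule for $x = p$ moves $t$ into the
  left ideal.
\<close>

lemma base_change_generated:
  assumes "X \<in> carrier (base_change A T h P)"
  obtains t where "t \<in> idempotent_left_ideal T (h (\<delta> p))" "X = pt t p"
proof -
  let ?F = "free_Abelian_group (carrier B \<times> carrier P)"
  let ?K = "tensor_kernel A B P"
  obtain c where c: "Poly_Mapping.keys c \<subseteq> carrier B \<times> carrier P" "X = ?K #>\<^bsub>?F\<^esub> c"
    using assms by (auto simp: base_change_def Let_def tensor_def carrier_FactGroup)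
  have "\<exists>t\<in>carrier T. c - frag_of (t, p) \<in> ?K"
    using c(1)
  proof (induction c rule: frag_induction)
    case zero
    have "frag_of (\<zero>\<^bsub>T\<^esub> \<oplus>\<^bsub>B\<^esub> \<zero>\<^bsub>T\<^esub>, p) - frag_of (\<zero>\<^bsub>T\<^esub>, p) - frag_of (\<zero>\<^bsub>T\<^esub>, p) \<in> ?K"
      by (intro tensor_kernel_relation[OF P B] tensor_relationsI) (auto simp: Bs gen_closed)
    then show ?case by (intro bexI[of _ "\<zero>\<^bsub>T\<^esub>"]) (auto simp: Bs)
  next
    case (one z)
    obtain t x where z: "z = (t, x)" "t \<in> carrier T" "x \<in> carrier P"
      using one by (auto simp: Bs)
    have "frag_of (\<delta> x \<odot>\<^bsub>B\<^esub> t, p) - frag_of (t, \<delta> x \<odot>\<^bsub>P\<^esub> p) \<in> ?K"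
      using z by (intro tensor_kernel_relation[OF P B] tensor_relationsI) (auto simp: Bs gen_closed dual_closed)
    then have "- (frag_of (t \<otimes>\<^bsub>T\<^esub> h (\<delta> x), p) - frag_of z) \<in> ?K"
      using z by (intro tensor_kernel_minus[OF P B]) (simp add: Bs dual_basis)
    then show ?case
      using z by (intro bexI[of _ "t \<otimes>\<^bsub>T\<^esub> h (\<delta> x)"]) (auto simp: hc dual_closed)
  next
    case (diff c d)
    then obtain t u where tu: "t \<in> carrier T" "u \<in> carrier T" "c - frag_of (t, p) \<in> ?K" "d - frag_of (u, p) \<in> ?K"
      by blast
    have "t \<ominus>\<^bsub>T\<^esub> u \<oplus>\<^bsub>T\<^esub> u = t"
      using tu by (simp add: a_minus_def T.a_assoc T.l_neg)
    moreover have "frag_of ((t \<ominus>\<^bsub>T\<^esub> u) \<oplus>\<^bsub>B\<^esub> u, p) - frag_of (t \<ominus>\<^bsub>T\<^esub> u, p) - frag_of (u, p) \<in> ?K"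
      using tu by (intro tensor_kernel_relation[OF P B] tensor_relationsI) (auto simp: Bs gen_closed)
    ultimately have "frag_of (t, p) - frag_of (t \<ominus>\<^bsub>T\<^esub> u, p) - frag_of (u, p) \<in> ?K"
      by (simp add: Bs)
    from tensor_kernel_add[OF P B this tensor_kernel_diff[OF P B tu(3,4)]]
    have "c - d - frag_of (t \<ominus>\<^bsub>T\<^esub> u, p) \<in> ?K" by (simp add: algebra_simps)
    then show ?case using tu by (intro bexI[of _ "t \<ominus>\<^bsub>T\<^esub> u"]) auto
  qed
  then obtain t where t: "t \<in> carrier T" "c - frag_of (t, p) \<in> ?K" by blast
  then have "X = pt t p"
    unfolding pure_tensor_def c(2) using c(1) gen_closed
    by (subst tensor_coset_eq_iff[OF P B]) (auto simp: Bs)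
  also have "\<dots> = pt (t \<otimes>\<^bsub>T\<^esub> h (\<delta> p)) p"
    using pure_tensor_balanced[OF P B, of "\<delta> p" t p] t gen_closed
    by (simp add: Bs dual_closed dual_basis)
  finally have "X = pt (t \<otimes>\<^bsub>T\<^esub> h (\<delta> p)) p" .
  moreover have "h (\<delta> p) \<otimes>\<^bsub>T\<^esub> h (\<delta> p) = h (\<delta> p)"
    using ring_hom_mult[OF h, of "\<delta> p" "\<delta> p"] dual_idem[OF gen_closed] dual_closed[OF gen_closed] by simp
  then have "t \<otimes>\<^bsub>T\<^esub> h (\<delta> p) \<in> idempotent_left_ideal T (h (\<delta> p))"
    using t hc[OF dual_closed[OF gen_closed]] by (simp add: idempotent_left_ideal_def T.m_assoc)
  ultimately show thesis using that by blast
qed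

text \<open>
  The base change of $Ae$ is $T h(e)$: the evaluation $t \<otimes> x \<mapsto> t\,h(\<delta>(x))$ is inverse to
  $t \<mapsto> t \<otimes> p$.
\<close>

lemma base_change_evaluation:
  obtains \<Phi> where "\<And>t x. \<lbrakk>t \<in> carrier T; x \<in> carrier P\<rbrakk> \<Longrightarrow> \<Phi> (pt t x) = t \<otimes>\<^bsub>T\<^esub> h (\<delta> x)"
    "bij_betw \<Phi> (carrier (base_change A T h P)) (idempotent_left_ideal T (h (\<delta> p)))"
proof -
  have G: "comm_group (add_monoid T)" by (rule T.a_comm_group)
  obtain \<Phi> where \<Phi>: "\<And>t x. \<lbrakk>t \<in> carrier T; x \<in> carrier P\<rbrakk> \<Longrightarrow> \<Phi> (pt t x) = t \<otimes>\<^bsub>T\<^esub> h (\<delta> x)"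
    by (rule tensor_universal[OF P B G, of "\<lambda>t x. t \<otimes>\<^bsub>T\<^esub> h (\<delta> x)"])
      (auto simp: Bs hc dual_closed dual_add dual_smult T.l_distr T.r_distr T.m_assoc
        ring_hom_add[OF h] ring_hom_mult[OF h])
  have gen: "\<Phi> (pt t p) = t" if "t \<in> idempotent_left_ideal T (h (\<delta> p))" for t
    using that \<Phi>[of t p] gen_closed by (auto simp: idempotent_left_ideal_def)
  have "bij_betw \<Phi> (carrier (base_change A T h P)) (idempotent_left_ideal T (h (\<delta> p)))"
  proof (rule bij_betw_byWitness[where f' = "\<lambda>t. pt t p"])
    show "\<forall>X\<in>carrier (base_change A T h P). pt (\<Phi> X) p = X"
      using gen by (metis base_change_generated)
    show "\<forall>t\<in>idempotent_left_ideal T (h (\<delta> p)). \<Phi> (pt t p) = t" using gen by blast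
    show "\<Phi> ` carrier (base_change A T h P) \<subseteq> idempotent_left_ideal T (h (\<delta> p))"
      using gen by (metis base_change_generated image_subsetI)
    show "(\<lambda>t. pt t p) ` idempotent_left_ideal T (h (\<delta> p)) \<subseteq> carrier (base_change A T h P)"
      using pure_tensor_closed[OF P B] gen_closed
      by (auto simp: base_change_def Let_def idempotent_left_ideal_def Bs)
  qed
  with \<Phi> show thesis by (rule that)
qed

lemma base_change_pure:
  shows base_change_add_pure: "\<lbrakk>t \<in> carrier T; u \<in> carrier T; x \<in> carrier P\<rbrakk> \<Longrightarrow>
      pt t x \<oplus>\<^bsub>base_change A T h P\<^esub> pt u x = pt (t \<oplus>\<^bsub>T\<^esub> u) x"
    and base_change_smult_pure: "\<lbrakk>b \<in> carrier T; t \<in> carrier T; x \<in> carrier P\<rbrakk> \<Longrightarrow>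
      b \<odot>\<^bsub>base_change A T h P\<^esub> pt t x = pt (b \<otimes>\<^bsub>T\<^esub> t) x"
    and base_change_pure_closed: "\<lbrakk>t \<in> carrier T; x \<in> carrier P\<rbrakk> \<Longrightarrow>
      pt t x \<in> carrier (base_change A T h P)"
    and base_change_map_pure: "\<lbrakk>left_module A Q; s \<in> linear_hom A P Q; t \<in> carrier T; x \<in> carrier P\<rbrakk> \<Longrightarrow>
      base_change_map A T h Q s (pt t x) = pure_tensor A (right_restrict h T) Q t (s x)"
proof -
  assume *: "t \<in> carrier T" "x \<in> carrier P"
  show "pt t x \<oplus>\<^bsub>base_change A T h P\<^esub> pt u x = pt (t \<oplus>\<^bsub>T\<^esub> u) x" if "u \<in> carrier T"
    using pure_tensor_add_left[OF P B, of t u x] * that by (simp add: base_change_def Let_def Bs)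
  show "b \<odot>\<^bsub>base_change A T h P\<^esub> pt t x = pt (b \<otimes>\<^bsub>T\<^esub> t) x" if "b \<in> carrier T"
  proof -
    have "(\<lambda>x. b \<otimes>\<^bsub>T\<^esub> x) \<in> linear_hom A B B"
      using that by (auto simp: linear_hom_def Bs T.r_distr T.m_assoc hc)
    from tensor_map_pure[OF P B P B this linear_hom_id] show ?thesis
      using * by (simp add: base_change_def Let_def Bs)
  qed
  show "pt t x \<in> carrier (base_change A T h P)"
    using * pure_tensor_closed[OF P B] by (simp add: base_change_def Let_def Bs)
  show "base_change_map A T h Q s (pt t x) = pure_tensor A B Q t (s x)"
    if "left_module A Q" "s \<in> linear_hom A P Q"
    using tensor_map_pure[OF P B that(1) B linear_hom_id that(2)] *
    by (simp add: base_change_map_def Bs)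
qed

end

end

text \<open>
  A linear map $Ae \<rightarrow> Af$ is right multiplication by the element $c$ of $eAf$ to which it sends $e$.
  After the identifications of \<open>base_change_evaluation\<close>, its base change is right multiplication
  by $h(c)$. Linearity is automatic, so only bijectivity is at stake.
\<close>

lemma base_change_map_iso_iff:
  assumes P: "principal_projective A P p \<delta>" and Q: "principal_projective A Q q \<epsilon>"
    and T: "ring T" and h: "h \<in> ring_hom A T" and s: "s \<in> linear_hom A P Q"
  shows "base_change_map A T h Q s \<in> linear_iso T (base_change A T h P) (base_change A T h Q) \<longleftrightarrow>
    bij_betw (\<lambda>t. t \<otimes>\<^bsub>T\<^esub> h (\<epsilon> (s p))) (idempotent_left_ideal T (h (\<delta> p))) (idempotent_left_ideal T (h (\<epsilon> q)))"
    (is "?f \<in> linear_iso T ?BP ?BQ \<longleftrightarrow> bij_betw ?c ?LP ?LQ")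
proof -
  interpret P: principal_projective A P p \<delta> by (rule P)
  interpret Q: principal_projective A Q q \<epsilon> by (rule Q)
  interpret T: ring T by (rule T)
  let ?pP = "pure_tensor A (right_restrict h T) P" and ?pQ = "pure_tensor A (right_restrict h T) Q"
  note genP = P.base_change_generated[OF T h]
  note pureP = P.base_change_pure[OF T h] and pureQ = Q.base_change_pure[OF T h]
  have sp: "s p \<in> carrier Q" using s P.gen_closed by (auto simp: linear_hom_def)
  obtain \<Phi> where \<Phi>: "\<And>t x. \<lbrakk>t \<in> carrier T; x \<in> carrier P\<rbrakk> \<Longrightarrow> \<Phi> (?pP t x) = t \<otimes>\<^bsub>T\<^esub> h (\<delta> x)"
    "bij_betw \<Phi> (carrier ?BP) ?LP" using P.base_change_evaluation[OF T h] by blast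
  obtain \<Psi> where \<Psi>: "\<And>t x. \<lbrakk>t \<in> carrier T; x \<in> carrier Q\<rbrakk> \<Longrightarrow> \<Psi> (?pQ t x) = t \<otimes>\<^bsub>T\<^esub> h (\<epsilon> x)"
    "bij_betw \<Psi> (carrier ?BQ) ?LQ" using Q.base_change_evaluation[OF T h] by blast
  have map: "?f (?pP t p) = ?pQ t (s p)" if "t \<in> carrier T" for t
    using pureP(4)[OF Q.left_module_axioms s that P.gen_closed] .
  have LP: "t \<in> carrier T" if "t \<in> ?LP" for t using that by (simp add: idempotent_left_ideal_def)
  have closed: "?f X \<in> carrier ?BQ" if X: "X \<in> carrier ?BP" for X
  proof -
    obtain t where t: "t \<in> ?LP" "X = ?pP t p" using genP[OF X] by blast
    then show ?thesis using map pureQ(3) sp LP by simp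
  qed
  have hom: "?f \<in> linear_hom T ?BP ?BQ"
    unfolding linear_hom_def
  proof (intro CollectI conjI ballI Pi_I closed)
    fix X Y assume "X \<in> carrier ?BP" "Y \<in> carrier ?BP"
    then obtain t u where "t \<in> ?LP" "X = ?pP t p" "u \<in> ?LP" "Y = ?pP u p" using genP by metis
    then show "?f (X \<oplus>\<^bsub>?BP\<^esub> Y) = ?f X \<oplus>\<^bsub>?BQ\<^esub> ?f Y"
      using pureP(1) pureQ(1) P.gen_closed sp LP by (simp add: map)
  next
    fix b X assume "b \<in> carrier T" "X \<in> carrier ?BP"
    moreover from this obtain t where "t \<in> ?LP" "X = ?pP t p" using genP by metis
    ultimately show "?f (b \<odot>\<^bsub>?BP\<^esub> X) = b \<odot>\<^bsub>?BQ\<^esub> ?f X"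
      using pureP(2) pureQ(2) P.gen_closed sp LP by (simp add: map)
  qed
  \<comment> \<open>The square with the two evaluation maps commutes; it is checked on the elements $t \<otimes> p$.\<close>
  have comm: "\<Psi> (?f X) = ?c (\<Phi> X)" if X: "X \<in> carrier ?BP" for X
  proof -
    obtain t where t: "t \<in> ?LP" "X = ?pP t p" using genP[OF X] by blast
    then have "\<Psi> (?f X) = t \<otimes>\<^bsub>T\<^esub> h (\<epsilon> (s p))" using map[of t] \<Psi>(1)[of t "s p"] sp LP by simp
    moreover have "\<Phi> X = t" using t \<Phi>(1)[of t p] P.gen_closed by (simp add: idempotent_left_ideal_def)
    ultimately show ?thesis by simp
  qed
  have "bij_betw ?f (carrier ?BP) (carrier ?BQ) \<longleftrightarrow> bij_betw (\<Psi> \<circ> ?f) (carrier ?BP) ?LQ"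
    using closed by (intro bij_betw_comp_iff2[OF \<Psi>(2)]) auto
  also have "\<dots> \<longleftrightarrow> bij_betw (?c \<circ> \<Phi>) (carrier ?BP) ?LQ"
    by (rule bij_betw_cong) (simp add: comm)
  also have "\<dots> \<longleftrightarrow> bij_betw ?c ?LP ?LQ"
    by (rule bij_betw_comp_iff[OF \<Phi>(2), symmetric])
  finally show ?thesis using hom by (simp add: linear_iso_def)
qed

section \<open>Matrix units\<close>

text \<open>
  Right multiplication by $c$ is a map $Re \<rightarrow> Rf$. If it is bijective, the preimage $v$ of $f$ is
  forced to be a two-sided inverse of $c$ between $e$ and $f$: both remaining equations hold after
  multiplication by $c$ on the right. Conversely right multiplication by $v$ is the inverse map.
\<close>

lemma (in ring) left_ideal_bij_iff:
  assumes c: "e \<in> carrier R" "f \<in> carrier R" "c \<in> carrier R"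
    and idem: "e \<otimes> e = e" "f \<otimes> f = f" and ec: "e \<otimes> c = c" and cf: "c \<otimes> f = c"
  shows "bij_betw (\<lambda>t. t \<otimes> c) (idempotent_left_ideal R e) (idempotent_left_ideal R f) \<longleftrightarrow>
    (\<exists>v\<in>carrier R. f \<otimes> v = v \<and> v \<otimes> e = v \<and> v \<otimes> c = f \<and> c \<otimes> v = e)"
proof
  assume bij: "bij_betw (\<lambda>t. t \<otimes> c) (idempotent_left_ideal R e) (idempotent_left_ideal R f)"
  have inj: "t = u" if "t \<in> carrier R" "t \<otimes> e = t" "u \<in> carrier R" "u \<otimes> e = u" "t \<otimes> c = u \<otimes> c" for t u
    using inj_onD[OF bij_betw_imp_inj_on[OF bij], of t u] that by (simp add: idempotent_left_ideal_def)
  have "f \<in> idempotent_left_ideal R f" using c idem by (simp add: idempotent_left_ideal_def)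
  then have "f \<in> (\<lambda>t. t \<otimes> c) ` idempotent_left_ideal R e" using bij_betw_imp_surj_on[OF bij] by simp
  then obtain v where v: "v \<in> carrier R" "v \<otimes> e = v" "v \<otimes> c = f"
    by (auto simp: idempotent_left_ideal_def)
  have "f \<otimes> v = v"
    by (rule inj) (use c v idem in \<open>simp_all add: m_assoc\<close>)
  moreover have "c \<otimes> v = e"
    by (rule inj) (use c v idem ec cf in \<open>simp_all add: m_assoc\<close>)
  ultimately show "\<exists>v\<in>carrier R. f \<otimes> v = v \<and> v \<otimes> e = v \<and> v \<otimes> c = f \<and> c \<otimes> v = e"
    using v by auto
next
  assume "\<exists>v\<in>carrier R. f \<otimes> v = v \<and> v \<otimes> e = v \<and> v \<otimes> c = f \<and> c \<otimes> v = e"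
  then obtain v where v: "v \<in> carrier R" "f \<otimes> v = v" "v \<otimes> e = v" "v \<otimes> c = f" "c \<otimes> v = e" by blast
  show "bij_betw (\<lambda>t. t \<otimes> c) (idempotent_left_ideal R e) (idempotent_left_ideal R f)"
    by (rule bij_betw_byWitness[where f' = "\<lambda>t. t \<otimes> v"])
      (use c v cf in \<open>auto simp: idempotent_left_ideal_def m_assoc\<close>)
qed

text \<open>
  The usual comparison of a left with a right inverse. It will identify the image of a matrix
  unit under any competing homomorphism.
\<close>

lemma (in ring) left_ideal_bij_inverse_unique:
  assumes "e \<in> carrier R" "f \<in> carrier R" "c \<in> carrier R"
    "v \<in> carrier R" "v \<otimes> e = v" "v \<otimes> c = f"
    "u \<in> carrier R" "f \<otimes> u = u" "c \<otimes> u = e"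
  shows "u = v"
proof -
  have "u = v \<otimes> c \<otimes> u" using assms by simp
  also have "\<dots> = v \<otimes> (c \<otimes> u)" using assms(3,4,7) by (simp only: m_assoc)
  finally show ?thesis using assms(5,9) by (simp only:)
qed

lemma (in ring) finsum_single:
  assumes "finite I" "i \<in> I" "f i \<in> carrier R" "\<And>j. \<lbrakk>j \<in> I; j \<noteq> i\<rbrakk> \<Longrightarrow> f j = \<zero>"
  shows "(\<Oplus>j\<in>I. f j) = f i"
proof -
  have "f \<in> I \<rightarrow> carrier R" using assms by (metis Pi_I zero_closed)
  moreover have "(\<Oplus>j\<in>I. f j) = (\<Oplus>j\<in>I. if i = j then f j else \<zero>)"
    using assms by (intro finsum_cong') auto
  ultimately show ?thesis using finsum_singleton[of i I f] assms by simp
qed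

text \<open>
  The column $v_1, \<dots>, v_n$ and the row $w_1, \<dots>, w_n$ play the parts of the matrix units in the
  last column and the last row. They exhibit $R$ as the matrix ring over the corner $eRe$, with
  $w_i t v_j$ as the $(i,j)$-entry of $t$; the products $v_i w_j$ are a full set of matrix units.
\<close>

locale matrix_units = ring R for R (structure) +
  fixes n :: nat and e and v w :: "nat \<Rightarrow> 'a"
  assumes e_closed: "e \<in> carrier R"
    and vw_closed: "i \<in> {1..n} \<Longrightarrow> v i \<in> carrier R" "i \<in> {1..n} \<Longrightarrow> w i \<in> carrier R"
    and v_corner: "i \<in> {1..n} \<Longrightarrow> v i \<otimes> e = v i"
    and wv: "\<lbrakk>i \<in> {1..n}; j \<in> {1..n}\<rbrakk> \<Longrightarrow> w i \<otimes> v j = (if i = j then e else \<zero>)"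
    and vw_sum: "(\<Oplus>i\<in>{1..n}. v i \<otimes> w i) = \<one>"
begin

text \<open>
  The source of matrix multiplication: the sum of the $v_l w_l$ is inserted between the factors.
\<close>

lemma insert_units:
  assumes t: "t \<in> carrier R" and u: "u \<in> carrier R"
  shows "t \<otimes> u = (\<Oplus>l\<in>{1..n}. (t \<otimes> v l) \<otimes> (w l \<otimes> u))"
proof -
  have "t \<otimes> u = t \<otimes> (\<Oplus>l\<in>{1..n}. v l \<otimes> w l) \<otimes> u" using t u unfolding vw_sum by simp
  also have "\<dots> = (\<Oplus>l\<in>{1..n}. t \<otimes> (v l \<otimes> w l)) \<otimes> u"
    using t vw_closed by (subst finsum_rdistr) auto
  also have "\<dots> = (\<Oplus>l\<in>{1..n}. t \<otimes> (v l \<otimes> w l) \<otimes> u)"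
    using t u vw_closed by (subst finsum_ldistr) auto
  also have "\<dots> = (\<Oplus>l\<in>{1..n}. (t \<otimes> v l) \<otimes> (w l \<otimes> u))"
    using t u vw_closed by (intro finsum_cong') (auto simp: m_assoc)
  finally show ?thesis .
qed

definition entry :: "nat \<Rightarrow> nat \<Rightarrow> 'a \<Rightarrow> 'a" where
  "entry i j t = w i \<otimes> t \<otimes> v j"

lemma entry_closed: "\<lbrakk>i \<in> {1..n}; j \<in> {1..n}; t \<in> carrier R\<rbrakk> \<Longrightarrow> entry i j t \<in> carrier R"
  using vw_closed by (simp add: entry_def)

lemma entry_eqI:
  assumes t: "t \<in> carrier R" and u: "u \<in> carrier R"
    and eq: "\<And>i j. \<lbrakk>i \<in> {1..n}; j \<in> {1..n}\<rbrakk> \<Longrightarrow> entry i j t = entry i j u"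
  shows "t = u"
proof -
  have "w i \<otimes> t = w i \<otimes> u" if i: "i \<in> {1..n}" for i
  proof -
    have "w i \<otimes> t = (w i \<otimes> t) \<otimes> \<one>" using i t vw_closed by simp
    also have "\<dots> = (\<Oplus>l\<in>{1..n}. entry i l t \<otimes> (w l \<otimes> \<one>))"
      unfolding entry_def using i t vw_closed by (intro insert_units) auto
    also have "\<dots> = (\<Oplus>l\<in>{1..n}. entry i l u \<otimes> (w l \<otimes> \<one>))"
      using i u vw_closed eq entry_closed by (intro finsum_cong') auto
    also have "\<dots> = (w i \<otimes> u) \<otimes> \<one>"
      unfolding entry_def using i u vw_closed by (intro insert_units[symmetric]) auto
    finally show ?thesis using i u vw_closed by simp
  qed
  then have "(\<Oplus>l\<in>{1..n}. (\<one> \<otimes> v l) \<otimes> (w l \<otimes> t)) = (\<Oplus>l\<in>{1..n}. (\<one> \<otimes> v l) \<otimes> (w l \<otimes> u))"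
    using u vw_closed by (intro finsum_cong') auto
  then show ?thesis using insert_units[of \<one> t] insert_units[of \<one> u] t u by simp
qed

lemma entry_mult:
  assumes "t \<in> carrier R" "u \<in> carrier R" "i \<in> {1..n}" "j \<in> {1..n}"
  shows "entry i j (t \<otimes> u) = (\<Oplus>l\<in>{1..n}. entry i l t \<otimes> entry l j u)"
proof -
  have "entry i j (t \<otimes> u) = (w i \<otimes> t) \<otimes> (u \<otimes> v j)"
    using assms vw_closed by (simp add: entry_def m_assoc)
  also have "\<dots> = (\<Oplus>l\<in>{1..n}. (w i \<otimes> t \<otimes> v l) \<otimes> (w l \<otimes> (u \<otimes> v j)))"
    using assms vw_closed by (intro insert_units) auto
  finally show ?thesis using assms vw_closed by (simp add: entry_def m_assoc cong: finsum_cong)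
qed

lemma entry_add:
  "\<lbrakk>t \<in> carrier R; u \<in> carrier R; i \<in> {1..n}; j \<in> {1..n}\<rbrakk> \<Longrightarrow>
    entry i j (t \<oplus> u) = entry i j t \<oplus> entry i j u"
  using vw_closed by (simp add: entry_def l_distr r_distr)

lemma entry_one: "\<lbrakk>i \<in> {1..n}; j \<in> {1..n}\<rbrakk> \<Longrightarrow> entry i j \<one> = (if i = j then e else \<zero>)"
  using vw_closed wv by (simp add: entry_def)

definition assemble :: "(nat \<Rightarrow> nat \<Rightarrow> 'a) \<Rightarrow> 'a" where
  "assemble b = (\<Oplus>i\<in>{1..n}. v i \<otimes> (\<Oplus>j\<in>{1..n}. b i j \<otimes> w j))"

lemma assemble_closed:
  "(\<And>i j. \<lbrakk>i \<in> {1..n}; j \<in> {1..n}\<rbrakk> \<Longrightarrow> b i j \<in> carrier R) \<Longrightarrow> assemble b \<in> carrier R"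
  using vw_closed by (auto simp: assemble_def intro!: finsum_closed)

lemma entry_assemble:
  assumes b: "\<And>i j. \<lbrakk>i \<in> {1..n}; j \<in> {1..n}\<rbrakk> \<Longrightarrow> b i j \<in> carrier R"
    "\<And>i j. \<lbrakk>i \<in> {1..n}; j \<in> {1..n}\<rbrakk> \<Longrightarrow> e \<otimes> b i j = b i j"
    "\<And>i j. \<lbrakk>i \<in> {1..n}; j \<in> {1..n}\<rbrakk> \<Longrightarrow> b i j \<otimes> e = b i j"
    and ij: "i \<in> {1..n}" "j \<in> {1..n}"
  shows "entry i j (assemble b) = b i j"
proof -
  let ?r = "\<lambda>i. \<Oplus>j\<in>{1..n}. b i j \<otimes> w j"
  have rc: "?r i \<in> carrier R" if "i \<in> {1..n}" for i
    using that b vw_closed by (intro finsum_closed) auto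
  have "w i \<otimes> assemble b = (\<Oplus>l\<in>{1..n}. w i \<otimes> (v l \<otimes> ?r l))"
    unfolding assemble_def using ij rc vw_closed by (subst finsum_rdistr) auto
  also have "\<dots> = (\<Oplus>l\<in>{1..n}. (w i \<otimes> v l) \<otimes> ?r l)"
    using ij rc vw_closed by (intro finsum_cong') (auto simp: m_assoc)
  also have "\<dots> = e \<otimes> ?r i"
    using ij rc wv e_closed finsum_single[of "{1..n}" i "\<lambda>l. (w i \<otimes> v l) \<otimes> ?r l"] by simp
  also have "\<dots> = (\<Oplus>j\<in>{1..n}. e \<otimes> (b i j \<otimes> w j))"
    using ij b vw_closed e_closed by (subst finsum_rdistr) auto
  also have "\<dots> = ?r i"
    using ij b vw_closed e_closed by (intro finsum_cong') (auto simp: m_assoc[symmetric])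
  finally have "entry i j (assemble b) = ?r i \<otimes> v j" by (simp add: entry_def)
  also have "\<dots> = (\<Oplus>l\<in>{1..n}. b i l \<otimes> w l \<otimes> v j)"
    using ij b vw_closed by (subst finsum_ldistr) auto
  also have "\<dots> = (\<Oplus>l\<in>{1..n}. b i l \<otimes> (w l \<otimes> v j))"
    using ij b vw_closed by (intro finsum_cong') (auto simp: m_assoc)
  also have "\<dots> = b i j"
    using ij b vw_closed wv finsum_single[of "{1..n}" j "\<lambda>l. b i l \<otimes> (w l \<otimes> v j)"] by simp
  finally show ?thesis .
qed

end

section \<open>Elementary triangular matrices\<close>

locale triangular = k: ring k + S: ring S for k :: "'k ring" and S :: "'s ring" +
  fixes \<phi> :: "'k \<Rightarrow> 's" and n :: nat
  assumes \<phi>_hom: "\<phi> \<in> ring_hom k S"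
begin

abbreviation "A \<equiv> triangular_ring n k S \<phi>"
abbreviation "P \<equiv> column_module n k S \<phi>"
abbreviation "E \<equiv> triangular_entry S \<phi>"
abbreviation "C \<equiv> column_entry S \<phi>"

lemmas base = k.ring_axioms S.ring_axioms \<phi>_hom

sublocale A: ring A
  by (rule ring_triangular_ring[OF base])

lemma phi [simp]: "x \<in> carrier k \<Longrightarrow> \<phi> x \<in> carrier S" "\<phi> \<one>\<^bsub>k\<^esub> = \<one>\<^bsub>S\<^esub>" "\<phi> \<zero>\<^bsub>k\<^esub> = \<zero>\<^bsub>S\<^esub>"
  using \<phi>_hom ring_hom_zero[OF \<phi>_hom k.ring_axioms S.ring_axioms] by (auto simp: ring_hom_def)

lemmas A_ext = triangular_ext[where n = n, OF base]
lemmas A_fst = triangular_fst[where n = n, OF base]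
lemmas A_entry = triangular_entry_simps[where n = n, OF base]
lemmas A_el = triangular_el[where n = n, OF base]

definition column_embed :: "nat \<Rightarrow> 'k \<times> (nat \<Rightarrow> 's) \<Rightarrow> (nat \<Rightarrow> 'k) \<times> (nat \<times> nat \<Rightarrow> 's)" where
  "column_embed i c = (\<lambda>l\<in>{1..n}. if l = i then fst c else \<zero>\<^bsub>k\<^esub>,
     restrict (\<lambda>(r, l). if l = i then snd c r else \<zero>\<^bsub>S\<^esub>) (below_diagonal n))"

definition column_gen :: "nat \<Rightarrow> 'k \<times> (nat \<Rightarrow> 's)" where
  "column_gen i = (\<one>\<^bsub>k\<^esub>, \<lambda>r\<in>{i<..n}. \<zero>\<^bsub>S\<^esub>)"

lemma column_embed_closed: "x \<in> carrier (P i) \<Longrightarrow> column_embed i x \<in> carrier A"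
  by (auto simp: column_embed_def column_module_def triangular_ring_def below_diagonal_def PiE_iff)

lemma column_embed_fst: "l \<in> {1..n} \<Longrightarrow> fst (column_embed i x) l = (if l = i then fst x else \<zero>\<^bsub>k\<^esub>)"
  by (simp add: column_embed_def)

lemma column_embed_entry:
  "\<lbrakk>r \<in> {1..n}; l \<in> {1..n}\<rbrakk> \<Longrightarrow> E (column_embed i x) (r, l) = (if l = i then C i x r else \<zero>\<^bsub>S\<^esub>)"
  by (auto simp: column_embed_def triangular_entry_def column_entry_def below_diagonal_def)

lemma column_gen_closed: "column_gen i \<in> carrier (P i)"
  by (auto simp: column_gen_def column_module_def)

lemma column_gen_entry: "r \<in> {1..n} \<Longrightarrow> C i (column_gen i) r = (if r = i then \<one>\<^bsub>S\<^esub> else \<zero>\<^bsub>S\<^esub>)"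
  by (auto simp: column_gen_def column_entry_def)

text \<open>
  The column $P_i$ is $Ae_i$, embedded as the matrices that vanish outside column $i$.
\<close>

lemma column_principal_projective:
  assumes i: "i \<in> {1..n}"
  shows "principal_projective A (P i) (column_gen i) (column_embed i)"
proof -
  interpret P: left_module A "P i"
    by (rule left_module_column_module[where n = n, OF base i])
  note col = column_fst[where n = n, OF base] column_entry_simps[where n = n, OF base i] column_el[where n = n, OF base]
  note simps = column_embed_closed column_embed_fst column_embed_entry A_fst A_entry A_el col column_gen_closed column_gen_entry
    P.smult_closed
  show ?thesis
  proof
    show "column_embed i \<in> linear_hom A (P i) (left_restrict id A)"
      unfolding linear_hom_def left_restrict_def
    proof (intro CollectI conjI ballI Pi_I; simp)
      fix x y assume "x \<in> carrier (P i)" "y \<in> carrier (P i)"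
      then show "column_embed i (x \<oplus>\<^bsub>P i\<^esub> y) = column_embed i x \<oplus>\<^bsub>A\<^esub> column_embed i y"
        by (intro A_ext) (simp_all add: simps)
    next
      fix a x assume "a \<in> carrier A" "x \<in> carrier (P i)"
      then show "column_embed i (a \<odot>\<^bsub>P i\<^esub> x) = a \<otimes>\<^bsub>A\<^esub> column_embed i x"
        by (intro A_ext) (simp_all add: simps S.finsum_zero Pi_iff cong: S.finsum_cong)
    qed (rule column_embed_closed)
    fix x assume x: "x \<in> carrier (P i)"
    show "column_embed i x \<odot>\<^bsub>P i\<^esub> column_gen i = x"
    proof (rule column_ext[where n = n, OF base _ _ _ i])
      show "fst (column_embed i x \<odot>\<^bsub>P i\<^esub> column_gen i) = fst x"
        using x i by (simp add: simps) (simp add: column_gen_def col)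
      fix r assume r: "r \<in> {1..n}"
      show "C i (column_embed i x \<odot>\<^bsub>P i\<^esub> column_gen i) r = C i x r"
        using x i r S.finsum_single[of "{1..n}" i "\<lambda>l. E (column_embed i x) (r, l) \<otimes>\<^bsub>S\<^esub> C i (column_gen i) l"]
        by (simp add: simps)
    qed (use x in \<open>simp_all add: simps\<close>)
  qed (rule column_gen_closed)
qed

text \<open>
  The next three kinds of elements of \<open>A\<close> are all obtained from columns, so that their entries
  can be read off from \<open>column_embed_entry\<close>. The last one is the image of the generator of $P_n$
  under $s_i$, hence the element by which $s_i$ acts from the right: it has a single entry, equal to
  one, in position $(n,i)$.
\<close>

definition elementary :: "nat \<Rightarrow> nat \<Rightarrow> 's \<Rightarrow> (nat \<Rightarrow> 'k) \<times> (nat \<times> nat \<Rightarrow> 's)" where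
  "elementary i j s = column_embed j (\<zero>\<^bsub>k\<^esub>, \<lambda>r\<in>{j<..n}. if r = i then s else \<zero>\<^bsub>S\<^esub>)"

definition diagonal_idem :: "nat \<Rightarrow> (nat \<Rightarrow> 'k) \<times> (nat \<times> nat \<Rightarrow> 's)" where
  "diagonal_idem i = column_embed i (column_gen i)"

definition last_row_unit :: "nat \<Rightarrow> (nat \<Rightarrow> 'k) \<times> (nat \<times> nat \<Rightarrow> 's)" where
  "last_row_unit i = column_embed i (column_map n k S \<phi> i (column_gen n))"

lemma elementary:
  assumes "s \<in> carrier S" "j < i"
  shows "elementary i j s \<in> carrier A"
    and "l \<in> {1..n} \<Longrightarrow> fst (elementary i j s) l = \<zero>\<^bsub>k\<^esub>"
    and "\<lbrakk>r \<in> {1..n}; l \<in> {1..n}\<rbrakk> \<Longrightarrow>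
      E (elementary i j s) (r, l) = (if l = j then if r = i then s else \<zero>\<^bsub>S\<^esub> else \<zero>\<^bsub>S\<^esub>)"
  unfolding elementary_def using assms
  by (auto intro!: column_embed_closed simp: column_embed_fst column_embed_entry column_module_def column_entry_def)

lemma diagonal_idem:
  shows "diagonal_idem i \<in> carrier A"
    and "l \<in> {1..n} \<Longrightarrow> fst (diagonal_idem i) l = (if l = i then \<one>\<^bsub>k\<^esub> else \<zero>\<^bsub>k\<^esub>)"
    and "\<lbrakk>r \<in> {1..n}; l \<in> {1..n}\<rbrakk> \<Longrightarrow>
      E (diagonal_idem i) (r, l) = (if l = i then if r = i then \<one>\<^bsub>S\<^esub> else \<zero>\<^bsub>S\<^esub> else \<zero>\<^bsub>S\<^esub>)"
  by (simp_all add: diagonal_idem_def column_embed_closed column_embed_fst column_embed_entry column_gen_closed column_gen_entry)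
    (simp add: column_gen_def)

lemma last_row_unit:
  assumes "i \<in> {1..n}"
  shows "last_row_unit i \<in> carrier A"
    and "l \<in> {1..n} \<Longrightarrow> fst (last_row_unit i) l = (if i = n \<and> l = n then \<one>\<^bsub>k\<^esub> else \<zero>\<^bsub>k\<^esub>)"
    and "\<lbrakk>r \<in> {1..n}; l \<in> {1..n}\<rbrakk> \<Longrightarrow>
      E (last_row_unit i) (r, l) = (if l = i then if r = n then \<one>\<^bsub>S\<^esub> else \<zero>\<^bsub>S\<^esub> else \<zero>\<^bsub>S\<^esub>)"
  using assms unfolding last_row_unit_def
  by (auto intro!: column_embed_closed simp: column_embed_fst column_embed_entry column_module_def column_entry_def
    column_map_def column_gen_def restrict_def)

lemma last_row_unit_last: "1 \<le> n \<Longrightarrow> last_row_unit n = diagonal_idem n"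
  by (simp add: last_row_unit_def diagonal_idem_def column_map_def)

lemma last_row_unit_elementary: "i < n \<Longrightarrow> last_row_unit i = elementary n i \<one>\<^bsub>S\<^esub>"
  by (simp add: last_row_unit_def elementary_def column_map_def column_gen_def cong: if_cong)

text \<open>
  Multiplication by a matrix with a single nonzero entry. The nested conditionals, with the column
  tested first, match the entry rules of the elementary matrices.
\<close>

lemma row_single:
  assumes "j \<in> {1..n}" "s \<in> carrier S" "\<And>l. l \<in> {1..n} \<Longrightarrow> y l \<in> carrier S"
    "\<And>l. l \<in> {1..n} \<Longrightarrow> x l = (if l = j then if r = i then s else \<zero>\<^bsub>S\<^esub> else \<zero>\<^bsub>S\<^esub>)"
  shows "(\<Oplus>\<^bsub>S\<^esub>l\<in>{1..n}. x l \<otimes>\<^bsub>S\<^esub> y l) = (if r = i then s \<otimes>\<^bsub>S\<^esub> y j else \<zero>\<^bsub>S\<^esub>)"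
  using assms by (subst S.finsum_single[of _ j]) auto

lemma column_single:
  assumes "i \<in> {1..n}" "s \<in> carrier S" "\<And>l. l \<in> {1..n} \<Longrightarrow> y l \<in> carrier S"
    "\<And>l. l \<in> {1..n} \<Longrightarrow> x l = (if m = j then if l = i then s else \<zero>\<^bsub>S\<^esub> else \<zero>\<^bsub>S\<^esub>)"
  shows "(\<Oplus>\<^bsub>S\<^esub>l\<in>{1..n}. y l \<otimes>\<^bsub>S\<^esub> x l) = (if m = j then y i \<otimes>\<^bsub>S\<^esub> s else \<zero>\<^bsub>S\<^esub>)"
  using assms by (subst S.finsum_single[of _ i]) auto

lemma entry_products:
  assumes a: "a \<in> carrier A" and rm: "r \<in> {1..n}" "m \<in> {1..n}"
  shows "\<lbrakk>i \<in> {1..n}; j \<in> {1..n}; j < i; s \<in> carrier S\<rbrakk> \<Longrightarrow>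
      E (elementary i j s \<otimes>\<^bsub>A\<^esub> a) (r, m) = (if r = i then s \<otimes>\<^bsub>S\<^esub> E a (j, m) else \<zero>\<^bsub>S\<^esub>)"
    and "i \<in> {1..n} \<Longrightarrow> E (diagonal_idem i \<otimes>\<^bsub>A\<^esub> a) (r, m) = (if r = i then E a (i, m) else \<zero>\<^bsub>S\<^esub>)"
    and "i \<in> {1..n} \<Longrightarrow> E (last_row_unit i \<otimes>\<^bsub>A\<^esub> a) (r, m) = (if r = n then E a (i, m) else \<zero>\<^bsub>S\<^esub>)"
    and "i \<in> {1..n} \<Longrightarrow> E (a \<otimes>\<^bsub>A\<^esub> diagonal_idem i) (r, m) = (if m = i then E a (r, i) else \<zero>\<^bsub>S\<^esub>)"
    and "i \<in> {1..n} \<Longrightarrow> E (a \<otimes>\<^bsub>A\<^esub> last_row_unit i) (r, m) = (if m = i then E a (r, n) else \<zero>\<^bsub>S\<^esub>)"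
proof -
  have el: "E a (r, l) \<in> carrier S" "E a (l, m) \<in> carrier S" if "l \<in> {1..n}" for l
    using A_el(2)[OF a] that rm by auto
  show "E (elementary i j s \<otimes>\<^bsub>A\<^esub> a) (r, m) = (if r = i then s \<otimes>\<^bsub>S\<^esub> E a (j, m) else \<zero>\<^bsub>S\<^esub>)"
    if "i \<in> {1..n}" "j \<in> {1..n}" "j < i" "s \<in> carrier S"
    using that by (subst A_entry(1)[OF rm _ a]; intro row_single el elementary rm)
  assume i: "i \<in> {1..n}"
  have n: "n \<in> {1..n}" using i by auto
  show "E (diagonal_idem i \<otimes>\<^bsub>A\<^esub> a) (r, m) = (if r = i then E a (i, m) else \<zero>\<^bsub>S\<^esub>)"
    using row_single[OF i S.one_closed el(2) diagonal_idem(3)[OF rm(1)]] el(2)[OF i]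
    by (simp add: A_entry(1)[OF rm] a diagonal_idem)
  show "E (last_row_unit i \<otimes>\<^bsub>A\<^esub> a) (r, m) = (if r = n then E a (i, m) else \<zero>\<^bsub>S\<^esub>)"
    using row_single[OF i S.one_closed el(2) last_row_unit(3)[OF i rm(1)]] el(2)[OF i]
    by (simp add: A_entry(1)[OF rm] a last_row_unit[OF i])
  show "E (a \<otimes>\<^bsub>A\<^esub> diagonal_idem i) (r, m) = (if m = i then E a (r, i) else \<zero>\<^bsub>S\<^esub>)"
    using column_single[OF i S.one_closed el(1) diagonal_idem(3)[OF _ rm(2)]] el(1)[OF i]
    by (simp add: A_entry(1)[OF rm] a diagonal_idem)
  show "E (a \<otimes>\<^bsub>A\<^esub> last_row_unit i) (r, m) = (if m = i then E a (r, n) else \<zero>\<^bsub>S\<^esub>)"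
    using column_single[OF n S.one_closed el(1) last_row_unit(3)[OF i _ rm(2)]] el(1)[OF n]
    by (simp add: A_entry(1)[OF rm] a last_row_unit[OF i])
qed

lemma entry_above: "i < j \<Longrightarrow> E a (i, j) = \<zero>\<^bsub>S\<^esub>"
  by (simp add: triangular_entry_def)

lemma elementary_add:
  "\<lbrakk>j < i; s \<in> carrier S; t \<in> carrier S\<rbrakk> \<Longrightarrow>
    elementary i j (s \<oplus>\<^bsub>S\<^esub> t) = elementary i j s \<oplus>\<^bsub>A\<^esub> elementary i j t"
  by (rule A_ext) (simp_all add: elementary A_fst A_entry)

lemma elementary_zero: "j < i \<Longrightarrow> elementary i j \<zero>\<^bsub>S\<^esub> = \<zero>\<^bsub>A\<^esub>"
  by (rule A_ext) (simp_all add: elementary A_fst A_entry)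

lemma elementary_mult:
  "\<lbrakk>1 \<le> j; j < l; l < i; i \<le> n; s \<in> carrier S; t \<in> carrier S\<rbrakk> \<Longrightarrow>
    elementary i l s \<otimes>\<^bsub>A\<^esub> elementary l j t = elementary i j (s \<otimes>\<^bsub>S\<^esub> t)"
  by (rule A_ext) (simp_all add: elementary A_fst entry_products)

lemma last_row_unit_elementary_mult:
  "\<lbrakk>1 \<le> j; j < l; l \<le> n; t \<in> carrier S\<rbrakk> \<Longrightarrow>
    last_row_unit l \<otimes>\<^bsub>A\<^esub> elementary l j t = elementary n j t"
  by (rule A_ext) (simp_all add: elementary A_fst entry_products last_row_unit)

lemma diagonal_idem_mult:
  "\<lbrakk>i \<in> {1..n}; j \<in> {1..n}\<rbrakk> \<Longrightarrow>
    diagonal_idem i \<otimes>\<^bsub>A\<^esub> diagonal_idem j = (if i = j then diagonal_idem i else \<zero>\<^bsub>A\<^esub>)"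
  by (rule A_ext) (auto simp: diagonal_idem A_fst A_entry(4) entry_products)

lemma last_row_unit_idem:
  assumes "i \<in> {1..n}"
  shows "diagonal_idem n \<otimes>\<^bsub>A\<^esub> last_row_unit i = last_row_unit i"
    "last_row_unit i \<otimes>\<^bsub>A\<^esub> diagonal_idem i = last_row_unit i"
  by (rule A_ext; use assms in \<open>auto simp: diagonal_idem A_fst last_row_unit entry_products\<close>)+

text \<open>
  The next three rules move the $(i,j)$-entry of $a$ to the last row, or from $(n,n)$ to $(n,1)$.
  This is how an entry of $k$ on the diagonal turns into an entry of $S$.
\<close>

lemma compress_left:
  "\<lbrakk>a \<in> carrier A; i \<in> {1..n}; 1 \<le> j; j < n\<rbrakk> \<Longrightarrow>
    last_row_unit i \<otimes>\<^bsub>A\<^esub> a \<otimes>\<^bsub>A\<^esub> diagonal_idem j = elementary n j (E a (i, j))"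
  by (rule A_ext) (auto simp: diagonal_idem A_fst A_el last_row_unit entry_products elementary)

lemma compress_zero:
  "\<lbrakk>a \<in> carrier A; i \<in> {1..n}; i < n\<rbrakk> \<Longrightarrow>
    last_row_unit i \<otimes>\<^bsub>A\<^esub> a \<otimes>\<^bsub>A\<^esub> diagonal_idem n = \<zero>\<^bsub>A\<^esub>"
  by (rule A_ext) (auto simp: diagonal_idem A_fst A_entry(4) A_el last_row_unit entry_products entry_above)

lemma compress_last:
  "\<lbrakk>a \<in> carrier A; 1 < n\<rbrakk> \<Longrightarrow>
    diagonal_idem n \<otimes>\<^bsub>A\<^esub> a \<otimes>\<^bsub>A\<^esub> last_row_unit 1 = elementary n 1 (E a (n, n))"
  by (rule A_ext) (auto simp: diagonal_idem A_fst A_el last_row_unit entry_products elementary)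

text \<open>
  The partial sums are diagonal matrices with an initial run of ones, which allows an induction.
\<close>

lemma diagonal_idem_sum: "(\<Oplus>\<^bsub>A\<^esub>i\<in>{1..n}. diagonal_idem i) = \<one>\<^bsub>A\<^esub>"
proof -
  \<comment> \<open>Both components are needed: $\<phi>$ may fail to be injective, so the images in $S$ do not
    determine the diagonal.\<close>
  have "fst (\<Oplus>\<^bsub>A\<^esub>i\<in>{1..m}. diagonal_idem i) l = (if l \<le> m then \<one>\<^bsub>k\<^esub> else \<zero>\<^bsub>k\<^esub>) \<and>
      E (\<Oplus>\<^bsub>A\<^esub>i\<in>{1..m}. diagonal_idem i) (r, l) = (if r = l \<and> l \<le> m then \<one>\<^bsub>S\<^esub> else \<zero>\<^bsub>S\<^esub>)"
    if "r \<in> {1..n}" "l \<in> {1..n}" "m \<le> n" for m r l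
    using that(3)
  proof (induction m)
    case 0
    then show ?case using that by (auto simp: A_fst A_entry)
  next
    case (Suc m)
    have "(\<Oplus>\<^bsub>A\<^esub>i\<in>{1..Suc m}. diagonal_idem i) =
        diagonal_idem (Suc m) \<oplus>\<^bsub>A\<^esub> (\<Oplus>\<^bsub>A\<^esub>i\<in>{1..m}. diagonal_idem i)"
      by (simp add: atLeastAtMostSuc_conv A.finsum_insert diagonal_idem Pi_iff)
    then show ?case using Suc that A.finsum_closed[of diagonal_idem "{1..m}"]
      by (auto simp: A_fst A_entry diagonal_idem Pi_iff)
  qed
  then show ?thesis
    by (intro A_ext) (auto simp: A_fst A_entry diagonal_idem Pi_iff)
qed

lemma elementary_idem:
  assumes "1 \<le> j" "j < i" "i \<le> n" "s \<in> carrier S"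
  shows "diagonal_idem i \<otimes>\<^bsub>A\<^esub> elementary i j s = elementary i j s"
    "elementary i j s \<otimes>\<^bsub>A\<^esub> diagonal_idem j = elementary i j s"
  by (rule A_ext; use assms in \<open>auto simp: diagonal_idem A_fst elementary entry_products\<close>)+

section \<open>The full matrix ring\<close>

abbreviation "M \<equiv> matrix_ring n S"
abbreviation "\<iota> \<equiv> triangular_to_matrix n S \<phi>"

sublocale M: ring M
  by (rule ring_matrix_ring[OF S.ring_axioms])

definition matrix_unit :: "nat \<Rightarrow> nat \<Rightarrow> 's \<Rightarrow> nat \<times> nat \<Rightarrow> 's" where
  "matrix_unit i j s =
     restrict (\<lambda>(r, l). if l = j then if r = i then s else \<zero>\<^bsub>S\<^esub> else \<zero>\<^bsub>S\<^esub>) ({1..n} \<times> {1..n})"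

lemma matrix_unit:
  shows "s \<in> carrier S \<Longrightarrow> matrix_unit i j s \<in> carrier M"
    and "\<lbrakk>r \<in> {1..n}; l \<in> {1..n}\<rbrakk> \<Longrightarrow>
      matrix_unit i j s (r, l) = (if l = j then if r = i then s else \<zero>\<^bsub>S\<^esub> else \<zero>\<^bsub>S\<^esub>)"
  by (auto simp: matrix_unit_def matrix_ring_def)

lemma matrix_el: "\<lbrakk>m \<in> carrier M; i \<in> {1..n}; j \<in> {1..n}\<rbrakk> \<Longrightarrow> m (i, j) \<in> carrier S"
  by (auto simp: matrix_ring_def)

lemma matrix_entry:
  assumes "i \<in> {1..n}" "j \<in> {1..n}"
  shows "(x \<otimes>\<^bsub>M\<^esub> y) (i, j) = (\<Oplus>\<^bsub>S\<^esub>l\<in>{1..n}. x (i, l) \<otimes>\<^bsub>S\<^esub> y (l, j))"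
    "(x \<oplus>\<^bsub>M\<^esub> y) (i, j) = x (i, j) \<oplus>\<^bsub>S\<^esub> y (i, j)"
    "\<one>\<^bsub>M\<^esub> (i, j) = (if i = j then \<one>\<^bsub>S\<^esub> else \<zero>\<^bsub>S\<^esub>)"
  using assms by (auto simp: matrix_ring_def)

lemma matrix_ext:
  assumes "x \<in> carrier M" "y \<in> carrier M"
    "\<And>i j. \<lbrakk>i \<in> {1..n}; j \<in> {1..n}\<rbrakk> \<Longrightarrow> x (i, j) = y (i, j)"
  shows "x = y"
  by (rule PiE_ext[of _ "{1..n} \<times> {1..n}" "\<lambda>_. carrier S"])
    (use assms in \<open>auto simp: matrix_ring_def\<close>)

lemma matrix_unit_mult:
  assumes x: "x \<in> carrier M" and s: "s \<in> carrier S" and ij: "i \<in> {1..n}" "j \<in> {1..n}"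
    and rl: "r \<in> {1..n}" "l \<in> {1..n}"
  shows "(matrix_unit i j s \<otimes>\<^bsub>M\<^esub> x) (r, l) = (if r = i then s \<otimes>\<^bsub>S\<^esub> x (j, l) else \<zero>\<^bsub>S\<^esub>)"
    and "(x \<otimes>\<^bsub>M\<^esub> matrix_unit i j s) (r, l) = (if l = j then x (r, i) \<otimes>\<^bsub>S\<^esub> s else \<zero>\<^bsub>S\<^esub>)"
proof -
  show "(matrix_unit i j s \<otimes>\<^bsub>M\<^esub> x) (r, l) = (if r = i then s \<otimes>\<^bsub>S\<^esub> x (j, l) else \<zero>\<^bsub>S\<^esub>)"
    unfolding matrix_entry(1)[OF rl] by (intro row_single ij s matrix_el[OF x] matrix_unit rl)
  show "(x \<otimes>\<^bsub>M\<^esub> matrix_unit i j s) (r, l) = (if l = j then x (r, i) \<otimes>\<^bsub>S\<^esub> s else \<zero>\<^bsub>S\<^esub>)"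
    unfolding matrix_entry(1)[OF rl] by (intro column_single ij s matrix_el[OF x] matrix_unit rl)
qed

lemma matrix_unit_matrix_unit:
  "\<lbrakk>i \<in> {1..n}; j \<in> {1..n}; l \<in> {1..n}; s \<in> carrier S; t \<in> carrier S\<rbrakk> \<Longrightarrow>
    matrix_unit i j s \<otimes>\<^bsub>M\<^esub> matrix_unit j l t = matrix_unit i l (s \<otimes>\<^bsub>S\<^esub> t)"
  by (rule matrix_ext) (auto simp: matrix_unit matrix_unit_mult)

lemma matrix_unit_compress:
  assumes "m \<in> carrier M" "i \<in> {1..n}" "j \<in> {1..n}" "p \<in> {1..n}" "q \<in> {1..n}"
  shows "matrix_unit p i \<one>\<^bsub>S\<^esub> \<otimes>\<^bsub>M\<^esub> m \<otimes>\<^bsub>M\<^esub> matrix_unit j q \<one>\<^bsub>S\<^esub> = matrix_unit p q (m (i, j))"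
  by (rule matrix_ext) (use assms in \<open>auto simp: matrix_unit matrix_unit_mult matrix_el\<close>)

lemma to_matrix_hom: "\<iota> \<in> ring_hom A M"
  by (rule triangular_to_matrix_hom[OF base])

lemma to_matrix_entry: "\<lbrakk>i \<in> {1..n}; j \<in> {1..n}\<rbrakk> \<Longrightarrow> \<iota> a (i, j) = E a (i, j)"
  by (simp add: triangular_to_matrix_def)

lemma to_matrix_unit:
  shows "\<lbrakk>j < i; s \<in> carrier S\<rbrakk> \<Longrightarrow> \<iota> (elementary i j s) = matrix_unit i j s"
    and "\<iota> (diagonal_idem i) = matrix_unit i i \<one>\<^bsub>S\<^esub>"
    and "i \<in> {1..n} \<Longrightarrow> \<iota> (last_row_unit i) = matrix_unit n i \<one>\<^bsub>S\<^esub>"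
  by (rule matrix_ext; auto simp: ring_hom_closed[OF to_matrix_hom] matrix_unit to_matrix_entry
    elementary diagonal_idem last_row_unit)+

section \<open>Inverting the column maps\<close>

text \<open>
  Being \<open>\<sigma>\<close>-inverting is the solvability of equations in \<open>T\<close>: each $h(c_i)$, with $c_i$ the
  element in position $(n,i)$, must have an inverse $v$ that behaves like a matrix unit in
  position $(i,n)$.
\<close>

lemma inverting_iff:
  assumes T: "ring T" and h: "h \<in> ring_hom A T"
  shows "inverting A (column_maps n k S \<phi>) T h \<longleftrightarrow>
    (\<forall>i\<in>{1..n}. \<exists>v\<in>carrier T.
       h (diagonal_idem i) \<otimes>\<^bsub>T\<^esub> v = v \<and> v \<otimes>\<^bsub>T\<^esub> h (diagonal_idem n) = v \<and>
       v \<otimes>\<^bsub>T\<^esub> h (last_row_unit i) = h (diagonal_idem i) \<and>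
       h (last_row_unit i) \<otimes>\<^bsub>T\<^esub> v = h (diagonal_idem n))"
proof -
  interpret T: ring T by (rule T)
  have hc: "h a \<in> carrier T" if "a \<in> carrier A" for a using h that by (rule ring_hom_closed)
  have hm: "h a \<otimes>\<^bsub>T\<^esub> h b = h (a \<otimes>\<^bsub>A\<^esub> b)" if "a \<in> carrier A" "b \<in> carrier A" for a b
    using ring_hom_mult[OF h that] by simp
  have "base_change_map A T h (P i) (column_map n k S \<phi> i)
        \<in> linear_iso T (base_change A T h (P n)) (base_change A T h (P i)) \<longleftrightarrow>
      (\<exists>v\<in>carrier T.
       h (diagonal_idem i) \<otimes>\<^bsub>T\<^esub> v = v \<and> v \<otimes>\<^bsub>T\<^esub> h (diagonal_idem n) = v \<and>
       v \<otimes>\<^bsub>T\<^esub> h (last_row_unit i) = h (diagonal_idem i) \<and>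
       h (last_row_unit i) \<otimes>\<^bsub>T\<^esub> v = h (diagonal_idem n))" if i: "i \<in> {1..n}" for i
  proof -
    have n: "n \<in> {1..n}" using i by auto
    have "base_change_map A T h (P i) (column_map n k S \<phi> i)
        \<in> linear_iso T (base_change A T h (P n)) (base_change A T h (P i)) \<longleftrightarrow>
      bij_betw (\<lambda>t. t \<otimes>\<^bsub>T\<^esub> h (last_row_unit i))
        (idempotent_left_ideal T (h (diagonal_idem n))) (idempotent_left_ideal T (h (diagonal_idem i)))"
      unfolding last_row_unit_def diagonal_idem_def
      by (rule base_change_map_iso_iff[OF column_principal_projective[OF n]
            column_principal_projective[OF i] T h column_map_linear[OF base i]])
    also have "\<dots> \<longleftrightarrow> (\<exists>v\<in>carrier T.
       h (diagonal_idem i) \<otimes>\<^bsub>T\<^esub> v = v \<and> v \<otimes>\<^bsub>T\<^esub> h (diagonal_idem n) = v \<and>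
       v \<otimes>\<^bsub>T\<^esub> h (last_row_unit i) = h (diagonal_idem i) \<and>
       h (last_row_unit i) \<otimes>\<^bsub>T\<^esub> v = h (diagonal_idem n))"
      by (rule T.left_ideal_bij_iff)
        (use i n in \<open>simp_all add: hc hm diagonal_idem(1) last_row_unit(1) diagonal_idem_mult last_row_unit_idem\<close>)
    finally show ?thesis .
  qed
  moreover have "inverting A (column_maps n k S \<phi>) T h \<longleftrightarrow>
      (\<forall>i\<in>{1..n}. base_change_map A T h (P i) (column_map n k S \<phi> i)
        \<in> linear_iso T (base_change A T h (P n)) (base_change A T h (P i)))"
    unfolding inverting_def column_maps_def using T h A.ring_axioms by blast
  ultimately show ?thesis by simp
qed

lemma inverting_to_matrix: "inverting A (column_maps n k S \<phi>) M \<iota>"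
  unfolding inverting_iff[OF M.ring_axioms to_matrix_hom]
proof
  fix i assume i: "i \<in> {1..n}"
  then have n: "n \<in> {1..n}" by auto
  show "\<exists>v\<in>carrier M. \<iota> (diagonal_idem i) \<otimes>\<^bsub>M\<^esub> v = v \<and> v \<otimes>\<^bsub>M\<^esub> \<iota> (diagonal_idem n) = v \<and>
       v \<otimes>\<^bsub>M\<^esub> \<iota> (last_row_unit i) = \<iota> (diagonal_idem i) \<and>
       \<iota> (last_row_unit i) \<otimes>\<^bsub>M\<^esub> v = \<iota> (diagonal_idem n)"
    by (rule bexI[of _ "matrix_unit i n \<one>\<^bsub>S\<^esub>"])
      (simp_all only: to_matrix_unit(2) to_matrix_unit(3)[OF i] matrix_unit_matrix_unit i n
        S.one_closed S.l_one matrix_unit(1) simp_thms)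
qed

end

section \<open>Lifting an inverting homomorphism to the matrix ring\<close>

text \<open>
  A \<open>\<sigma>\<close>-inverting homomorphism together with a choice of the inverses $v_i$ of the $h(c_i)$.
\<close>

locale inverted_triangular = triangular k S \<phi> n + T: ring T
  for k :: "'k ring" and S :: "'s ring" and \<phi> :: "'k \<Rightarrow> 's" and n :: nat and T :: "'t ring" +
  fixes h :: "(nat \<Rightarrow> 'k) \<times> (nat \<times> nat \<Rightarrow> 's) \<Rightarrow> 't" and v :: "nat \<Rightarrow> 't"
  assumes n: "n \<ge> 3" and h: "h \<in> ring_hom A T"
    and v_closed: "i \<in> {1..n} \<Longrightarrow> v i \<in> carrier T"
    and idem_v: "i \<in> {1..n} \<Longrightarrow> h (diagonal_idem i) \<otimes>\<^bsub>T\<^esub> v i = v i"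
    and v_idem: "i \<in> {1..n} \<Longrightarrow> v i \<otimes>\<^bsub>T\<^esub> h (diagonal_idem n) = v i"
    and v_unit: "i \<in> {1..n} \<Longrightarrow> v i \<otimes>\<^bsub>T\<^esub> h (last_row_unit i) = h (diagonal_idem i)"
    and unit_v: "i \<in> {1..n} \<Longrightarrow> h (last_row_unit i) \<otimes>\<^bsub>T\<^esub> v i = h (diagonal_idem n)"
begin

lemma n_mem: "n \<in> {1..n}" "1 \<in> {1..n}" "1 < n" using n by auto

lemma h_closed [simp]: "a \<in> carrier A \<Longrightarrow> h a \<in> carrier T" using h by (rule ring_hom_closed)
lemma h_mult: "\<lbrakk>a \<in> carrier A; b \<in> carrier A\<rbrakk> \<Longrightarrow> h (a \<otimes>\<^bsub>A\<^esub> b) = h a \<otimes>\<^bsub>T\<^esub> h b"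
  using h by (rule ring_hom_mult)
lemma h_zero: "h \<zero>\<^bsub>A\<^esub> = \<zero>\<^bsub>T\<^esub>"
  using h A.ring_axioms T.ring_axioms by (rule ring_hom_zero)

text \<open>
  The idempotents $h(e_i)$ are orthogonal and sum to one, and $v_i$ and $h(c_i)$ identify each of
  them with $h(e_n)$.
\<close>

sublocale matrix_units T n "h (diagonal_idem n)" v "\<lambda>i. h (last_row_unit i)"
proof
  fix i j assume ij: "i \<in> {1..n}" "j \<in> {1..n}"
  have "h (last_row_unit i) \<otimes>\<^bsub>T\<^esub> v j = \<zero>\<^bsub>T\<^esub>" if "i \<noteq> j"
  proof -
    have "h (last_row_unit i) \<otimes>\<^bsub>T\<^esub> v j =
        h (last_row_unit i \<otimes>\<^bsub>A\<^esub> diagonal_idem i) \<otimes>\<^bsub>T\<^esub> (h (diagonal_idem j) \<otimes>\<^bsub>T\<^esub> v j)"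
      using ij by (simp add: last_row_unit_idem idem_v)
    also have "\<dots> = h (last_row_unit i) \<otimes>\<^bsub>T\<^esub> h (diagonal_idem i \<otimes>\<^bsub>A\<^esub> diagonal_idem j) \<otimes>\<^bsub>T\<^esub> v j"
      using ij by (simp add: h_mult last_row_unit(1) diagonal_idem(1) v_closed T.m_assoc)
    also have "\<dots> = \<zero>\<^bsub>T\<^esub>"
      using ij that by (simp add: diagonal_idem_mult h_zero last_row_unit(1) v_closed)
    finally show ?thesis .
  qed
  then show "h (last_row_unit i) \<otimes>\<^bsub>T\<^esub> v j = (if i = j then h (diagonal_idem n) else \<zero>\<^bsub>T\<^esub>)"
    using ij unit_v by simp
next
  interpret h: ring_hom_ring A T h
    using A.ring_axioms T.ring_axioms h by (intro ring_hom_ringI2)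
  have "(\<Oplus>\<^bsub>T\<^esub>i\<in>{1..n}. v i \<otimes>\<^bsub>T\<^esub> h (last_row_unit i)) = (\<Oplus>\<^bsub>T\<^esub>i\<in>{1..n}. h (diagonal_idem i))"
    by (rule T.finsum_cong') (auto simp: v_unit diagonal_idem(1))
  also have "\<dots> = h (\<Oplus>\<^bsub>A\<^esub>i\<in>{1..n}. diagonal_idem i)"
    by (subst h.hom_finsum) (auto simp: diagonal_idem(1) comp_def)
  finally show "(\<Oplus>\<^bsub>T\<^esub>i\<in>{1..n}. v i \<otimes>\<^bsub>T\<^esub> h (last_row_unit i)) = \<one>\<^bsub>T\<^esub>"
    unfolding diagonal_idem_sum by simp
qed (auto simp: v_closed v_idem last_row_unit(1) diagonal_idem(1))

text \<open>
  An entry $s$ of a triangular matrix in column $j$, seen as an element of the corner $h(e_n)Th(e_n)$: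
  it is placed in the last row, and $v_j$ moves it on to position $(n,n)$.
\<close>

definition corner_map :: "nat \<Rightarrow> 's \<Rightarrow> 't" where
  "corner_map j s = h (elementary n j s) \<otimes>\<^bsub>T\<^esub> v j"

lemma corner_map_closed: "\<lbrakk>1 \<le> j; j < n; s \<in> carrier S\<rbrakk> \<Longrightarrow> corner_map j s \<in> carrier T"
  by (simp add: corner_map_def elementary v_closed)

lemma corner_map_corner:
  assumes "1 \<le> j" "j < n" "s \<in> carrier S"
  shows "h (diagonal_idem n) \<otimes>\<^bsub>T\<^esub> corner_map j s = corner_map j s" "corner_map j s \<otimes>\<^bsub>T\<^esub> h (diagonal_idem n) = corner_map j s"
  using assms elementary_idem(1)[of j n s]
    T.m_assoc[of "h (diagonal_idem n)" "h (elementary n j s)" "v j"]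
  by (simp_all add: corner_map_def elementary v_closed diagonal_idem(1) T.m_assoc v_idem flip: h_mult)

lemma corner_map_add:
  "\<lbrakk>1 \<le> j; j < n; s \<in> carrier S; t \<in> carrier S\<rbrakk> \<Longrightarrow> corner_map j (s \<oplus>\<^bsub>S\<^esub> t) = corner_map j s \<oplus>\<^bsub>T\<^esub> corner_map j t"
  by (simp add: corner_map_def elementary_add ring_hom_add[OF h] elementary v_closed T.l_distr)

lemma corner_map_zero: "\<lbrakk>1 \<le> j; j < n\<rbrakk> \<Longrightarrow> corner_map j \<zero>\<^bsub>S\<^esub> = \<zero>\<^bsub>T\<^esub>"
  by (simp add: corner_map_def elementary_zero h_zero v_closed)

lemma corner_map_one: "\<lbrakk>1 \<le> j; j < n\<rbrakk> \<Longrightarrow> corner_map j \<one>\<^bsub>S\<^esub> = h (diagonal_idem n)"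
  using unit_v[of j] by (simp add: corner_map_def last_row_unit_elementary)

text \<open>
  In \<open>A\<close> an entry in position $(n,l)$ times one in position $(l,j)$ lands in $(n,j)$. In \<open>T\<close> the
  product $v_l\,h(c_l)$ is $h(e_l)$, which brings the second factor from row $n$ back to row $l$, and so
  turns this into a rule for the corner.
\<close>

lemma corner_map_mult_descending:
  assumes jl: "1 \<le> j" "j < l" "l < n" and st: "s \<in> carrier S" "t \<in> carrier S"
  shows "corner_map l s \<otimes>\<^bsub>T\<^esub> corner_map j t = corner_map j (s \<otimes>\<^bsub>S\<^esub> t)"
proof -
  note cl = elementary(1) last_row_unit(1) diagonal_idem(1) v_closed
  have l: "l \<in> {1..n}" "j \<in> {1..n}" using jl by auto
  have "corner_map l s \<otimes>\<^bsub>T\<^esub> corner_map j t =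
      h (elementary n l s) \<otimes>\<^bsub>T\<^esub> v l \<otimes>\<^bsub>T\<^esub> (h (last_row_unit l \<otimes>\<^bsub>A\<^esub> elementary l j t) \<otimes>\<^bsub>T\<^esub> v j)"
    using jl st by (simp add: corner_map_def last_row_unit_elementary_mult)
  also have "\<dots> = h (elementary n l s) \<otimes>\<^bsub>T\<^esub> (v l \<otimes>\<^bsub>T\<^esub> h (last_row_unit l)) \<otimes>\<^bsub>T\<^esub> h (elementary l j t) \<otimes>\<^bsub>T\<^esub> v j"
    using jl l st by (simp add: cl h_mult T.m_assoc)
  also have "\<dots> = h (elementary n l s \<otimes>\<^bsub>A\<^esub> diagonal_idem l \<otimes>\<^bsub>A\<^esub> elementary l j t) \<otimes>\<^bsub>T\<^esub> v j"
    using jl l st by (simp add: cl h_mult v_unit)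
  also have "\<dots> = corner_map j (s \<otimes>\<^bsub>S\<^esub> t)"
    using jl st by (simp add: elementary_idem elementary_mult corner_map_def)
  finally show ?thesis .
qed

text \<open>
  The case $t = 1$ of the previous rule.
\<close>

lemma corner_map_independent:
  assumes "1 \<le> j" "j < n" "s \<in> carrier S"
  shows "corner_map j s = corner_map 1 s"
proof (cases "j = 1")
  case False
  then show ?thesis
    using corner_map_mult_descending[of 1 j s "\<one>\<^bsub>S\<^esub>"] corner_map_one[of 1] corner_map_corner(2)[of j s] assms by simp
qed simp

text \<open>
  The combination of the two rules needs two columns to the left of the last one, here the columns
  1 and 2; this is the use of $n \<ge> 3$.
\<close>

lemma corner_map_mult:
  assumes "s \<in> carrier S" "t \<in> carrier S"
  shows "corner_map 1 (s \<otimes>\<^bsub>S\<^esub> t) = corner_map 1 s \<otimes>\<^bsub>T\<^esub> corner_map 1 t"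
  using corner_map_mult_descending[of 1 2 s t] corner_map_independent[of 2 s] assms n by simp

lemma corner_map_finsum:
  assumes "finite I" "\<And>i. i \<in> I \<Longrightarrow> f i \<in> carrier S"
  shows "corner_map 1 (\<Oplus>\<^bsub>S\<^esub>i\<in>I. f i) = (\<Oplus>\<^bsub>T\<^esub>i\<in>I. corner_map 1 (f i))"
  using assms
proof (induction I rule: finite_induct)
  case empty
  then show ?case using corner_map_zero[of 1] n by simp
next
  case (insert i I)
  then show ?case using n_mem(3)
    by (simp add: S.finsum_insert T.finsum_insert corner_map_add corner_map_closed Pi_iff)
qed

text \<open>
  Right multiplication by $v_j = h(e_j) v_j$ selects column $j$ and left multiplication by $h(c_i)$
  selects row $i$. The corner maps are only available for columns before the last, so the entry in
  position $(n,n)$ is first moved to column 1, by writing $h(e_n)$ as $h(c_1) v_1$.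
\<close>

lemma entry_h:
  assumes a: "a \<in> carrier A" and i: "i \<in> {1..n}" and j: "j \<in> {1..n}"
  shows "entry i j (h a) = corner_map 1 (E a (i, j))"
proof -
  note cl = a i j last_row_unit(1) diagonal_idem(1) v_closed
  have *: "entry i j (h a) = h (last_row_unit i \<otimes>\<^bsub>A\<^esub> a \<otimes>\<^bsub>A\<^esub> diagonal_idem j) \<otimes>\<^bsub>T\<^esub> v j"
    unfolding entry_def using cl by (simp add: h_mult T.m_assoc idem_v)
  consider "j < n" | "j = n" "i < n" | "j = n" "i = n" using i j by fastforce
  then show ?thesis
  proof cases
    case 1
    then show ?thesis
      using * compress_left[of a i j] corner_map_independent[of j "E a (i, j)"] A_el(2)[OF a i j] a i j
      by (simp add: corner_map_def)
  next
    case 2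
    then show ?thesis
      using * compress_zero[of a i] corner_map_zero[of 1] a i v_closed[OF j] n by (simp add: h_zero entry_above)
  next
    case 3
    \<comment> \<open>Here $c_n = e_n$, because $s_n$ is the identity.\<close>
    have "v n = h (diagonal_idem n)"
      using v_idem[OF n_mem(1)] v_unit[OF n_mem(1)] n by (simp add: last_row_unit_last)
    then have "entry n n (h a) = h (diagonal_idem n) \<otimes>\<^bsub>T\<^esub> h a \<otimes>\<^bsub>T\<^esub> (h (last_row_unit 1) \<otimes>\<^bsub>T\<^esub> v 1)"
      unfolding entry_def unit_v[OF n_mem(2)] using n by (simp add: last_row_unit_last)
    also have "\<dots> = h (diagonal_idem n \<otimes>\<^bsub>A\<^esub> a \<otimes>\<^bsub>A\<^esub> last_row_unit 1) \<otimes>\<^bsub>T\<^esub> v 1"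
      using cl n_mem by (simp add: h_mult T.m_assoc)
    also have "\<dots> = corner_map 1 (E a (n, n))"
      unfolding compress_last[OF a n_mem(3)] corner_map_def ..
    finally show ?thesis using 3 by simp
  qed
qed

text \<open>
  The matrix over the corner with entries $\<beta>(m_{ij})$, for the ring homomorphism
  $\<beta>$ from $S$ given by the first corner map. Outside the carrier it is undefined, as extensionality requires.
\<close>

definition lift :: "(nat \<times> nat \<Rightarrow> 's) \<Rightarrow> 't" where
  "lift = (\<lambda>m\<in>carrier M. assemble (\<lambda>i j. corner_map 1 (m (i, j))))"

lemma lift_closed: "m \<in> carrier M \<Longrightarrow> lift m \<in> carrier T"
  using n_mem by (auto simp: lift_def matrix_el intro!: assemble_closed corner_map_closed)

lemma entry_lift:
  assumes m: "m \<in> carrier M" and ij: "i \<in> {1..n}" "j \<in> {1..n}"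
  shows "entry i j (lift m) = corner_map 1 (m (i, j))"
  unfolding lift_def restrict_apply if_P[OF m]
  by (rule entry_assemble[OF _ _ _ ij]; intro corner_map_closed corner_map_corner matrix_el[OF m] n_mem order_refl)

lemma lift_hom: "lift \<in> ring_hom M T"
proof (rule ring_hom_memI)
  fix x y assume x: "x \<in> carrier M" and y: "y \<in> carrier M"
  show "lift (x \<otimes>\<^bsub>M\<^esub> y) = lift x \<otimes>\<^bsub>T\<^esub> lift y"
  proof (rule entry_eqI)
    fix i j assume ij: "i \<in> {1..n}" "j \<in> {1..n}"
    have "entry i j (lift (x \<otimes>\<^bsub>M\<^esub> y)) = corner_map 1 (\<Oplus>\<^bsub>S\<^esub>l\<in>{1..n}. x (i, l) \<otimes>\<^bsub>S\<^esub> y (l, j))"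
      using ij x y by (simp only: entry_lift M.m_closed matrix_entry)
    also have "\<dots> = (\<Oplus>\<^bsub>T\<^esub>l\<in>{1..n}. corner_map 1 (x (i, l) \<otimes>\<^bsub>S\<^esub> y (l, j)))"
      using ij x y by (intro corner_map_finsum) (auto simp: matrix_el)
    also have "\<dots> = (\<Oplus>\<^bsub>T\<^esub>l\<in>{1..n}. entry i l (lift x) \<otimes>\<^bsub>T\<^esub> entry l j (lift y))"
      using ij x y by (intro T.finsum_cong') (auto simp: matrix_el corner_map_mult corner_map_closed n_mem entry_lift simp del: One_nat_def)
    also have "\<dots> = entry i j (lift x \<otimes>\<^bsub>T\<^esub> lift y)"
      using ij x y by (intro entry_mult[symmetric] lift_closed)
    finally show "entry i j (lift (x \<otimes>\<^bsub>M\<^esub> y)) = entry i j (lift x \<otimes>\<^bsub>T\<^esub> lift y)" .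
  qed (use x y in \<open>simp_all add: lift_closed\<close>)
  show "lift (x \<oplus>\<^bsub>M\<^esub> y) = lift x \<oplus>\<^bsub>T\<^esub> lift y"
    by (rule entry_eqI)
      (use x y n_mem in \<open>simp_all add: lift_closed entry_lift entry_add matrix_entry corner_map_add matrix_el\<close>)
next
  show "lift \<one>\<^bsub>M\<^esub> = \<one>\<^bsub>T\<^esub>"
    by (rule entry_eqI)
      (use n_mem in \<open>simp_all add: lift_closed entry_lift entry_one matrix_entry corner_map_one corner_map_zero\<close>)
qed (rule lift_closed)

lemma lift_to_matrix: "a \<in> carrier A \<Longrightarrow> lift (\<iota> a) = h a"
  by (rule entry_eqI)
    (simp_all add: lift_closed ring_hom_closed[OF to_matrix_hom] entry_lift entry_h to_matrix_entry)

text \<open>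
  The image under $g$ of the matrix unit in position $(i,n)$ has the properties that characterize $v_i$.
  Hence the entries of $g(m)$ are the images of the entries of $m$, moved to position $(n,n)$; and such
  a matrix is a product of the unit in position $(1,n)$ with a triangular matrix, on
  which $g$ is prescribed.
\<close>

lemma lift_unique:
  assumes g: "g \<in> ring_hom M T" and gh: "\<And>a. a \<in> carrier A \<Longrightarrow> g (\<iota> a) = h a"
    and m: "m \<in> carrier M"
  shows "g m = lift m"
proof -
  have gc: "g x \<in> carrier T" if "x \<in> carrier M" for x using g that by (rule ring_hom_closed)
  have gm: "g (x \<otimes>\<^bsub>M\<^esub> y) = g x \<otimes>\<^bsub>T\<^esub> g y" if "x \<in> carrier M" "y \<in> carrier M" for x y
    using g that by (rule ring_hom_mult)
  have units: "h (diagonal_idem i) = g (matrix_unit i i \<one>\<^bsub>S\<^esub>)"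
    "h (last_row_unit i) = g (matrix_unit n i \<one>\<^bsub>S\<^esub>)" if "i \<in> {1..n}" for i
    using gh[of "diagonal_idem i"] gh[of "last_row_unit i"] that
    by (simp_all add: diagonal_idem(1) last_row_unit(1) to_matrix_unit)
  have v: "v i = g (matrix_unit i n \<one>\<^bsub>S\<^esub>)" if i: "i \<in> {1..n}" for i
    by (rule T.left_ideal_bij_inverse_unique[of "h (diagonal_idem n)" "h (diagonal_idem i)" "h (last_row_unit i)"])
      (use i n_mem idem_v[OF i] unit_v[OF i] in \<open>simp_all add: diagonal_idem(1) last_row_unit(1) v_closed gc matrix_unit(1)
        matrix_unit_matrix_unit units flip: gm\<close>)
  show ?thesis
  proof (rule entry_eqI)
    fix i j assume ij: "i \<in> {1..n}" "j \<in> {1..n}"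
    note s = matrix_el[OF m ij]
    have "entry i j (g m) = g (matrix_unit n i \<one>\<^bsub>S\<^esub> \<otimes>\<^bsub>M\<^esub> m \<otimes>\<^bsub>M\<^esub> matrix_unit j n \<one>\<^bsub>S\<^esub>)"
      using ij m by (simp add: entry_def units v gm matrix_unit(1))
    \<comment> \<open>Position $(n,n)$ is reached through position $(n,1)$, which lies below the diagonal.\<close>
    also have "\<dots> = g (matrix_unit n 1 (m (i, j)) \<otimes>\<^bsub>M\<^esub> matrix_unit 1 n \<one>\<^bsub>S\<^esub>)"
      using ij m s n_mem by (simp add: matrix_unit_compress matrix_unit_matrix_unit)
    also have "\<dots> = g (\<iota> (elementary n 1 (m (i, j)))) \<otimes>\<^bsub>T\<^esub> v 1"
      using s n_mem by (simp add: gm matrix_unit(1) to_matrix_unit v)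
    also have "\<dots> = corner_map 1 (m (i, j))"
      using s n_mem by (simp add: gh elementary(1) corner_map_def)
    finally show "entry i j (g m) = entry i j (lift m)" using entry_lift[OF m ij] by simp
  qed (use m in \<open>simp_all add: gc lift_closed\<close>)
qed

end

theorem theorem2p12:
  fixes k :: "'k ring" and S :: "'s ring" and \<phi> :: "'k \<Rightarrow> 's" and n :: nat
  assumes "ring k" and "ring S" and "\<phi> \<in> ring_hom k S"
    and "flat k (left_restrict \<phi> S)"
    and "n \<ge> 3"
  shows "universally_inverting TYPE('t) (triangular_ring n k S \<phi>) (column_maps n k S \<phi>)
           (matrix_ring n S) (triangular_to_matrix n S \<phi>)"
proof -
  interpret triangular k S \<phi> n
    using assms by (intro triangular.intro triangular_axioms.intro)
  have "\<exists>!g. g \<in> ring_hom M T \<inter> extensional (carrier M) \<and> (\<forall>a\<in>carrier A. g (\<iota> a) = h a)"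
    if inv: "inverting A (column_maps n k S \<phi>) T h" for T :: "'t ring" and h
  proof -
    have T: "ring T" and h: "h \<in> ring_hom A T" using inv by (auto simp: inverting_def)
    obtain v where v: "\<And>i. i \<in> {1..n} \<Longrightarrow> v i \<in> carrier T \<and>
       h (diagonal_idem i) \<otimes>\<^bsub>T\<^esub> v i = v i \<and> v i \<otimes>\<^bsub>T\<^esub> h (diagonal_idem n) = v i \<and>
       v i \<otimes>\<^bsub>T\<^esub> h (last_row_unit i) = h (diagonal_idem i) \<and>
       h (last_row_unit i) \<otimes>\<^bsub>T\<^esub> v i = h (diagonal_idem n)"
      using inv unfolding inverting_iff[OF T h] by metis
    interpret inverted_triangular k S \<phi> n T h v
      by (intro inverted_triangular.intro inverted_triangular_axioms.intro triangular_axioms T)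
        (use v h \<open>n \<ge> 3\<close> in auto)
    show ?thesis
    proof (rule ex1I[of _ lift])
      show "lift \<in> ring_hom M T \<inter> extensional (carrier M) \<and> (\<forall>a\<in>carrier A. lift (\<iota> a) = h a)"
        using lift_hom lift_to_matrix by (auto simp: lift_def)
      fix g assume g: "g \<in> ring_hom M T \<inter> extensional (carrier M) \<and> (\<forall>a\<in>carrier A. g (\<iota> a) = h a)"
      show "g = lift"
        by (rule extensionalityI[of _ "carrier M"]) (use g lift_unique in \<open>auto simp: lift_def\<close>)
    qed
  qed
  then show ?thesis using inverting_to_matrix by (simp add: universally_inverting_def)
qed

end
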